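(* Let $p:\mathbb{R}^d\to\mathbb{R}$ be a probability density function of the form $$p(x)=\exp\left(-\frac{\|x\|^2}{2}+a(x)\right),$$ such that $a\in\mathcal{H}^\beta_K(\mathbb{R}^d,\mathbb{R})$ with $\beta\ge1$ and $K>0$, and let $s$ be the score function associated with the Ornstein–Uhlenbeck process started at $p$. Then, for all $t\in[0,1)$, $$\sum_{k=0}^{\lfloor\beta\rfloor}\sup_{x\in\mathbb{R}^d}\|\nabla^k s(t,x)\|\le Ce^{-t}(1+t^{-1/2})$$ and $$\sup_{x\in\mathbb{R}^d}\|\nabla^{\lfloor\beta\rfloor+1}s(t,x)\|\le Ce^{-t}\big(1+t^{(\beta-\lfloor\beta\rfloor)/2-1}\big),$$ where $\nabla^k$ denotes the $k$-th differential in $x$ and $C>0$ is a constant depending only on $\beta$, $d$ and $K$.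
   Context: Let $d\in\mathbb{N}_{>0}$, let $\gamma_d$ be the standard Gaussian measure on $\mathbb{R}^d$ (and its density), $r(x)=p(x)/\gamma_d(x)$ and $Q_sr(x)=\int r(sx+\sqrt{1-s^2}z)\,d\gamma_d(z)$. Let $dY_t=-Y_tdt+\sqrt2\,dB_t$ with $Y_0\sim p$, where $B_t$ is a Brownian motion in $\mathbb{R}^d$, and let $\mu_t$ be the law (density) of $Y_t$. The score function is $s(t,x)=\nabla\log\mu_t(x)=-x+\nabla\log Q_{e^{-t}}r(x)$. $\lfloor\beta\rfloor=\max\{k\in\mathbb{N}_0:k\le\beta\}$. $\mathcal{H}^\beta_K(\mathbb{R}^d,\mathbb{R})$ is the set of $f\in C^{\lfloor\beta\rfloor}(\mathbb{R}^d,\mathbb{R})$ ($\lfloor\beta\rfloor$ times differentiable functions, almost everywhere) with $$\sum_{|\nu|\le\lfloor\beta\rfloor}\|\partial^\nu f\|_{L^\infty}+\sum_{|\nu|=\lfloor\beta\rfloor}\sup_{x\neq y}\frac{|\partial^\nu f(x)-\partial^\nu f(y)|}{\|x-y\|^{\beta-\lfloor\beta\rfloor}}\le K,$$ $\nu$ ranging over multi-indices in $\mathbb{N}_0^d$.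
   Formalization: The k = 0 term is sup‖s(t,x)+x‖, since sup‖s(t,x)‖ is infinite (p Gaussian: s = −x). "Differentiable almost everywhere" is read with Lipschitz derivatives of order ⌊β⌋−1, as step functions refute the bound. C is taken per sample space; s depends on p alone. *)

theory Defs
  imports "HOL-Probability.Probability" "HOL-Probability.Essential_Supremum"
begin

section \<open>Iterated derivatives\<close>

text \<open>
  If \<open>f\<close> is \<open>k\<close> times differentiable, \<open>dir_deriv [v1, \<dots>, vk] f x\<close> is the value
  at \<open>(v1, \<dots>, vk)\<close> of the \<open>k\<close>-linear map \<open>D\<^sup>k f(x)\<close>.
\<close>

primrec dir_deriv ::
    "'a list \<Rightarrow> ('a::real_normed_vector \<Rightarrow> 'b::real_normed_vector) \<Rightarrow> 'a \<Rightarrow> 'b" where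
  "dir_deriv [] f = f"
| "dir_deriv (v # vs) f = dir_deriv vs (\<lambda>x. frechet_derivative f (at x) v)"

text \<open>In finite dimension \<open>Df\<close> is differentiable iff all its evaluations \<open>x \<mapsto> Df(x)v\<close> are.\<close>

primrec times_differentiable ::
    "nat \<Rightarrow> ('a::euclidean_space \<Rightarrow> 'b::real_normed_vector) \<Rightarrow> bool" where
  "times_differentiable 0 f \<longleftrightarrow> True"
| "times_differentiable (Suc k) f \<longleftrightarrow>
     (\<forall>x. f differentiable (at x)) \<and>
     (\<forall>v. times_differentiable k (\<lambda>x. frechet_derivative f (at x) v))"

text \<open>The operator norm of the \<open>k\<close>-linear map \<open>D\<^sup>k f(x)\<close>.\<close>

definition deriv_norm ::
    "nat \<Rightarrow> ('a::euclidean_space \<Rightarrow> 'b::real_normed_vector) \<Rightarrow> 'a \<Rightarrow> ennreal" where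
  "deriv_norm k f x =
     (SUP vs \<in> {vs. length vs = k \<and> (\<forall>v\<in>set vs. norm v \<le> 1)}. ennreal (norm (dir_deriv vs f x)))"

definition grad :: "(real ^ 'n \<Rightarrow> real) \<Rightarrow> real ^ 'n \<Rightarrow> real ^ 'n" where
  "grad f x = (\<chi> i. frechet_derivative f (at x) (axis i 1))"


section \<open>H\<ouml>lder classes\<close>

definition mi_order :: "('n::finite \<Rightarrow> nat) \<Rightarrow> nat" where
  "mi_order \<nu> = (\<Sum>i\<in>UNIV. \<nu> i)"

text \<open>
  The coordinate directions of \<open>\<partial>\<^sup>\<nu>\<close> are taken in an arbitrary order, which is immaterial where
  the derivative of order \<open>|\<nu>|\<close> exists.
\<close>

definition partial_deriv :: "('n::finite \<Rightarrow> nat) \<Rightarrow> (real ^ 'n \<Rightarrow> real) \<Rightarrow> real ^ 'n \<Rightarrow> real" where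
  "partial_deriv \<nu> f =
     dir_deriv (map (\<lambda>i. axis i 1) (SOME is. \<forall>i. count_list is i = \<nu> i)) f"

text \<open>For \<open>f\<close> that is \<open>k - 1\<close> times differentiable: the points where \<open>D\<^sup>k f\<close> exists.\<close>

definition diff_points :: "nat \<Rightarrow> ('a::euclidean_space \<Rightarrow> 'b::real_normed_vector) \<Rightarrow> 'a set" where
  "diff_points k f = {x. \<forall>vs. Suc (length vs) = k \<longrightarrow> dir_deriv vs f differentiable (at x)}"

text \<open>
  The class \<open>C\<^sup>k\<close> with the top derivative existing only almost everywhere. The derivatives of
  order \<open>k - 1\<close> are required to be Lipschitz (with an unspecified constant), so that they are
  determined by their almost everywhere derivatives; this is automatic if \<open>f\<close> is \<open>k\<close> times
  differentiable everywhere with bounded derivative of order \<open>k\<close>. Mere differentiability almost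
  everywhere would admit step functions and Cantor functions.
\<close>

definition C_ae :: "nat \<Rightarrow> ('a::euclidean_space \<Rightarrow> real) \<Rightarrow> bool" where
  "C_ae k f \<longleftrightarrow>
     (case k of
        0 \<Rightarrow> continuous_on UNIV f
      | Suc m \<Rightarrow>
          times_differentiable m f \<and>
          (\<forall>vs. length vs = m \<longrightarrow> (\<exists>L. L-lipschitz_on UNIV (dir_deriv vs f))) \<and>
          (AE x in lborel. x \<in> diff_points k f))"

definition holder_norm :: "real \<Rightarrow> (real ^ 'n::finite \<Rightarrow> real) \<Rightarrow> ennreal" where
  "holder_norm \<beta> f =
     (let k = nat \<lfloor>\<beta>\<rfloor> in
       (\<Sum>\<nu> | mi_order \<nu> \<le> k. esssup lborel (\<lambda>x. ennreal \<bar>partial_deriv \<nu> f x\<bar>)) +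
       (\<Sum>\<nu> | mi_order \<nu> = k.
          SUP (x, y) \<in> {(x, y). x \<in> diff_points k f \<and> y \<in> diff_points k f \<and> x \<noteq> y}.
            ennreal (\<bar>partial_deriv \<nu> f x - partial_deriv \<nu> f y\<bar> / norm (x - y) powr (\<beta> - real k))))"

definition holder_class :: "real \<Rightarrow> real \<Rightarrow> (real ^ 'n::finite \<Rightarrow> real) set" where
  "holder_class \<beta> K = {f. C_ae (nat \<lfloor>\<beta>\<rfloor>) f \<and> holder_norm \<beta> f \<le> ennreal K}"


section \<open>The Ornstein--Uhlenbeck process and its score\<close>

text \<open>Brownian motion indexed by \<open>t \<ge> 0\<close>; the values at negative times are irrelevant.\<close>

definition brownian_motion :: "'w measure \<Rightarrow> (real \<Rightarrow> 'w \<Rightarrow> real ^ 'n::finite) \<Rightarrow> bool" where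
  "brownian_motion M B \<longleftrightarrow>
     prob_space M \<and>
     (\<forall>t\<ge>0. B t \<in> borel_measurable M) \<and>
     (AE \<omega> in M. B 0 \<omega> = 0) \<and>
     (AE \<omega> in M. continuous_on {0..} (\<lambda>t. B t \<omega>)) \<and>
     (\<forall>s t. 0 \<le> s \<and> s < t \<longrightarrow>
        distributed M lborel (\<lambda>\<omega>. B t \<omega> - B s \<omega>)
          (\<lambda>x. ennreal (\<Prod>i\<in>UNIV. normal_density 0 (sqrt (t - s)) (x $ i)))) \<and>
     (\<forall>\<tau> (n::nat). 0 \<le> \<tau> 0 \<and> mono \<tau> \<longrightarrow>
        prob_space.indep_vars M (\<lambda>_. borel) (\<lambda>j \<omega>. B (\<tau> (Suc j)) \<omega> - B (\<tau> j) \<omega>) {..<n})"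

text \<open>
  The equation \<open>dY\<^sub>t = -Y\<^sub>t dt + \<surd>2 dB\<^sub>t\<close>, \<open>Y\<^sub>0 \<sim> p\<close> with \<open>Y\<^sub>0\<close> independent of \<open>B\<close>. The
  noise is additive, so its integral form involves no stochastic integral.
\<close>

definition ornstein_uhlenbeck ::
    "'w measure \<Rightarrow> (real \<Rightarrow> 'w \<Rightarrow> real ^ 'n::finite) \<Rightarrow> (real ^ 'n \<Rightarrow> real)
      \<Rightarrow> (real \<Rightarrow> 'w \<Rightarrow> real ^ 'n) \<Rightarrow> bool" where
  "ornstein_uhlenbeck M B p Y \<longleftrightarrow>
     brownian_motion M B \<and>
     (\<forall>t\<ge>0. Y t \<in> borel_measurable M) \<and>
     distributed M lborel (Y 0) (\<lambda>x. ennreal (p x)) \<and>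
     prob_space.indep_set M
       (sets (vimage_algebra (space M) (Y 0) borel))
       (sets (vimage_algebra (space M) (\<lambda>\<omega>. \<lambda>t\<in>{0..}. B t \<omega>) (\<Pi>\<^sub>M t\<in>{0..}. borel))) \<and>
     (AE \<omega> in M. continuous_on {0..} (\<lambda>t. Y t \<omega>) \<and>
        (\<forall>t\<ge>0. Y t \<omega> = Y 0 \<omega> - integral {0..t} (\<lambda>u. Y u \<omega>) + sqrt 2 *\<^sub>R B t \<omega>))"

text \<open>Continuity selects the version of the density, which makes \<open>\<nabla> log \<mu>\<^sub>t\<close> meaningful pointwise.\<close>

definition marginal_densities ::
    "'w measure \<Rightarrow> (real \<Rightarrow> 'w \<Rightarrow> real ^ 'n::finite) \<Rightarrow> (real \<Rightarrow> real ^ 'n \<Rightarrow> real) \<Rightarrow> bool" where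
  "marginal_densities M Y \<mu> \<longleftrightarrow>
     (\<forall>t\<ge>0. continuous_on UNIV (\<mu> t) \<and> (\<forall>x. 0 \<le> \<mu> t x) \<and>
        distributed M lborel (Y t) (\<lambda>x. ennreal (\<mu> t x)))"

definition score :: "(real \<Rightarrow> real ^ 'n::finite \<Rightarrow> real) \<Rightarrow> real \<Rightarrow> real ^ 'n \<Rightarrow> real ^ 'n" where
  "score \<mu> t x = grad (\<lambda>y. ln (\<mu> t y)) x"

text \<open>A negative power \<open>t\<^sup>e\<close> of \<open>t \<ge> 0\<close>, infinite at \<open>t = 0\<close> (where \<open>0 powr e = 0\<close>).\<close>

definition neg_powr :: "real \<Rightarrow> real \<Rightarrow> ennreal" where
  "neg_powr t e = (if t = 0 then \<infinity> else ennreal (t powr e))"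

end

theory Submission
  imports Defs
begin

text \<open>
  Put \<open>s = e\<^sup>-\<^sup>t\<close> and \<open>\<sigma>\<^sup>2 = 1 - s\<^sup>2\<close>. Completing the square turns the density of \<open>Y\<^sub>t\<close> into
  \<open>exp (- |x|\<^sup>2 / 2) F x\<close> with \<open>F x = E exp (a (s x + \<sigma> Z))\<close>, so that the score is \<open>- x + \<nabla> ln F x\<close>.
  Up to order \<open>k = \<lfloor>\<beta>\<rfloor>\<close> the derivatives of \<open>F\<close> fall on \<open>exp \<circ> a\<close> and are bounded. The derivative of order
  \<open>k + 1\<close> costs a factor \<open>1 / \<sigma>\<close> by Gaussian integration by parts, and the one of order \<open>k + 2\<close> costs
  \<open>\<sigma> powr (\<theta> - 2)\<close> with \<open>\<theta> = \<beta> - k\<close>, since the Gaussian weight of second order has mean zero and the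
  derivative of order \<open>k\<close> is \<open>\<theta>\<close>-Hoelder. As \<open>F\<close> is bounded below and \<open>k \<ge> 1\<close>, the derivatives of \<open>ln F\<close>
  inherit these bounds, and \<open>\<sigma>\<^sup>2\<close> is of order \<open>t\<close>. To avoid derivatives that exist only almost everywhere,
  \<open>a\<close> is first mollified; the bounds are uniform in the mollification, and the derivatives of \<open>F\<close>
  depend continuously on \<open>a\<close> because they can be put on the Gaussian kernel.
\<close>

section \<open>Iterated derivatives\<close>

text \<open>Besides the analysis there is a probabilistic gap: the process is given by its integral
  equation, and its law at time t has to be extracted from that. Solving the equation for the
  increments of B expresses \<open>Y t - exp (- t) Y 0\<close> as a pathwise limit of weighted sums
  of independent increments, so no stochastic integral enters. Laws are compared only through
  Gaussian test kernels, because averaging a kernel over one more increment merely enlarges its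
  variance. Letting the kernel width tend to 0 yields an inequality between two continuous
  probability densities, which already forces equality. The form of the estimates is dictated by
  uniformity. The constant must not depend on a, t or the process, so the closure lemmas for exp,
  inverse and ln fix their constant before the function and, where \<sigma> enters, before the
  weights. Mollification is applied to a and not to its exponential: the Hoelder class controls a,
  and the chain rule for exp then concerns smooth functions.\<close>

lemma times_differentiable_SucD:
  "times_differentiable (Suc m) f \<Longrightarrow> times_differentiable m f"
proof (induction m arbitrary: f)
  case (Suc m)
  then show ?case
    by (subst times_differentiable.simps(2)) (metis times_differentiable.simps(2))
qed simp

lemma times_differentiable_mono:
  "m \<le> n \<Longrightarrow> times_differentiable n f \<Longrightarrow> times_differentiable m f"
  by (induction rule: inc_induct) (blast dest: times_differentiable_SucD)+

lemma frechet_derivative_eqI: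
  "(f has_derivative f') (at x) \<Longrightarrow> frechet_derivative f (at x) v = f' v"
  by (metis frechet_derivative_at)

lemma times_differentiable_SucI:
  assumes "\<And>x. (f has_derivative f' x) (at x)" "\<And>v. times_differentiable m (\<lambda>x. f' x v)"
  shows "times_differentiable (Suc m) f"
  using assms by (auto simp: frechet_derivative_eqI[OF assms(1)] differentiable_def)

lemma differentiable_has_derivative:
  "f differentiable (at x) \<Longrightarrow> (f has_derivative frechet_derivative f (at x)) (at x)"
  by (simp add: frechet_derivative_works)

section \<open>Closure of k-fold differentiability under algebra, exp, inverse and ln\<close>

lemma times_differentiable_const: "times_differentiable m (\<lambda>x. c)"
proof (induction m arbitrary: c)
  case (Suc m)
  show ?case by (rule times_differentiable_SucI[where f' = "\<lambda>_ _. 0"]) (use Suc in auto)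
qed simp

lemma times_differentiable_bounded_linear:
  assumes "bounded_linear f" shows "times_differentiable m f"
proof (cases m)
  case (Suc n)
  then show ?thesis
    using assms unfolding Suc by (intro times_differentiable_SucI[where f' = "\<lambda>_. f"])
      (auto intro!: times_differentiable_const bounded_linear_imp_has_derivative)
qed simp

lemma times_differentiable_add:
  "times_differentiable m f \<Longrightarrow> times_differentiable m g \<Longrightarrow> times_differentiable m (\<lambda>x. f x + g x)"
proof (induction m arbitrary: f g)
  case (Suc m)
  show ?case
    by (rule times_differentiable_SucI[where f' = "\<lambda>x v. frechet_derivative f (at x) v + frechet_derivative g (at x) v"])
      (use Suc in \<open>auto intro!: derivative_eq_intros differentiable_has_derivative\<close>)
qed simp

lemma times_differentiable_mult:
  fixes f g :: "'a::euclidean_space \<Rightarrow> real"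
  shows "times_differentiable m f \<Longrightarrow> times_differentiable m g \<Longrightarrow> times_differentiable m (\<lambda>x. f x * g x)"
proof (induction m arbitrary: f g)
  case (Suc m)
  show ?case
  proof (rule times_differentiable_SucI[where f' = "\<lambda>x v. f x * frechet_derivative g (at x) v + frechet_derivative f (at x) v * g x"])
    show "((\<lambda>x. f x * g x) has_derivative (\<lambda>v. f x * frechet_derivative g (at x) v + frechet_derivative f (at x) v * g x)) (at x)" for x
      using Suc.prems by (intro has_derivative_mult differentiable_has_derivative) auto
    show "times_differentiable m (\<lambda>x. f x * frechet_derivative g (at x) v + frechet_derivative f (at x) v * g x)" for v
      using Suc.prems times_differentiable_SucD[OF Suc.prems(1)] times_differentiable_SucD[OF Suc.prems(2)]
      by (intro times_differentiable_add Suc.IH) auto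
  qed
qed simp

lemma times_differentiable_exp:
  fixes f :: "'a::euclidean_space \<Rightarrow> real"
  shows "times_differentiable m f \<Longrightarrow> times_differentiable m (\<lambda>x. exp (f x))"
proof (induction m arbitrary: f)
  case (Suc m)
  show ?case
    by (rule times_differentiable_SucI[where f' = "\<lambda>x v. exp (f x) * frechet_derivative f (at x) v"])
      (use Suc times_differentiable_SucD[OF Suc.prems]
        in \<open>auto intro!: derivative_eq_intros differentiable_has_derivative times_differentiable_mult\<close>)
qed simp

lemma times_differentiable_inverse:
  fixes f :: "'a::euclidean_space \<Rightarrow> real"
  assumes "\<And>x. f x > 0"
  shows "times_differentiable m f \<Longrightarrow> times_differentiable m (\<lambda>x. inverse (f x))"
proof (induction m)
  case (Suc m)
  have td: "times_differentiable m (\<lambda>x. - 1 * (inverse (f x) * frechet_derivative f (at x) v * inverse (f x)))" for v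
    using Suc times_differentiable_SucD[OF Suc.prems]
    by (intro times_differentiable_mult times_differentiable_const) auto
  have nz: "f x \<noteq> 0" for x using assms[of x] by simp
  have "((\<lambda>x. inverse (f x)) has_derivative (\<lambda>v. - (inverse (f x) * frechet_derivative f (at x) v * inverse (f x)))) (at x)" for x
    using Suc.prems nz by (intro Deriv.has_derivative_inverse differentiable_has_derivative) auto
  with td show ?case
    by (intro times_differentiable_SucI[where f' = "\<lambda>x v. - (inverse (f x) * frechet_derivative f (at x) v * inverse (f x))"])
      simp_all
qed simp

lemma times_differentiable_ln:
  fixes f :: "'a::euclidean_space \<Rightarrow> real"
  assumes pos: "\<And>x. f x > 0" and td: "times_differentiable m f"
  shows "times_differentiable m (\<lambda>x. ln (f x))"
proof (cases m)
  case (Suc n)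
  have "times_differentiable n (\<lambda>x. frechet_derivative f (at x) v * inverse (f x))" for v
    using td Suc times_differentiable_SucD[OF td[unfolded Suc]]
    by (intro times_differentiable_mult times_differentiable_inverse[OF pos]) auto
  moreover have "((\<lambda>x. ln (f x)) has_derivative (\<lambda>v. frechet_derivative f (at x) v * inverse (f x))) (at x)" for x
    using td Suc by (intro has_derivative_ln pos differentiable_has_derivative) simp
  ultimately show ?thesis
    unfolding Suc by (intro times_differentiable_SucI)
qed simp

text \<open>All functions that are differentiated to high order below are mollified or convolved
  with a Gaussian, so every order can be demanded at once. This removes the counting of orders from
  the calculus.\<close>

definition smooth :: "('a::euclidean_space \<Rightarrow> real) \<Rightarrow> bool" where
  "smooth f \<longleftrightarrow> (\<forall>m. times_differentiable m f)"

lemma smooth_differentiable: "smooth f \<Longrightarrow> f differentiable (at x)"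
  unfolding smooth_def by (metis times_differentiable.simps(2))

lemma smooth_has_derivative: "smooth f \<Longrightarrow> (f has_derivative frechet_derivative f (at x)) (at x)"
  by (intro differentiable_has_derivative smooth_differentiable)

lemma smooth_frechet: "smooth f \<Longrightarrow> smooth (\<lambda>x. frechet_derivative f (at x) v)"
  unfolding smooth_def by (metis times_differentiable.simps(2))

lemma smooth_dir_deriv: "smooth f \<Longrightarrow> smooth (dir_deriv vs f)"
  by (induction vs arbitrary: f) (auto intro: smooth_frechet)

text \<open>Membership in S is preserved by directional derivatives, so induction on the order never
  leaves S. The intended S consists of Laplace transforms, whose derivatives are Laplace transforms
  of another weight.\<close>

lemma smooth_coinduct:
  assumes "f \<in> S"
    and "\<And>f. f \<in> S \<Longrightarrow> \<exists>f'. (\<forall>x. (f has_derivative f' x) (at x)) \<and> (\<forall>v. (\<lambda>x. f' x v) \<in> S)"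
  shows "smooth f"
proof -
  have "times_differentiable m f" if "f \<in> S" for m f
    using that
  proof (induction m arbitrary: f)
    case (Suc m)
    obtain f' where "\<forall>x. (f has_derivative f' x) (at x)" "\<forall>v. (\<lambda>x. f' x v) \<in> S"
      using assms(2) Suc.prems by blast
    then show ?case using Suc.IH by (intro times_differentiable_SucI) auto
  qed simp
  then show ?thesis using assms(1) unfolding smooth_def by blast
qed

lemma smooth_const: "smooth (\<lambda>x. c)"
  and smooth_add: "smooth f \<Longrightarrow> smooth g \<Longrightarrow> smooth (\<lambda>x. f x + g x)"
  and smooth_mult: "smooth f \<Longrightarrow> smooth g \<Longrightarrow> smooth (\<lambda>x. f x * g x)"
  and smooth_exp: "smooth f \<Longrightarrow> smooth (\<lambda>x. exp (f x))"
  and smooth_inverse: "(\<And>x. f x > 0) \<Longrightarrow> smooth f \<Longrightarrow> smooth (\<lambda>x. inverse (f x))"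
  and smooth_ln: "(\<And>x. f x > 0) \<Longrightarrow> smooth f \<Longrightarrow> smooth (\<lambda>x. ln (f x))"
  and smooth_bounded_linear: "bounded_linear f \<Longrightarrow> smooth f"
  unfolding smooth_def
  by (auto intro: times_differentiable_const times_differentiable_add times_differentiable_mult
      times_differentiable_exp times_differentiable_inverse times_differentiable_ln
      times_differentiable_bounded_linear)

lemma smooth_cmult: "smooth f \<Longrightarrow> smooth (\<lambda>x. c * f x)"
  by (intro smooth_mult smooth_const)

lemma smooth_inner: "smooth (\<lambda>x. v \<bullet> x)"
  by (intro smooth_bounded_linear bounded_linear_inner_right)

lemma smooth_inner_self: "smooth (\<lambda>x. x \<bullet> x)"
proof -
  have "smooth (\<lambda>x::'a. \<Sum>b\<in>Basis. (b \<bullet> x) * (b \<bullet> x))"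
  proof -
    have "finite B \<Longrightarrow> smooth (\<lambda>x::'a. \<Sum>b\<in>B. (b \<bullet> x) * (b \<bullet> x))" for B
      by (induction B rule: finite_induct) (simp_all add: smooth_const smooth_add smooth_mult smooth_inner)
    then show ?thesis by simp
  qed
  moreover have "(\<lambda>x::'a. \<Sum>b\<in>Basis. (b \<bullet> x) * (b \<bullet> x)) = (\<lambda>x. x \<bullet> x)"
    by (rule ext, subst (3) euclidean_inner) (simp add: inner_commute)
  ultimately show ?thesis by simp
qed

section \<open>The Leibniz rule for iterated directional derivatives\<close>

lemma dir_deriv_append: "dir_deriv (us @ vs) f = dir_deriv vs (dir_deriv us f)"
  by (induction us arbitrary: f) auto

lemma dir_deriv_const: "dir_deriv (v # vs) (\<lambda>x. c) = (\<lambda>x. 0)"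
proof (induction vs arbitrary: v c)
  case Nil
  then show ?case by (simp add: frechet_derivative_eqI[OF has_derivative_const])
next
  case (Cons a vs)
  have "(\<lambda>x. frechet_derivative (\<lambda>x. c) (at x) v) = (\<lambda>x. 0)"
    by (simp add: frechet_derivative_eqI[OF has_derivative_const])
  then show ?case using Cons[of a 0] by simp
qed

lemma frechet_add:
  "f differentiable (at x) \<Longrightarrow> g differentiable (at x) \<Longrightarrow>
    frechet_derivative (\<lambda>x. f x + g x) (at x) v = frechet_derivative f (at x) v + frechet_derivative g (at x) v"
  by (intro frechet_derivative_eqI has_derivative_add differentiable_has_derivative)

lemma frechet_mult:
  fixes f g :: "'a::euclidean_space \<Rightarrow> real"
  shows "f differentiable (at x) \<Longrightarrow> g differentiable (at x) \<Longrightarrow>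
    frechet_derivative (\<lambda>x. f x * g x) (at x) v = frechet_derivative f (at x) v * g x + f x * frechet_derivative g (at x) v"
  by (subst frechet_derivative_eqI[OF has_derivative_mult[OF differentiable_has_derivative differentiable_has_derivative]])
    auto

lemma frechet_cmult:
  fixes f :: "'a::euclidean_space \<Rightarrow> real"
  shows "f differentiable (at x) \<Longrightarrow> frechet_derivative (\<lambda>x. c * f x) (at x) v = c * frechet_derivative f (at x) v"
  by (intro frechet_derivative_eqI has_derivative_mult_right differentiable_has_derivative)

lemma dir_deriv_add:
  "smooth f \<Longrightarrow> smooth g \<Longrightarrow> dir_deriv vs (\<lambda>x. f x + g x) x = dir_deriv vs f x + dir_deriv vs g x"
  by (induction vs arbitrary: f g) (auto simp: frechet_add smooth_differentiable smooth_frechet)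

lemma dir_deriv_cmult:
  "smooth f \<Longrightarrow> dir_deriv vs (\<lambda>x. c * f x) x = c * dir_deriv vs f x"
  by (induction vs arbitrary: f) (auto simp: frechet_cmult smooth_differentiable smooth_frechet)

lemma smooth_sum: "(\<And>i. i \<in> A \<Longrightarrow> smooth (f i)) \<Longrightarrow> smooth (\<lambda>x. \<Sum>i\<in>A. f i x)"
  by (induction A rule: infinite_finite_induct) (auto intro: smooth_const smooth_add)

lemma dir_deriv_zero: "dir_deriv vs (\<lambda>x. 0) x = 0"
  by (cases vs) (auto simp: dir_deriv_const simp del: dir_deriv.simps(2))

lemma dir_deriv_sum:
  "(\<And>i. i \<in> A \<Longrightarrow> smooth (f i)) \<Longrightarrow> dir_deriv vs (\<lambda>x. \<Sum>i\<in>A. f i x) x = (\<Sum>i\<in>A. dir_deriv vs (f i) x)"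
  by (induction A rule: infinite_finite_induct) (auto simp: dir_deriv_zero dir_deriv_add smooth_sum)

text \<open>Each direction goes to one of the two factors of a product. Keeping all
  \<open>2 ^ length vs\<close> distributions in a list replaces the binomial coefficients of the
  Leibniz rule.\<close>

primrec splits :: "'a list \<Rightarrow> ('a list \<times> 'a list) list" where
  "splits [] = [([], [])]"
| "splits (v # vs) = map (\<lambda>(a, b). (v # a, b)) (splits vs) @ map (\<lambda>(a, b). (a, v # b)) (splits vs)"

lemma length_splits: "length (splits vs) = 2 ^ length vs"
  by (induction vs) auto

lemma splits_sub:
  "(a, b) \<in> set (splits vs) \<Longrightarrow>
    length a + length b = length vs \<and> set a \<subseteq> set vs \<and> set b \<subseteq> set vs"
  by (induction vs arbitrary: a b) fastforce+

lemma dir_deriv_mult: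
  "smooth f \<Longrightarrow> smooth g \<Longrightarrow>
    dir_deriv vs (\<lambda>x. f x * g x) x = (\<Sum>(a, b)\<leftarrow>splits vs. dir_deriv a f x * dir_deriv b g x)"
proof (induction vs arbitrary: f g)
  case (Cons v vs)
  then show ?case
    by (simp add: frechet_mult smooth_differentiable dir_deriv_add smooth_mult smooth_frechet
        o_def case_prod_unfold)
qed simp

lemma abs_sum_list_le:
  fixes F :: "'b \<Rightarrow> real" and C :: real
  shows "(\<And>p. p \<in> set xs \<Longrightarrow> \<bar>F p\<bar> \<le> C) \<Longrightarrow> \<bar>\<Sum>p\<leftarrow>xs. F p\<bar> \<le> length xs * C"
proof (induction xs)
  case (Cons p xs)
  have "\<bar>F p\<bar> \<le> C" "\<bar>\<Sum>p\<leftarrow>xs. F p\<bar> \<le> length xs * C" using Cons by auto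
  then show ?case by (simp add: algebra_simps)
qed simp

text \<open>The Leibniz sums at x and y run over the same list, so they are compared term by term.
  With c = 0 this bounds a value, with c = 1 an increment.\<close>

lemma dir_deriv_mult_bound:
  assumes "smooth f" "smooth g"
    and "\<And>a b. (a, b) \<in> set (splits vs) \<Longrightarrow>
      \<bar>dir_deriv a f x * dir_deriv b g x - c * (dir_deriv a f y * dir_deriv b g y)\<bar> \<le> C"
  shows "\<bar>dir_deriv vs (\<lambda>x. f x * g x) x - c * dir_deriv vs (\<lambda>x. f x * g x) y\<bar> \<le> 2 ^ length vs * C"
proof -
  have "\<bar>\<Sum>p\<leftarrow>splits vs. case p of (a, b) \<Rightarrow> dir_deriv a f x * dir_deriv b g x - c * (dir_deriv a f y * dir_deriv b g y)\<bar>
      \<le> length (splits vs) * C"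
    by (rule abs_sum_list_le) (use assms(3) in auto)
  then show ?thesis
    by (simp add: dir_deriv_mult[OF assms(1,2)] length_splits sum_list_subtractf sum_list_const_mult case_prod_unfold)
qed

text \<open>The mean value theorem in direction u turns the second difference into h times an
  increment of the derivative g of f along u, and differentiability of g at the single point x
  evaluates that increment. This is the form of Schwarz's theorem for twice differentiable
  functions, which matches \<open>times_differentiable\<close>.\<close>

lemma mixed_difference_limit:
  fixes f :: "'a::euclidean_space \<Rightarrow> real"
  assumes f: "\<And>x. f differentiable (at x)"
    and fu: "(\<lambda>x. frechet_derivative f (at x) u) differentiable (at x)"
  shows "((\<lambda>h. (f (x + h *\<^sub>R u + h *\<^sub>R v) - f (x + h *\<^sub>R u) - f (x + h *\<^sub>R v) + f x) / h\<^sup>2) \<longlongrightarrow>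
    frechet_derivative (\<lambda>x. frechet_derivative f (at x) u) (at x) v) (at_right 0)"
proof (rule tendstoI)
  fix e :: real assume "e > 0"
  define g where "g = (\<lambda>x. frechet_derivative f (at x) u)"
  define g' where "g' = frechet_derivative g (at x)"
  \<comment> \<open>The displacements below have norm at most \<open>h * M / 2\<close>; the summand
    1 keeps M positive when u = v = 0.\<close>
  define M where "M = 2 * (norm u + norm v) + 1"
  have M: "M > 0" unfolding M_def by (intro add_nonneg_pos mult_nonneg_nonneg add_nonneg_nonneg) auto
  have g': "(g has_derivative g') (at x)"
    unfolding g'_def using fu by (simp add: g_def differentiable_has_derivative)
  then have lin: "linear g'" using has_derivative_bounded_linear bounded_linear.linear by blast
  obtain d where d: "d > 0" "\<And>y. norm (y - x) < d \<Longrightarrow> norm (g y - g x - g' (y - x)) \<le> e / (2 * M) * norm (y - x)"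
    using g' \<open>e > 0\<close> M unfolding has_derivative_at_alt by (metis divide_pos_pos mult_pos_pos zero_less_numeral)
  have "eventually (\<lambda>h::real. h > 0 \<and> h < d / M) (at_right 0)"
    using d(1) M by (auto simp: eventually_at_right intro!: exI[of _ "d / M"])
  then show "\<forall>\<^sub>F h in at_right 0. dist ((f (x + h *\<^sub>R u + h *\<^sub>R v) - f (x + h *\<^sub>R u) - f (x + h *\<^sub>R v) + f x) / h\<^sup>2)
      (frechet_derivative (\<lambda>x. frechet_derivative f (at x) u) (at x) v) < e"
  proof eventually_elim
    case (elim h)
    define \<psi> where "\<psi> = (\<lambda>t. f (x + t *\<^sub>R u + h *\<^sub>R v) - f (x + t *\<^sub>R u))"
    have fd: "(f has_derivative frechet_derivative f (at y)) (at y)" for y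
      using f differentiable_has_derivative by blast
    have d1: "((\<lambda>t. f (y + t *\<^sub>R u)) has_real_derivative g (y + t *\<^sub>R u)) (at t)" for y t
    proof -
      have "((\<lambda>t. f (y + t *\<^sub>R u)) has_derivative (\<lambda>s. frechet_derivative f (at (y + t *\<^sub>R u)) (s *\<^sub>R u))) (at t)"
        by (rule has_derivative_compose[OF _ fd]) (auto intro!: derivative_eq_intros)
      moreover have "frechet_derivative f (at (y + t *\<^sub>R u)) (s *\<^sub>R u) = s * g (y + t *\<^sub>R u)" for s
        unfolding g_def using linear_frechet_derivative[OF f] by (simp add: linear_cmul)
      moreover have "(\<lambda>s. s * g (y + t *\<^sub>R u)) = (*) (g (y + t *\<^sub>R u))"
        by (simp add: fun_eq_iff)
      ultimately show ?thesis by (simp add: has_field_derivative_def)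
    qed
    have "(\<psi> has_real_derivative g (x + t *\<^sub>R u + h *\<^sub>R v) - g (x + t *\<^sub>R u)) (at t)" for t
      unfolding \<psi>_def using d1[of "x + h *\<^sub>R v" t] d1[of x t]
      by (auto intro!: derivative_eq_intros simp: algebra_simps)
    then obtain t where t: "0 < t" "t < h" "\<psi> h - \<psi> 0 = h * (g (x + t *\<^sub>R u + h *\<^sub>R v) - g (x + t *\<^sub>R u))"
      using MVT2[of 0 h \<psi> "\<lambda>t. g (x + t *\<^sub>R u + h *\<^sub>R v) - g (x + t *\<^sub>R u)"] elim by auto
    have n1: "norm (t *\<^sub>R u + h *\<^sub>R v) \<le> h * (norm u + norm v)"
      using norm_triangle_ineq[of "t *\<^sub>R u" "h *\<^sub>R v"] t mult_right_mono[of t h "norm u"]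
      by (auto simp: algebra_simps)
    have n2: "norm (t *\<^sub>R u) \<le> h * (norm u + norm v)"
      using t mult_mono[of t h "norm u" "norm u + norm v"] by auto
    have hM: "h * (norm u + norm v) \<le> h * M / 2" "h * M < d"
      using elim M by (auto simp: M_def field_simps)
    have b: "\<bar>g (x + w) - g x - g' w\<bar> \<le> e / (2 * M) * (h * (norm u + norm v))"
      if "norm w \<le> h * (norm u + norm v)" for w
    proof -
      have "0 < h * M" using elim M by simp
      then have "norm w < d" using that hM by linarith
      then have "\<bar>g (x + w) - g x - g' w\<bar> \<le> e / (2 * M) * norm w"
        using d(2)[of "x + w"] by simp
      also have "\<dots> \<le> e / (2 * M) * (h * (norm u + norm v))"
        using that \<open>e > 0\<close> M by (intro mult_left_mono) auto
      finally show ?thesis .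
    qed
    note b1 = b[OF n1] and b2 = b[OF n2]
    \<comment> \<open>Linearity of g' cancels the common displacement \<open>t u\<close> and leaves
      \<open>h * g' v\<close>; the two linearization errors add up to at most
      \<open>h * (e / 2)\<close>.\<close>
    have "g' (t *\<^sub>R u + h *\<^sub>R v) = g' (t *\<^sub>R u) + h * g' v"
      using lin by (simp add: linear_add linear_cmul)
    then have "\<bar>(g (x + t *\<^sub>R u + h *\<^sub>R v) - g (x + t *\<^sub>R u)) - h * g' v\<bar> \<le> 2 * (e / (2 * M) * (h * (norm u + norm v)))"
      using b1 b2 by (simp add: add.assoc)
    also have "\<dots> \<le> 2 * (e / (2 * M) * (h * M / 2))"
      using hM \<open>e > 0\<close> M by (intro mult_left_mono) auto
    also have "\<dots> = h * (e / 2)" using M by simp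
    finally have "\<bar>h * ((g (x + t *\<^sub>R u + h *\<^sub>R v) - g (x + t *\<^sub>R u)) - h * g' v)\<bar> \<le> h\<^sup>2 * (e / 2)"
      using elim by (simp add: abs_mult power2_eq_square)
    moreover have "\<psi> h - \<psi> 0 - h\<^sup>2 * g' v = h * ((g (x + t *\<^sub>R u + h *\<^sub>R v) - g (x + t *\<^sub>R u)) - h * g' v)"
      by (simp add: t(3) power2_eq_square right_diff_distrib)
    ultimately have "\<bar>\<psi> h - \<psi> 0 - h\<^sup>2 * g' v\<bar> \<le> h\<^sup>2 * (e / 2)" by simp
    moreover have "(\<psi> h - \<psi> 0) / h\<^sup>2 - g' v = (\<psi> h - \<psi> 0 - h\<^sup>2 * g' v) / h\<^sup>2"
      using elim by (simp add: diff_divide_distrib)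
    ultimately have "\<bar>(\<psi> h - \<psi> 0) / h\<^sup>2 - g' v\<bar> \<le> e / 2"
      using elim by (simp add: abs_divide pos_divide_le_eq mult.commute)
    then show ?case using \<open>e > 0\<close>
      by (simp add: \<psi>_def g'_def g_def dist_real_def algebra_simps)
  qed
qed

text \<open>The second difference is symmetric in u and v, so both iterated derivatives are its
  limit.\<close>

lemma frechet_derivative_commute:
  fixes f :: "'a::euclidean_space \<Rightarrow> real"
  assumes "times_differentiable 2 f"
  shows "frechet_derivative (\<lambda>x. frechet_derivative f (at x) u) (at x) v =
    frechet_derivative (\<lambda>x. frechet_derivative f (at x) v) (at x) u"
proof -
  have f: "f differentiable (at x)" "(\<lambda>x. frechet_derivative f (at x) u) differentiable (at x)" for x u
    using assms by (simp_all add: numeral_2_eq_2)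
  have eq: "(\<lambda>h::real. (f (x + h *\<^sub>R u + h *\<^sub>R v) - f (x + h *\<^sub>R u) - f (x + h *\<^sub>R v) + f x) / h\<^sup>2) =
    (\<lambda>h. (f (x + h *\<^sub>R v + h *\<^sub>R u) - f (x + h *\<^sub>R v) - f (x + h *\<^sub>R u) + f x) / h\<^sup>2)"
    by (simp add: algebra_simps)
  show ?thesis
    using mixed_difference_limit[OF f, of x u v] mixed_difference_limit[OF f, of x v u]
    unfolding eq by (rule tendsto_unique[rotated]) simp
qed

lemma dir_deriv_rotate:
  fixes f :: "'a::euclidean_space \<Rightarrow> real"
  assumes "times_differentiable (Suc (length vs)) f"
  shows "dir_deriv (v # vs) f = dir_deriv (vs @ [v]) f"
  using assms
proof (induction vs arbitrary: f)
  case (Cons u vs)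
  have "times_differentiable 2 f"
    by (rule times_differentiable_mono[OF _ Cons.prems]) simp
  then have "(\<lambda>x. frechet_derivative (\<lambda>x. frechet_derivative f (at x) v) (at x) u) =
      (\<lambda>x. frechet_derivative (\<lambda>x. frechet_derivative f (at x) u) (at x) v)"
    by (intro ext frechet_derivative_commute)
  then have "dir_deriv (v # u # vs) f = dir_deriv (v # vs) (\<lambda>x. frechet_derivative f (at x) u)"
    by simp
  also have "\<dots> = dir_deriv (vs @ [v]) (\<lambda>x. frechet_derivative f (at x) u)"
    using Cons.prems by (intro Cons.IH) auto
  finally show ?case by simp
qed simp

text \<open>\<open>partial_deriv\<close> leaves the order of the directions to a choice; this frees
  the bounds from that order. The induction pulls v to the front by rotating the prefix before
  it.\<close>

lemma dir_deriv_perm: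
  fixes f :: "'a::euclidean_space \<Rightarrow> real"
  assumes "times_differentiable (length vs) f" "mset vs = mset ws"
  shows "dir_deriv vs f = dir_deriv ws f"
  using assms
proof (induction vs arbitrary: ws f)
  case (Cons v vs)
  from Cons.prems(2) have "v \<in> set ws" by (metis list.set_intros(1) set_mset_mset)
  then obtain as bs where ws: "ws = as @ v # bs" by (meson split_list)
  have len: "length vs = length as + length bs"
    using Cons.prems(2) ws by (metis add_Suc_right length_Cons length_append nat.inject size_mset)
  have "dir_deriv ws f = dir_deriv bs (dir_deriv (as @ [v]) f)"
    by (simp add: ws dir_deriv_append[symmetric])
  also have "dir_deriv (as @ [v]) f = dir_deriv (v # as) f"
    by (rule dir_deriv_rotate[symmetric]) (rule times_differentiable_mono[OF _ Cons.prems(1)], simp add: len)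
  also have "dir_deriv bs (dir_deriv (v # as) f) = dir_deriv (as @ bs) (\<lambda>x. frechet_derivative f (at x) v)"
    by (simp add: dir_deriv_append)
  also have "\<dots> = dir_deriv vs (\<lambda>x. frechet_derivative f (at x) v)"
    using Cons.prems ws by (intro Cons.IH[symmetric]) auto
  finally show ?case by simp
qed simp

lemma frechet_expand:
  fixes f :: "'a::euclidean_space \<Rightarrow> real"
  assumes "f differentiable (at x)"
  shows "frechet_derivative f (at x) v = (\<Sum>b\<in>Basis. (v \<bullet> b) * frechet_derivative f (at x) b)"
proof -
  interpret linear "frechet_derivative f (at x)" by (rule linear_frechet_derivative[OF assms])
  have "frechet_derivative f (at x) v = frechet_derivative f (at x) (\<Sum>b\<in>Basis. (v \<bullet> b) *\<^sub>R b)"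
    by (simp add: euclidean_representation)
  then show ?thesis by (simp add: sum scaleR)
qed

text \<open>The combination of two base points serves sup norms (\<open>c = 0\<close>) and differences (\<open>c = 1\<close>).\<close>

lemma dir_deriv_bound_from_Basis:
  fixes f :: "'a::euclidean_space \<Rightarrow> real"
  assumes "smooth f"
    and "\<And>is. length is = n \<Longrightarrow> set is \<subseteq> Basis \<Longrightarrow> \<bar>dir_deriv is f x - c * dir_deriv is f y\<bar> \<le> C"
    and "length vs = n" "\<And>v. v \<in> set vs \<Longrightarrow> norm v \<le> 1"
  shows "\<bar>dir_deriv vs f x - c * dir_deriv vs f y\<bar> \<le> real DIM('a) ^ n * C"
  using assms
proof (induction n arbitrary: vs f)
  case 0
  then show ?case using "0.prems"(2)[of "[]"] by simp
next
  case (Suc n)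
  obtain v ws where vs: "vs = v # ws" "length ws = n" using Suc.prems(3) by (cases vs) auto
  have "dir_deriv vs f z = (\<Sum>b\<in>Basis. (v \<bullet> b) * dir_deriv (b # ws) f z)" for z
  proof -
    have "(\<lambda>x. frechet_derivative f (at x) v) = (\<lambda>x. \<Sum>b\<in>Basis. (v \<bullet> b) * frechet_derivative f (at x) b)"
      by (rule ext, rule frechet_expand, rule smooth_differentiable, fact)
    then show ?thesis using Suc.prems(1)
      by (simp add: vs dir_deriv_sum dir_deriv_cmult smooth_frechet smooth_cmult)
  qed
  then have "\<bar>dir_deriv vs f x - c * dir_deriv vs f y\<bar> =
      \<bar>\<Sum>b\<in>Basis. (v \<bullet> b) * (dir_deriv (b # ws) f x - c * dir_deriv (b # ws) f y)\<bar>"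
    by (simp add: sum_distrib_left sum_subtractf algebra_simps)
  also have "\<dots> \<le> (\<Sum>b\<in>(Basis::'a set). real DIM('a) ^ n * C)"
  proof (rule order_trans[OF sum_abs], rule sum_mono)
    fix b :: 'a assume b: "b \<in> Basis"
    have "\<bar>v \<bullet> b\<bar> \<le> 1"
      using Cauchy_Schwarz_ineq2[of v b] b Suc.prems(4)[of v] vs by simp
    moreover have "\<bar>dir_deriv ws (\<lambda>x. frechet_derivative f (at x) b) x - c * dir_deriv ws (\<lambda>x. frechet_derivative f (at x) b) y\<bar>
       \<le> real DIM('a) ^ n * C"
    proof (rule Suc.IH)
      show "\<bar>dir_deriv is (\<lambda>x. frechet_derivative f (at x) b) x - c * dir_deriv is (\<lambda>x. frechet_derivative f (at x) b) y\<bar> \<le> C"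
        if "length is = n" "set is \<subseteq> Basis" for "is"
        using Suc.prems(2)[of "b # is"] that b by simp
    qed (use Suc.prems vs in \<open>auto intro: smooth_frechet\<close>)
    ultimately show "\<bar>(v \<bullet> b) * (dir_deriv (b # ws) f x - c * dir_deriv (b # ws) f y)\<bar> \<le> real DIM('a) ^ n * C"
      using mult_mono[of "\<bar>v \<bullet> b\<bar>" 1] by (fastforce simp: abs_mult)
  qed
  finally show ?case by simp
qed

section \<open>Gaussian kernels and their Laplace transforms\<close>

text \<open>The centred Gaussian density with standard deviation \<sigma> in each coordinate. The
  product form gives normalization and convolution coordinatewise; \<open>gauss_eq\<close> gives the
  radial form used for calculus.\<close>

definition gauss :: "real \<Rightarrow> 'a::euclidean_space \<Rightarrow> real" where
  "gauss \<sigma> z = (\<Prod>b\<in>Basis. normal_density 0 \<sigma> (z \<bullet> b))"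

lemma gauss_nonneg: "0 \<le> gauss \<sigma> z"
  unfolding gauss_def by (intro prod_nonneg) auto

lemma gauss_measurable [measurable]: "gauss \<sigma> \<in> borel_measurable borel"
  unfolding gauss_def[abs_def] by measurable

lemma gauss_eq:
  "gauss \<sigma> (z::'a::euclidean_space) = (1 / sqrt (2 * pi * \<sigma>\<^sup>2)) ^ DIM('a) * exp (- (z \<bullet> z) / (2 * \<sigma>\<^sup>2))"
proof -
  have "(\<Prod>b\<in>Basis. exp (- ((z \<bullet> b)\<^sup>2 / (2 * \<sigma>\<^sup>2)))) = exp (- (z \<bullet> z) / (2 * \<sigma>\<^sup>2))"
  proof -
    have "(\<Sum>b\<in>Basis. - ((z \<bullet> b)\<^sup>2 / (2 * \<sigma>\<^sup>2))) = - (z \<bullet> z) / (2 * \<sigma>\<^sup>2)"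
      by (subst euclidean_inner[of z z]) (simp add: sum_negf sum_divide_distrib power2_eq_square)
    then show ?thesis by (simp only: exp_sum[symmetric] finite_Basis)
  qed
  then show ?thesis
    unfolding gauss_def normal_density_def by (simp add: prod.distrib prod_dividef power_one_over)
qed

lemma gauss_minus: "gauss \<sigma> (- z) = gauss \<sigma> z"
  by (simp add: gauss_eq)

lemma gauss_le: "0 < \<sigma> \<Longrightarrow> gauss \<sigma> (z::'a::euclidean_space) \<le> (1 / sqrt (2 * pi * \<sigma>\<^sup>2)) ^ DIM('a)"
  unfolding gauss_eq by (rule mult_left_le) auto

lemma nn_integral_gauss:
  assumes "0 < \<sigma>" shows "(\<integral>\<^sup>+z. ennreal (gauss \<sigma> (z::'a::euclidean_space)) \<partial>lborel) = 1"
proof -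
  have "(\<integral>\<^sup>+z. ennreal (gauss \<sigma> (z::'a)) \<partial>lborel) =
    (\<integral>\<^sup>+z. (\<Prod>b\<in>Basis. ennreal (normal_density 0 \<sigma> ((z::'a) \<bullet> b))) \<partial>lborel)"
    unfolding gauss_def by (simp add: prod_ennreal)
  also have "\<dots> = (\<Prod>b\<in>(Basis::'a set). \<integral>\<^sup>+x. ennreal (normal_density 0 \<sigma> x) \<partial>lborel)"
    by (rule nn_integral_lborel_prod) auto
  also have "(\<integral>\<^sup>+x. ennreal (normal_density 0 \<sigma> x) \<partial>lborel) = 1"
    using assms by (subst nn_integral_eq_integral) auto
  finally show ?thesis by simp
qed

lemma integrable_gauss [simp]: "0 < \<sigma> \<Longrightarrow> integrable lborel (gauss \<sigma>)"
  by (intro integrableI_nonneg) (auto simp: gauss_nonneg nn_integral_gauss)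

lemma integral_gauss [simp]: "0 < \<sigma> \<Longrightarrow> (\<integral>z. gauss \<sigma> z \<partial>lborel) = 1"
  by (subst integral_eq_nn_integral) (auto simp: gauss_nonneg nn_integral_gauss)

text \<open>Half of the Gaussian exponent absorbs the exponential: \<open>c * norm y\<close> is at
  most \<open>(norm y)^2 / (4 \<sigma>^2) + c^2 \<sigma>^2\<close>, and what remains is a multiple
  of the Gaussian of standard deviation \<open>sqrt 2 * \<sigma>\<close>.\<close>

lemma integrable_exp_norm_gauss:
  assumes "0 < \<sigma>"
  shows "integrable lborel (\<lambda>y. exp (c * norm y) * exp (- (y \<bullet> y) / (2 * \<sigma>\<^sup>2)))"
proof -
  define C where "C = (1 / sqrt (2 * pi * (sqrt 2 * \<sigma>)\<^sup>2)) ^ DIM('a)"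
  have C: "C > 0" unfolding C_def using assms by simp
  show ?thesis
  proof (rule Bochner_Integration.integrable_bound)
    show "integrable lborel (\<lambda>y::'a. exp (c\<^sup>2 * \<sigma>\<^sup>2) / C * gauss (sqrt 2 * \<sigma>) y)"
      using assms by (intro integrable_mult_right integrable_gauss) auto
    show "AE y in lborel. norm (exp (c * norm y) * exp (- (y \<bullet> y) / (2 * \<sigma>\<^sup>2)))
      \<le> norm (exp (c\<^sup>2 * \<sigma>\<^sup>2) / C * gauss (sqrt 2 * \<sigma>) (y::'a))"
    proof (rule AE_I2)
      fix y :: 'a
      have "0 \<le> (norm y / (2 * \<sigma>) - c * \<sigma>)\<^sup>2" by simp
      also have "\<dots> = (norm y)\<^sup>2 / (4 * \<sigma>\<^sup>2) - c * norm y + c\<^sup>2 * \<sigma>\<^sup>2"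
        using assms by (simp add: power2_diff power_divide power_mult_distrib)
      finally have *: "0 \<le> (norm y)\<^sup>2 / (4 * \<sigma>\<^sup>2) - c * norm y + c\<^sup>2 * \<sigma>\<^sup>2" .
      have "(y \<bullet> y) / (2 * \<sigma>\<^sup>2) = 2 * ((norm y)\<^sup>2 / (4 * \<sigma>\<^sup>2))"
        "(y \<bullet> y) / (2 * (sqrt 2 * \<sigma>)\<^sup>2) = (norm y)\<^sup>2 / (4 * \<sigma>\<^sup>2)"
        by (simp_all add: dot_square_norm power_mult_distrib)
      with * have "c * norm y + - (y \<bullet> y) / (2 * \<sigma>\<^sup>2) \<le> c\<^sup>2 * \<sigma>\<^sup>2 + - (y \<bullet> y) / (2 * (sqrt 2 * \<sigma>)\<^sup>2)"
        by (simp only: minus_divide_left[symmetric])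
      then have "exp (c * norm y) * exp (- (y \<bullet> y) / (2 * \<sigma>\<^sup>2)) \<le> exp (c\<^sup>2 * \<sigma>\<^sup>2) * exp (- (y \<bullet> y) / (2 * (sqrt 2 * \<sigma>)\<^sup>2))"
        unfolding exp_add[symmetric] by simp
      then show "norm (exp (c * norm y) * exp (- (y \<bullet> y) / (2 * \<sigma>\<^sup>2)))
        \<le> norm (exp (c\<^sup>2 * \<sigma>\<^sup>2) / C * gauss (sqrt 2 * \<sigma>) y)"
        unfolding gauss_eq C_def[symmetric] using C by (simp add: abs_mult)
    qed
  qed measurable
qed

section \<open>Translation and scaling of Lebesgue integrals\<close>

lemma lborel_integral_shift:
  fixes f :: "'a::euclidean_space \<Rightarrow> real"
  assumes [measurable]: "f \<in> borel_measurable borel"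
  shows "(\<integral>y. f y \<partial>lborel) = (\<integral>z. f (c + z) \<partial>lborel)"
  by (subst lborel_distr_plus[of c, symmetric], subst integral_distr) auto

lemma lborel_integrable_shift:
  fixes f :: "'a::euclidean_space \<Rightarrow> real"
  assumes [measurable]: "f \<in> borel_measurable borel"
  shows "integrable lborel (\<lambda>z. f (c + z)) \<longleftrightarrow> integrable lborel f"
  using integrable_distr_eq[of "(+) c" lborel borel f] by (simp add: lborel_distr_plus)

lemma gauss_scale:
  fixes z :: "'a::euclidean_space"
  assumes "0 < \<sigma>" shows "\<sigma> ^ DIM('a) * gauss \<sigma> (\<sigma> *\<^sub>R z) = gauss 1 z"
proof -
  have "\<sigma> * (1 / sqrt (2 * pi * \<sigma>\<^sup>2)) = 1 / sqrt (2 * pi)"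
    using assms by (simp add: real_sqrt_mult)
  then have "\<sigma> ^ DIM('a) * (1 / sqrt (2 * pi * \<sigma>\<^sup>2)) ^ DIM('a) = (1 / sqrt (2 * pi)) ^ DIM('a)"
    by (simp only: power_mult_distrib[symmetric])
  moreover have "(\<sigma> *\<^sub>R z) \<bullet> (\<sigma> *\<^sub>R z) / (2 * \<sigma>\<^sup>2) = z \<bullet> z / 2"
    using assms by (simp add: power2_eq_square)
  ultimately show ?thesis by (simp add: gauss_eq mult.assoc[symmetric])
qed

lemma gauss_integral_scale:
  fixes g :: "'a::euclidean_space \<Rightarrow> real"
  assumes [measurable]: "g \<in> borel_measurable borel" and "0 < \<sigma>"
  shows "(\<integral>z. g z * gauss \<sigma> z \<partial>lborel) = (\<integral>z. g (\<sigma> *\<^sub>R z) * gauss 1 z \<partial>lborel)"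
proof -
  note * = gauss_scale[OF assms(2)]
  have "(\<integral>z. g z * gauss \<sigma> z \<partial>lborel) =
     (\<integral>z. g z * gauss \<sigma> z \<partial>(density (distr lborel borel (\<lambda>x. 0 + \<sigma> *\<^sub>R x)) (\<lambda>_. ennreal (\<bar>\<sigma>\<bar> ^ DIM('a)))))"
    by (rule arg_cong[OF lborel_affine[of \<sigma> "0::'a"], where f = "\<lambda>M. \<integral>z. g z * gauss \<sigma> z \<partial>M"])
      (use assms(2) in simp)
  also have "\<dots> = (\<integral>z. \<sigma> ^ DIM('a) * (g (\<sigma> *\<^sub>R z) * gauss \<sigma> (\<sigma> *\<^sub>R z)) \<partial>lborel)"
    using assms(2) by (subst integral_density) (auto simp: integral_distr)
  also have "\<dots> = (\<integral>z. g (\<sigma> *\<^sub>R z) * gauss 1 z \<partial>lborel)"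
    by (simp add: *[symmetric] mult_ac)
  finally show ?thesis .
qed

text \<open>Decay beyond every exponential makes the Laplace transform finite everywhere. It
  survives multiplication by linear functionals, which is what differentiation under the integral
  produces.\<close>

definition tame :: "('a::euclidean_space \<Rightarrow> real) \<Rightarrow> bool" where
  "tame P \<longleftrightarrow> P \<in> borel_measurable borel \<and> (\<forall>c. integrable lborel (\<lambda>y. exp (c * norm y) * P y))"

text \<open>A Gaussian kernel centred at \<open>s x\<close> is, up to a factor in x alone, a
  Gaussian in y times \<open>exp (r * (x \<bullet> y))\<close> with
  \<open>r = s / \<sigma>\<^sup>2\<close>. Smoothing is thus a Laplace transform with an explicit
  prefactor, and the function to be smoothed may be rough.\<close>

definition laplace :: "real \<Rightarrow> ('a::euclidean_space \<Rightarrow> real) \<Rightarrow> 'a \<Rightarrow> real" where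
  "laplace r P x = (\<integral>y. P y * exp (r * (x \<bullet> y)) \<partial>lborel)"

lemma tame_measurable [measurable_dest]: "tame P \<Longrightarrow> P \<in> borel_measurable borel"
  by (simp add: tame_def)

lemma tame_bound:
  assumes "tame P" and [measurable]: "Q \<in> borel_measurable borel"
    and "\<And>y. \<bar>Q y\<bar> \<le> C * exp (c * norm y) * \<bar>P y\<bar>"
  shows "integrable lborel Q"
proof (rule Bochner_Integration.integrable_bound)
  show "integrable lborel (\<lambda>y. C * (exp (c * norm y) * P y))"
    using assms(1) unfolding tame_def by (intro integrable_mult_right) auto
  show "AE y in lborel. norm (Q y) \<le> norm (C * (exp (c * norm y) * P y))"
  proof (rule AE_I2)
    fix y
    have "C * (exp (c * norm y) * \<bar>P y\<bar>) \<le> \<bar>C\<bar> * (exp (c * norm y) * \<bar>P y\<bar>)"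
      by (intro mult_right_mono) auto
    then show "norm (Q y) \<le> norm (C * (exp (c * norm y) * P y))"
      using order_trans[OF assms(3)[of y, unfolded mult.assoc]] by (simp only: abs_mult abs_exp_cancel real_norm_def)
  qed
qed measurable

lemma norm_le_exp: "norm y \<le> exp (norm y)"
  using exp_ge_add_one_self[of "norm y"] by linarith

lemma tame_inner:
  assumes "tame P" shows "tame (\<lambda>y. (v \<bullet> y) * P y)"
  unfolding tame_def
proof (intro conjI allI)
  note [measurable] = tame_measurable[OF assms]
  show "(\<lambda>y. (v \<bullet> y) * P y) \<in> borel_measurable borel" by measurable
  show "integrable lborel (\<lambda>y. exp (c * norm y) * ((v \<bullet> y) * P y))" for c
  proof (rule tame_bound[OF assms])
    fix y
    have "\<bar>v \<bullet> y\<bar> \<le> norm v * exp (norm y)"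
      using Cauchy_Schwarz_ineq2[of v y] mult_left_mono[OF norm_le_exp[of y], of "norm v"] by auto
    then have "\<bar>v \<bullet> y\<bar> * (exp (c * norm y) * \<bar>P y\<bar>) \<le> (norm v * exp (norm y)) * (exp (c * norm y) * \<bar>P y\<bar>)"
      by (intro mult_right_mono) auto
    moreover have "exp ((c + 1) * norm y) = exp (c * norm y) * exp (norm y)"
      by (simp add: distrib_right exp_add)
    ultimately show "\<bar>exp (c * norm y) * ((v \<bullet> y) * P y)\<bar> \<le> norm v * exp ((c + 1) * norm y) * \<bar>P y\<bar>"
      by (simp add: abs_mult mult_ac)
  qed measurable
qed

lemma tame_cmult: "tame P \<Longrightarrow> tame (\<lambda>y. c * P y)"
  unfolding tame_def
proof (safe)
  assume int: "\<forall>c. integrable lborel (\<lambda>y. exp (c * norm y) * P y)"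
  fix k
  have "(\<lambda>y. exp (k * norm y) * (c * P y)) = (\<lambda>y. c * (exp (k * norm y) * P y))"
    by (simp add: fun_eq_iff)
  then show "integrable lborel (\<lambda>y. exp (k * norm y) * (c * P y))" using int by simp
qed measurable

lemma integrable_laplace:
  assumes "tame P" shows "integrable lborel (\<lambda>y. P y * exp (r * (x \<bullet> y)))"
proof (rule tame_bound[OF assms])
  note [measurable] = tame_measurable[OF assms]
  show "(\<lambda>y. P y * exp (r * (x \<bullet> y))) \<in> borel_measurable borel" by measurable
  fix y
  have "\<bar>r * (x \<bullet> y)\<bar> \<le> \<bar>r\<bar> * (norm x * norm y)"
    unfolding abs_mult by (intro mult_left_mono Cauchy_Schwarz_ineq2) auto
  then have "r * (x \<bullet> y) \<le> \<bar>r\<bar> * norm x * norm y"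
    by (subst mult.assoc) linarith
  then have "exp (r * (x \<bullet> y)) * \<bar>P y\<bar> \<le> exp (\<bar>r\<bar> * norm x * norm y) * \<bar>P y\<bar>"
    by (intro mult_right_mono) auto
  then show "\<bar>P y * exp (r * (x \<bullet> y))\<bar> \<le> 1 * exp (\<bar>r\<bar> * norm x * norm y) * \<bar>P y\<bar>"
    by (simp only: abs_mult abs_exp_cancel mult_1 mult.commute[of "\<bar>P y\<bar>"])
qed

text \<open>Serves both the differentiation of Laplace transforms and the Riemann sums along the
  paths of the process.\<close>

lemma exp_remainder: "\<bar>exp u - 1 - u\<bar> \<le> u\<^sup>2 * exp \<bar>u\<bar>" for u :: real
proof -
  obtain t where t: "\<bar>t\<bar> \<le> \<bar>u\<bar>" "exp u = (\<Sum>m<2. u ^ m / fact m) + exp t / fact 2 * u\<^sup>2"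
    using Maclaurin_exp_le[of u 2] by auto
  have "exp u - 1 - u = exp t / 2 * u\<^sup>2"
    using t(2) by (simp add: numeral_2_eq_2)
  moreover have "\<bar>exp t / 2 * u\<^sup>2\<bar> \<le> exp \<bar>u\<bar> * u\<^sup>2"
  proof -
    have "exp t \<le> exp \<bar>u\<bar>" using t(1) by simp
    then have "exp t / 2 \<le> exp \<bar>u\<bar>" using exp_ge_zero[of t] by linarith
    then have "exp t / 2 * u\<^sup>2 \<le> exp \<bar>u\<bar> * u\<^sup>2" by (rule mult_right_mono) simp
    then show ?thesis by (simp add: abs_mult)
  qed
  ultimately show ?thesis by (simp only: mult.commute)
qed

text \<open>The Taylor remainder of exp bounds the integrand of the error by
  \<open>(norm h)^2 * R y\<close>, with R independent of h as long as \<open>norm h \<le> 1\<close>.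
  The derivative is the transform of another tame weight, so the step can be iterated.\<close>

lemma laplace_has_derivative:
  fixes P :: "'a::euclidean_space \<Rightarrow> real"
  assumes "tame P"
  shows "(laplace r P has_derivative (\<lambda>h. laplace r (\<lambda>y. (r * (h \<bullet> y)) * P y) x)) (at x)"
proof -
  note [measurable] = tame_measurable[OF assms]
  have tame1: "tame (\<lambda>y. (r * (h \<bullet> y)) * P y)" for h
    using tame_cmult[OF tame_inner[OF assms, of h], of r] by (simp add: mult.assoc)
  note int0 = integrable_laplace[OF assms, of r]
  note int1 = integrable_laplace[OF tame1, of _ r]
  \<comment> \<open>The coefficient \<open>norm x + 1\<close> dominates the exponential factor at x
    together with the remainder factor for a displacement of norm at most 1.\<close>
  define R where "R = (\<lambda>y::'a. r\<^sup>2 * (norm y)\<^sup>2 * exp (\<bar>r\<bar> * (norm x + 1) * norm y) * \<bar>P y\<bar>)"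
  have intR: "integrable lborel R"
    unfolding R_def
  proof (rule tame_bound[OF assms])
    fix y :: 'a
    have "(norm y)\<^sup>2 \<le> (exp (norm y))\<^sup>2" by (intro power_mono norm_le_exp) auto
    then have "r\<^sup>2 * (norm y)\<^sup>2 * (exp (\<bar>r\<bar> * (norm x + 1) * norm y) * \<bar>P y\<bar>)
        \<le> r\<^sup>2 * (exp (norm y))\<^sup>2 * (exp (\<bar>r\<bar> * (norm x + 1) * norm y) * \<bar>P y\<bar>)"
      by (intro mult_right_mono mult_left_mono) auto
    moreover have "exp ((\<bar>r\<bar> * (norm x + 1) + 2) * norm y) = exp (\<bar>r\<bar> * (norm x + 1) * norm y) * (exp (norm y))\<^sup>2"
      by (simp add: distrib_right exp_add exp_double)
    ultimately show "\<bar>r\<^sup>2 * (norm y)\<^sup>2 * exp (\<bar>r\<bar> * (norm x + 1) * norm y) * \<bar>P y\<bar>\<bar>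
      \<le> r\<^sup>2 * exp ((\<bar>r\<bar> * (norm x + 1) + 2) * norm y) * \<bar>P y\<bar>"
      by (simp add: abs_mult mult_ac)
  qed measurable
  define I where "I = (\<integral>y. R y \<partial>lborel)"
  show ?thesis
  proof (rule has_derivativeI_sandwich[where e = 1 and H = "\<lambda>z. norm (z - x) * I"])
    show "bounded_linear (\<lambda>h. laplace r (\<lambda>y. r * (h \<bullet> y) * P y) x)"
    proof (rule linear_conv_bounded_linear[THEN iffD1], rule linearI)
      show "laplace r (\<lambda>y. r * ((h + k) \<bullet> y) * P y) x =
        laplace r (\<lambda>y. r * (h \<bullet> y) * P y) x + laplace r (\<lambda>y. r * (k \<bullet> y) * P y) x" for h k
      proof -
        have "(\<lambda>y. r * ((h + k) \<bullet> y) * P y * exp (r * (x \<bullet> y))) =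
          (\<lambda>y. r * (h \<bullet> y) * P y * exp (r * (x \<bullet> y)) + r * (k \<bullet> y) * P y * exp (r * (x \<bullet> y)))"
          by (simp add: fun_eq_iff inner_add_left algebra_simps)
        then show ?thesis
          unfolding laplace_def by (simp only: Bochner_Integration.integral_add[OF int1 int1])
      qed
      show "laplace r (\<lambda>y. r * ((c *\<^sub>R h) \<bullet> y) * P y) x = c *\<^sub>R laplace r (\<lambda>y. r * (h \<bullet> y) * P y) x" for c h
        unfolding laplace_def by (simp add: mult_ac)
    qed
    fix z assume z: "z \<noteq> x" "dist z x < 1"
    define h where "h = z - x"
    have h: "norm h \<le> 1" "h \<noteq> 0" using z by (auto simp: h_def dist_norm)
    have "laplace r P z - laplace r P x - laplace r (\<lambda>y. r * (h \<bullet> y) * P y) x =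
      (\<integral>y. P y * exp (r * (z \<bullet> y)) - P y * exp (r * (x \<bullet> y)) - (r * (h \<bullet> y) * P y) * exp (r * (x \<bullet> y)) \<partial>lborel)"
      unfolding laplace_def by (simp add: int0 int1)
    also have "\<bar>\<dots>\<bar> \<le> (\<integral>y. (norm h)\<^sup>2 * R y \<partial>lborel)"
    proof (rule order_trans[OF integral_abs_bound], rule integral_mono)
      fix y
      define u where "u = r * (h \<bullet> y)"
      have u1: "\<bar>u\<bar> \<le> \<bar>r\<bar> * (norm h * norm y)"
        unfolding u_def abs_mult by (intro mult_left_mono Cauchy_Schwarz_ineq2) auto
      also have "\<dots> \<le> \<bar>r\<bar> * (1 * norm y)" using h by (intro mult_left_mono mult_right_mono) auto
      finally have u2: "exp \<bar>u\<bar> \<le> exp (\<bar>r\<bar> * norm y)" by simp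
      have "u\<^sup>2 \<le> (\<bar>r\<bar> * (norm h * norm y))\<^sup>2" using u1 power_mono[of "\<bar>u\<bar>" _ 2] by fastforce
      then have u3: "u\<^sup>2 * exp \<bar>u\<bar> \<le> (\<bar>r\<bar> * (norm h * norm y))\<^sup>2 * exp (\<bar>r\<bar> * norm y)"
        using u2 by (intro mult_mono) auto
      have "\<bar>r * (x \<bullet> y)\<bar> \<le> \<bar>r\<bar> * (norm x * norm y)"
        unfolding abs_mult by (intro mult_left_mono Cauchy_Schwarz_ineq2) auto
      then have "r * (x \<bullet> y) \<le> \<bar>r\<bar> * norm x * norm y" by (subst mult.assoc) linarith
      then have x: "exp (r * (x \<bullet> y)) \<le> exp (\<bar>r\<bar> * norm x * norm y)" by simp
      have "P y * exp (r * (z \<bullet> y)) - P y * exp (r * (x \<bullet> y)) - (r * (h \<bullet> y) * P y) * exp (r * (x \<bullet> y))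
        = P y * exp (r * (x \<bullet> y)) * (exp u - 1 - u)"
      proof -
        have "exp (r * (z \<bullet> y)) = exp (r * (x \<bullet> y)) * exp u"
          unfolding u_def h_def exp_add[symmetric] by (simp add: inner_diff_left algebra_simps)
        then show ?thesis by (simp add: u_def algebra_simps)
      qed
      also have "\<bar>\<dots>\<bar> \<le> \<bar>P y\<bar> * exp (\<bar>r\<bar> * norm x * norm y) * ((\<bar>r\<bar> * (norm h * norm y))\<^sup>2 * exp (\<bar>r\<bar> * norm y))"
        unfolding abs_mult using x order_trans[OF exp_remainder u3] by (intro mult_mono) auto
      also have "\<dots> = (norm h)\<^sup>2 * R y"
      proof -
        have "exp (\<bar>r\<bar> * (norm x + 1) * norm y) = exp (\<bar>r\<bar> * norm x * norm y) * exp (\<bar>r\<bar> * norm y)"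
          by (simp add: distrib_right distrib_left exp_add)
        then show ?thesis by (simp add: R_def power_mult_distrib mult_ac)
      qed
      finally show "\<bar>P y * exp (r * (z \<bullet> y)) - P y * exp (r * (x \<bullet> y)) - (r * (h \<bullet> y) * P y) * exp (r * (x \<bullet> y))\<bar>
        \<le> (norm h)\<^sup>2 * R y" .
    qed (use int0 int1 intR in auto)
    finally have "\<bar>laplace r P z - laplace r P x - laplace r (\<lambda>y. r * (h \<bullet> y) * P y) x\<bar> \<le> (norm h)\<^sup>2 * I"
      by (simp add: I_def)
    then show "norm (laplace r P z - laplace r P x - laplace r (\<lambda>y. r * ((z - x) \<bullet> y) * P y) x) / norm (z - x)
      \<le> norm (z - x) * I"
      using h unfolding h_def[symmetric] by (simp add: divide_le_eq power2_eq_square mult_ac)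
  next
    have "((\<lambda>z. norm (z - x) * I) \<longlongrightarrow> norm (x - x) * I) (at x)" by (intro tendsto_intros)
    then show "((\<lambda>z. norm (z - x) * I) \<longlongrightarrow> 0) (at x)" by simp
  qed simp
qed

lemma smooth_laplace: "tame P \<Longrightarrow> smooth (laplace r P)"
proof (rule smooth_coinduct[of _ "{laplace r P | P. tame P}"])
  fix f assume "f \<in> {laplace r P | P. tame (P :: 'a \<Rightarrow> real)}"
  then obtain P where P: "f = laplace r P" "tame P" by blast
  have "tame (\<lambda>y. (r * (v \<bullet> y)) * P y)" for v
    using tame_cmult[OF tame_inner[OF P(2), of v], of r] by (simp add: mult.assoc)
  then show "\<exists>f'. (\<forall>x. (f has_derivative f' x) (at x)) \<and> (\<forall>v. (\<lambda>x. f' x v) \<in> {laplace r P | P. tame P})"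
    unfolding P(1) using laplace_has_derivative[OF P(2), of r]
    by (intro exI[of _ "\<lambda>x h. laplace r (\<lambda>y. (r * (h \<bullet> y)) * P y) x"]) blast
qed blast

text \<open>Derivatives act on the exponential kernel and only multiply the weight by linear
  functionals, so pointwise convergence under a tame majorant passes to derivatives of every order.
  P, Q and W change along the induction by the same factor.\<close>

lemma dir_deriv_laplace_tendsto:
  fixes P :: "nat \<Rightarrow> 'a::euclidean_space \<Rightarrow> real"
  assumes "tame W" "\<And>n. P n \<in> borel_measurable borel" "\<And>n y. \<bar>P n y\<bar> \<le> \<bar>W y\<bar>" "\<And>y. (\<lambda>n. P n y) \<longlonglongrightarrow> Q y"
    "tame Q" "\<And>n. tame (P n)"
  shows "(\<lambda>n. dir_deriv vs (laplace r (P n)) x) \<longlonglongrightarrow> dir_deriv vs (laplace r Q) x"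
  using assms
proof (induction vs arbitrary: P Q W)
  case Nil
  note [measurable] = Nil(2) tame_measurable[OF Nil(1)] tame_measurable[OF Nil(5)]
  have "(\<lambda>n. \<integral>y. P n y * exp (r * (x \<bullet> y)) \<partial>lborel) \<longlonglongrightarrow> (\<integral>y. Q y * exp (r * (x \<bullet> y)) \<partial>lborel)"
  proof (rule integral_dominated_convergence)
    show "integrable lborel (\<lambda>y. \<bar>W y * exp (r * (x \<bullet> y))\<bar>)"
      using integrable_laplace[OF Nil(1)] by (rule integrable_abs)
    show "AE y in lborel. (\<lambda>n. P n y * exp (r * (x \<bullet> y))) \<longlonglongrightarrow> Q y * exp (r * (x \<bullet> y))"
      by (intro AE_I2 tendsto_intros Nil)
    show "AE y in lborel. norm (P n y * exp (r * (x \<bullet> y))) \<le> \<bar>W y * exp (r * (x \<bullet> y))\<bar>" for n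
      by (intro AE_I2) (auto simp: abs_mult intro!: mult_right_mono Nil)
  qed measurable
  then show ?case by (simp add: laplace_def)
next
  case (Cons v vs)
  have t: "tame P \<Longrightarrow> tame (\<lambda>y. (r * (v \<bullet> y)) * P y)" for P
    using tame_cmult[OF tame_inner[of P v], of r] by (simp add: mult.assoc)
  have eq: "tame P \<Longrightarrow> (\<lambda>x. frechet_derivative (laplace r P) (at x) v) = laplace r (\<lambda>y. (r * (v \<bullet> y)) * P y)" for P
    by (rule ext, rule frechet_derivative_eqI[OF laplace_has_derivative])
  note [measurable] = Cons.prems(2)
  show ?case
    unfolding dir_deriv.simps eq[OF Cons.prems(5)] eq[OF Cons.prems(6)]
  proof (rule Cons.IH)
    show "tame (\<lambda>y. (r * (v \<bullet> y)) * W y)" by (rule t) fact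
    show "\<bar>r * (v \<bullet> y) * P n y\<bar> \<le> \<bar>r * (v \<bullet> y) * W y\<bar>" for n y
      unfolding abs_mult[of "r * (v \<bullet> y)"] by (intro mult_left_mono Cons.prems) auto
    show "(\<lambda>n. r * (v \<bullet> y) * P n y) \<longlonglongrightarrow> r * (v \<bullet> y) * Q y" for y
      by (intro tendsto_intros Cons.prems)
  qed (use t Cons.prems in auto)
qed

section \<open>Gaussian smoothing\<close>

text \<open>The expectation of \<open>f (s x + \<sigma> Z)\<close> for a standard Gaussian Z,
  written with x in the kernel so that it can be differentiated without differentiating f. The case
  s = 1 serves as a mollifier, the case \<open>s = exp (- t)\<close> with
  \<open>s\<^sup>2 + \<sigma>\<^sup>2 = 1\<close> as the Ornstein--Uhlenbeck semigroup.\<close>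

definition smoothing :: "real \<Rightarrow> real \<Rightarrow> ('a::euclidean_space \<Rightarrow> real) \<Rightarrow> 'a \<Rightarrow> real" where
  "smoothing s \<sigma> f x = (\<integral>y. f y * gauss \<sigma> (y - s *\<^sub>R x) \<partial>lborel)"

text \<open>Bounded functions are the ones of interest; exponential growth is stable under the
  linear factors that come from differentiating the kernel.\<close>

definition exp_growth :: "('a::euclidean_space \<Rightarrow> real) \<Rightarrow> bool" where
  "exp_growth f \<longleftrightarrow> f \<in> borel_measurable borel \<and> (\<exists>C c. \<forall>y. \<bar>f y\<bar> \<le> C * exp (c * norm y))"

lemma exp_growth_measurable [measurable_dest]: "exp_growth f \<Longrightarrow> f \<in> borel_measurable borel"
  by (simp add: exp_growth_def)

lemma exp_growthI:
  "f \<in> borel_measurable borel \<Longrightarrow> (\<And>y. \<bar>f y\<bar> \<le> C * exp (c * norm y)) \<Longrightarrow> exp_growth f"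
  unfolding exp_growth_def by blast

lemma exp_growth_bounded:
  assumes "f \<in> borel_measurable borel" "\<And>y. \<bar>f y\<bar> \<le> C" shows "exp_growth f"
  by (rule exp_growthI[of _ C 0]) (use assms in auto)

lemma exp_growth_inner:
  assumes "exp_growth f" shows "exp_growth (\<lambda>y. (v \<bullet> y) * f y)"
proof -
  obtain C c where C: "\<And>y. \<bar>f y\<bar> \<le> C * exp (c * norm y)" using assms unfolding exp_growth_def by blast
  have "\<bar>(v \<bullet> y) * f y\<bar> \<le> (norm v * C) * exp ((c + 1) * norm y)" for y
  proof -
    have "\<bar>v \<bullet> y\<bar> \<le> norm v * exp (norm y)"
      using Cauchy_Schwarz_ineq2[of v y] mult_left_mono[OF norm_le_exp[of y], of "norm v"] by auto
    then have "\<bar>v \<bullet> y\<bar> * \<bar>f y\<bar> \<le> (norm v * exp (norm y)) * (C * exp (c * norm y))"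
      by (intro mult_mono C) auto
    moreover have "exp ((c + 1) * norm y) = exp (c * norm y) * exp (norm y)"
      by (simp add: distrib_right exp_add)
    ultimately show ?thesis by (simp add: abs_mult mult_ac)
  qed
  then show ?thesis
    by (rule exp_growthI[rotated]) (use exp_growth_measurable[OF assms] in measurable)
qed

lemma exp_growth_tame:
  fixes f :: "'a::euclidean_space \<Rightarrow> real"
  assumes "0 < \<sigma>" "exp_growth f" shows "tame (\<lambda>y. f y * exp (- (y \<bullet> y) / (2 * \<sigma>\<^sup>2)))"
  unfolding tame_def
proof (intro conjI allI)
  note [measurable] = exp_growth_measurable[OF assms(2)]
  show "(\<lambda>y. f y * exp (- (y \<bullet> y) / (2 * \<sigma>\<^sup>2))) \<in> borel_measurable borel" by measurable
  obtain C c where C: "\<And>y. \<bar>f y\<bar> \<le> C * exp (c * norm y)" using assms(2) unfolding exp_growth_def by blast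
  fix d
  show "integrable lborel (\<lambda>y. exp (d * norm y) * (f y * exp (- (y \<bullet> y) / (2 * \<sigma>\<^sup>2))))"
  proof (rule Bochner_Integration.integrable_bound)
    show "integrable lborel (\<lambda>y::'a. C * (exp ((d + c) * norm y) * exp (- (y \<bullet> y) / (2 * \<sigma>\<^sup>2))))"
      by (intro integrable_mult_right integrable_exp_norm_gauss assms)
    show "AE y in lborel. norm (exp (d * norm y) * (f y * exp (- (y \<bullet> y) / (2 * \<sigma>\<^sup>2))))
        \<le> norm (C * (exp ((d + c) * norm y) * exp (- (y \<bullet> y) / (2 * \<sigma>\<^sup>2))))"
    proof (rule AE_I2)
      fix y :: 'a
      define E where "E = exp (- (y \<bullet> y) / (2 * \<sigma>\<^sup>2))"
      have "\<bar>f y\<bar> \<le> \<bar>C\<bar> * exp (c * norm y)"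
        by (rule order_trans[OF C], rule mult_right_mono) auto
      then have "(exp (d * norm y) * E) * \<bar>f y\<bar> \<le> (exp (d * norm y) * E) * (\<bar>C\<bar> * exp (c * norm y))"
        unfolding E_def by (intro mult_left_mono) auto
      moreover have "exp ((d + c) * norm y) = exp (d * norm y) * exp (c * norm y)"
        by (simp add: distrib_right exp_add)
      ultimately show "norm (exp (d * norm y) * (f y * exp (- (y \<bullet> y) / (2 * \<sigma>\<^sup>2))))
        \<le> norm (C * (exp ((d + c) * norm y) * exp (- (y \<bullet> y) / (2 * \<sigma>\<^sup>2))))"
        unfolding E_def[symmetric] by (simp add: abs_mult mult_ac) (simp add: E_def mult_ac)
    qed
  qed measurable
qed

lemma gauss_shift_eq:
  fixes x y :: "'a::euclidean_space"
  assumes "0 < \<sigma>"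
  shows "gauss \<sigma> (y - s *\<^sub>R x) = (1 / sqrt (2 * pi * \<sigma>\<^sup>2)) ^ DIM('a) * exp (- (s\<^sup>2 / (2 * \<sigma>\<^sup>2)) * (x \<bullet> x)) *
    (exp (- (y \<bullet> y) / (2 * \<sigma>\<^sup>2)) * exp (s / \<sigma>\<^sup>2 * (x \<bullet> y)))"
proof -
  have "- ((y - s *\<^sub>R x) \<bullet> (y - s *\<^sub>R x)) / (2 * \<sigma>\<^sup>2) =
    - (s\<^sup>2 / (2 * \<sigma>\<^sup>2)) * (x \<bullet> x) + (- (y \<bullet> y) / (2 * \<sigma>\<^sup>2) + s / \<sigma>\<^sup>2 * (x \<bullet> y))"
    using assms by (simp add: inner_diff_left inner_diff_right inner_commute field_simps power2_eq_square)
  then show ?thesis unfolding gauss_eq by (simp only: exp_add mult.assoc)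
qed

lemma smoothing_eq:
  fixes f :: "'a::euclidean_space \<Rightarrow> real"
  assumes "0 < \<sigma>"
  shows "smoothing s \<sigma> f x = ((1 / sqrt (2 * pi * \<sigma>\<^sup>2)) ^ DIM('a) * exp (- (s\<^sup>2 / (2 * \<sigma>\<^sup>2)) * (x \<bullet> x))) *
    laplace (s / \<sigma>\<^sup>2) (\<lambda>y. f y * exp (- (y \<bullet> y) / (2 * \<sigma>\<^sup>2))) x"
  unfolding smoothing_def laplace_def gauss_shift_eq[OF assms]
  by (subst Bochner_Integration.integral_mult_right_zero[symmetric]) (simp add: mult_ac)

lemma smooth_gauss_factor: "smooth (\<lambda>x::'a::euclidean_space. c * exp (k * (x \<bullet> x)))"
  by (intro smooth_cmult smooth_exp smooth_inner_self)

lemma smooth_smoothing: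
  assumes "0 < \<sigma>" "exp_growth f" shows "smooth (smoothing s \<sigma> f)"
  unfolding smoothing_eq[OF assms(1), abs_def]
  by (intro smooth_mult smooth_gauss_factor smooth_laplace exp_growth_tame assms)

lemma integrable_smoothing:
  assumes "0 < \<sigma>" "exp_growth f"
  shows "integrable lborel (\<lambda>y. f y * gauss \<sigma> (y - s *\<^sub>R x))"
proof -
  have "(\<lambda>y. f y * gauss \<sigma> (y - s *\<^sub>R x)) = (\<lambda>y. ((1 / sqrt (2 * pi * \<sigma>\<^sup>2)) ^ DIM('a) * exp (- (s\<^sup>2 / (2 * \<sigma>\<^sup>2)) * (x \<bullet> x))) *
      (f y * exp (- (y \<bullet> y) / (2 * \<sigma>\<^sup>2)) * exp (s / \<sigma>\<^sup>2 * (x \<bullet> y))))"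
    by (simp add: gauss_shift_eq[OF assms(1)] mult_ac)
  then show ?thesis
    using integrable_laplace[OF exp_growth_tame[OF assms], of "s / \<sigma>\<^sup>2" x] by (simp only: integrable_mult_right)
qed

text \<open>Differentiating the kernel brings down
  \<open>s / \<sigma>^2 * (v \<bullet> (y - s x))\<close>. It is split into two smoothings so that
  the result stays in a class that can be differentiated again.\<close>

lemma smoothing_has_derivative:
  fixes f :: "'a::euclidean_space \<Rightarrow> real"
  assumes "0 < \<sigma>" "exp_growth f"
  shows "(smoothing s \<sigma> f has_derivative
    (\<lambda>v. s / \<sigma>\<^sup>2 * (smoothing s \<sigma> (\<lambda>y. (v \<bullet> y) * f y) x - s * (v \<bullet> x) * smoothing s \<sigma> f x))) (at x)"
proof -
  define N where "N = (1 / sqrt (2 * pi * \<sigma>\<^sup>2)) ^ DIM('a)"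
  define W where "W = (\<lambda>y. f y * exp (- (y \<bullet> y) / (2 * \<sigma>\<^sup>2)))"
  have G: "((\<lambda>x::'a. N * exp (- (s\<^sup>2 / (2 * \<sigma>\<^sup>2)) * (x \<bullet> x))) has_derivative
    (\<lambda>v. N * (exp (- (s\<^sup>2 / (2 * \<sigma>\<^sup>2)) * (x \<bullet> x)) * (- (s\<^sup>2 / \<sigma>\<^sup>2) * (v \<bullet> x))))) (at x)"
    using assms(1) by (auto intro!: derivative_eq_intros simp: fun_eq_iff inner_commute field_simps)
  have lap: "(laplace (s / \<sigma>\<^sup>2) W has_derivative
      (\<lambda>v. laplace (s / \<sigma>\<^sup>2) (\<lambda>y. (s / \<sigma>\<^sup>2 * (v \<bullet> y)) * W y) x)) (at x)"
    unfolding W_def by (intro laplace_has_derivative exp_growth_tame assms)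
  have eq: "laplace (s / \<sigma>\<^sup>2) (\<lambda>y. (s / \<sigma>\<^sup>2 * (v \<bullet> y)) * W y) x =
     s / \<sigma>\<^sup>2 * laplace (s / \<sigma>\<^sup>2) (\<lambda>y. (v \<bullet> y) * f y * exp (- (y \<bullet> y) / (2 * \<sigma>\<^sup>2))) x" for v
    unfolding laplace_def by (subst Bochner_Integration.integral_mult_right_zero[symmetric]) (simp add: W_def mult_ac)
  show ?thesis
    unfolding smoothing_eq[OF assms(1), abs_def] N_def[symmetric] W_def[symmetric]
    by (rule has_derivative_eq_rhs[OF has_derivative_mult[OF G lap]])
      (rule ext, simp only: eq, simp add: algebra_simps power2_eq_square)
qed

lemma smoothing_add:
  assumes "0 < \<sigma>" "exp_growth f" "exp_growth g"
  shows "smoothing s \<sigma> (\<lambda>y. f y + g y) x = smoothing s \<sigma> f x + smoothing s \<sigma> g x"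
  unfolding smoothing_def distrib_right
  by (intro Bochner_Integration.integral_add integrable_smoothing assms)

lemma smoothing_cmult: "smoothing s \<sigma> (\<lambda>y. c * f y) x = c * smoothing s \<sigma> f x"
  unfolding smoothing_def by (simp add: mult.assoc)

lemma exp_growth_add:
  assumes "exp_growth f" "exp_growth g" shows "exp_growth (\<lambda>y. f y + g y)"
proof -
  obtain C c where C: "\<And>y. \<bar>f y\<bar> \<le> C * exp (c * norm y)" using assms unfolding exp_growth_def by blast
  obtain D d where D: "\<And>y. \<bar>g y\<bar> \<le> D * exp (d * norm y)" using assms unfolding exp_growth_def by blast
  have nn: "0 \<le> C" "0 \<le> D" using C[of 0] D[of 0] by auto
  have "\<bar>f y + g y\<bar> \<le> (C + D) * exp (max c d * norm y)" for y
  proof -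
    have "C * exp (c * norm y) \<le> C * exp (max c d * norm y)" "D * exp (d * norm y) \<le> D * exp (max c d * norm y)"
      using nn by (auto intro!: mult_left_mono mult_right_mono)
    then show ?thesis using C[of y] D[of y] by (simp add: distrib_right)
  qed
  then show ?thesis
    using assms by (auto simp: exp_growth_def)
qed

lemma exp_growth_const: "exp_growth (\<lambda>y. c)"
  by (rule exp_growth_bounded[of _ "\<bar>c\<bar>"]) auto

lemma exp_growth_cmult:
  assumes "exp_growth f" shows "exp_growth (\<lambda>y. c * f y)"
proof -
  obtain C d where C: "\<And>y. \<bar>f y\<bar> \<le> C * exp (d * norm y)" using assms unfolding exp_growth_def by blast
  have "\<bar>c * f y\<bar> \<le> (\<bar>c\<bar> * C) * exp (d * norm y)" for y
    using mult_left_mono[OF C[of y], of "\<bar>c\<bar>"] by (simp add: abs_mult mult.assoc)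
  then show ?thesis using assms by (auto simp: exp_growth_def)
qed

lemma smoothing_const: "0 < \<sigma> \<Longrightarrow> smoothing s \<sigma> (\<lambda>y. c) x = c"
  unfolding smoothing_def by (subst lborel_integral_shift[of _ "s *\<^sub>R x"]) auto

lemma smoothing_frechet:
  fixes f :: "'a::euclidean_space \<Rightarrow> real"
  assumes "0 < \<sigma>" "exp_growth f"
  shows "frechet_derivative (smoothing s \<sigma> f) (at x) v =
    (\<integral>y. s / \<sigma>\<^sup>2 * (f y * (v \<bullet> (y - s *\<^sub>R x)) * gauss \<sigma> (y - s *\<^sub>R x)) \<partial>lborel)"
    and "integrable lborel (\<lambda>y. f y * (v \<bullet> (y - s *\<^sub>R x)) * gauss \<sigma> (y - s *\<^sub>R x))"
proof -
  have eq: "(\<lambda>y. f y * (v \<bullet> (y - s *\<^sub>R x)) * gauss \<sigma> (y - s *\<^sub>R x)) =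
    (\<lambda>y. (v \<bullet> y) * f y * gauss \<sigma> (y - s *\<^sub>R x) - (s * (v \<bullet> x)) * (f y * gauss \<sigma> (y - s *\<^sub>R x)))"
    by (simp add: fun_eq_iff inner_diff_right algebra_simps)
  have i: "integrable lborel (\<lambda>y. (v \<bullet> y) * f y * gauss \<sigma> (y - s *\<^sub>R x))"
    "integrable lborel (\<lambda>y. (s * (v \<bullet> x)) * (f y * gauss \<sigma> (y - s *\<^sub>R x)))"
    by (intro integrable_mult_right integrable_smoothing exp_growth_inner assms)+
  show "integrable lborel (\<lambda>y. f y * (v \<bullet> (y - s *\<^sub>R x)) * gauss \<sigma> (y - s *\<^sub>R x))"
    unfolding eq using i by (rule Bochner_Integration.integrable_diff)
  show "frechet_derivative (smoothing s \<sigma> f) (at x) v =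
    (\<integral>y. s / \<sigma>\<^sup>2 * (f y * (v \<bullet> (y - s *\<^sub>R x)) * gauss \<sigma> (y - s *\<^sub>R x)) \<partial>lborel)"
    by (subst frechet_derivative_eqI[OF smoothing_has_derivative[OF assms]],
        subst Bochner_Integration.integral_mult_right_zero, unfold eq,
        subst Bochner_Integration.integral_diff[OF i]) (simp add: smoothing_def)
qed

text \<open>The weight is the second Hermite polynomial of the kernel: the product of two linear
  factors comes from differentiating the kernel twice, the term \<open>- (u \<bullet> v)\<close>
  from differentiating the linear factor of the first step. Its Gaussian mean is 0.\<close>

lemma smoothing_frechet2:
  fixes f :: "'a::euclidean_space \<Rightarrow> real"
  assumes "0 < \<sigma>" "exp_growth f"
  shows "frechet_derivative (\<lambda>x. frechet_derivative (smoothing s \<sigma> f) (at x) v) (at x) u =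
    (\<integral>y. s\<^sup>2 / \<sigma>\<^sup>2 * (f y * ((u \<bullet> (y - s *\<^sub>R x)) * (v \<bullet> (y - s *\<^sub>R x)) / \<sigma>\<^sup>2 - u \<bullet> v) * gauss \<sigma> (y - s *\<^sub>R x)) \<partial>lborel)"
    (is "?l = ?r")
    and "integrable lborel (\<lambda>y. f y * ((u \<bullet> (y - s *\<^sub>R x)) * (v \<bullet> (y - s *\<^sub>R x)) / \<sigma>\<^sup>2 - u \<bullet> v) * gauss \<sigma> (y - s *\<^sub>R x))" (is ?int)
proof -
  let ?T = "smoothing s \<sigma>"
  define c where "c = s / \<sigma>\<^sup>2"
  define fv where "fv = (\<lambda>y. (v \<bullet> y) * f y)"
  have fv: "exp_growth fv" unfolding fv_def by (intro exp_growth_inner assms)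
  \<comment> \<open>With x frozen in the linear factor, h is f times
    \<open>v \<bullet> (y - s x)\<close>; its smoothing at the same x supplies the part in which the
    kernel is differentiated a second time.\<close>
  define h where "h = (\<lambda>y. fv y + (- (s * (v \<bullet> x))) * f y)"
  have h: "exp_growth h" unfolding h_def by (intro exp_growth_add exp_growth_cmult fv assms)
  have h_eq: "h y = f y * (v \<bullet> (y - s *\<^sub>R x))" for y
    by (simp add: h_def fv_def inner_diff_right algebra_simps)
  have 1: "(\<lambda>x. frechet_derivative (?T f) (at x) v) = (\<lambda>x. c * (?T fv x - s * (v \<bullet> x) * ?T f x))"
    unfolding fv_def c_def by (intro ext frechet_derivative_eqI smoothing_has_derivative assms)
  have "((\<lambda>x. c * (?T fv x - s * (v \<bullet> x) * ?T f x)) has_derivative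
      (\<lambda>u. c * (frechet_derivative (?T fv) (at x) u - (s * (v \<bullet> x) * frechet_derivative (?T f) (at x) u + s * (v \<bullet> u) * ?T f x)))) (at x)"
    by (intro has_derivative_mult_right has_derivative_diff has_derivative_mult smooth_has_derivative smooth_smoothing assms fv
        has_derivative_inner_right has_derivative_ident)
  from frechet_derivative_eqI[OF this] have "?l = c * ((frechet_derivative (?T fv) (at x) u - s * (v \<bullet> x) * frechet_derivative (?T f) (at x) u) - s * (u \<bullet> v) * ?T f x)"
    unfolding 1 by (simp add: inner_commute algebra_simps)
  also have "frechet_derivative (?T fv) (at x) u - s * (v \<bullet> x) * frechet_derivative (?T f) (at x) u = frechet_derivative (?T h) (at x) u"
  proof -
    define k where "k = - (s * (v \<bullet> x))"
    have "?T h = (\<lambda>x'. ?T fv x' + k * ?T f x')"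
      unfolding h_def k_def[symmetric]
      by (rule ext) (simp only: smoothing_add[OF assms(1) fv exp_growth_cmult[OF assms(2)]] smoothing_cmult)
    moreover have "frechet_derivative (\<lambda>x'. ?T fv x' + k * ?T f x') (at x) u =
        frechet_derivative (?T fv) (at x) u + k * frechet_derivative (?T f) (at x) u"
      by (simp only: frechet_add frechet_cmult smooth_differentiable smooth_cmult smooth_smoothing[OF assms(1)] assms(2) fv)
    moreover have "k * frechet_derivative (?T f) (at x) u = - (s * (v \<bullet> x) * frechet_derivative (?T f) (at x) u)"
      by (simp add: k_def)
    ultimately show ?thesis by simp
  qed
  also have "\<dots> = (\<integral>y. c * (h y * (u \<bullet> (y - s *\<^sub>R x)) * gauss \<sigma> (y - s *\<^sub>R x)) \<partial>lborel)"
    unfolding c_def by (rule smoothing_frechet[OF assms(1) h])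
  finally have l: "?l = c * (c * (\<integral>y. h y * (u \<bullet> (y - s *\<^sub>R x)) * gauss \<sigma> (y - s *\<^sub>R x) \<partial>lborel) - s * (u \<bullet> v) * ?T f x)"
    by simp
  have eq: "(\<lambda>y. f y * ((u \<bullet> (y - s *\<^sub>R x)) * (v \<bullet> (y - s *\<^sub>R x)) / \<sigma>\<^sup>2 - u \<bullet> v) * gauss \<sigma> (y - s *\<^sub>R x)) =
     (\<lambda>y. (1 / \<sigma>\<^sup>2) * (h y * (u \<bullet> (y - s *\<^sub>R x)) * gauss \<sigma> (y - s *\<^sub>R x)) - (u \<bullet> v) * (f y * gauss \<sigma> (y - s *\<^sub>R x)))"
  proof -
    have "F * (a * b / q - c) * G = 1 / q * (F * b * a * G) - c * (F * G)" for F a b q c G :: real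
      by (simp add: algebra_simps)
    then show ?thesis by (intro ext) (simp only: h_eq)
  qed
  have i: "integrable lborel (\<lambda>y. (1 / \<sigma>\<^sup>2) * (h y * (u \<bullet> (y - s *\<^sub>R x)) * gauss \<sigma> (y - s *\<^sub>R x)))"
    "integrable lborel (\<lambda>y. (u \<bullet> v) * (f y * gauss \<sigma> (y - s *\<^sub>R x)))"
    by (intro integrable_mult_right integrable_smoothing smoothing_frechet(2) assms h)+
  show ?int unfolding eq using i by (rule Bochner_Integration.integrable_diff)
  have "?r = s\<^sup>2 / \<sigma>\<^sup>2 * ((1 / \<sigma>\<^sup>2) * (\<integral>y. h y * (u \<bullet> (y - s *\<^sub>R x)) * gauss \<sigma> (y - s *\<^sub>R x) \<partial>lborel) - (u \<bullet> v) * ?T f x)"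
    by (subst Bochner_Integration.integral_mult_right_zero, unfold eq,
        subst Bochner_Integration.integral_diff[OF i]) (simp add: smoothing_def)
  with l show "?l = ?r" by (simp add: c_def algebra_simps power2_eq_square)
qed


text \<open>One moment for all estimates: \<open>1 + norm z\<close> absorbs
  \<open>norm z powr \<theta>\<close> for \<theta> < 1, and \<open>1 + (norm z)^2\<close> the second
  order weight. The \<open>itself\<close> argument records that the value depends on the space
  only.\<close>

definition gauss_moment :: "'a::euclidean_space itself \<Rightarrow> real" where
  "gauss_moment _ = (\<integral>z. (1 + norm z) * (1 + (norm z)\<^sup>2) * gauss 1 (z::'a) \<partial>lborel)"

lemma integrable_poly_gauss:
  fixes Q :: "'a::euclidean_space \<Rightarrow> real"
  assumes "0 < \<sigma>" and [measurable]: "Q \<in> borel_measurable borel" and "\<And>z. \<bar>Q z\<bar> \<le> C * exp (c * norm z)"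
  shows "integrable lborel (\<lambda>z. Q z * gauss \<sigma> z)"
  using integrable_smoothing[OF assms(1) exp_growthI[OF assms(2,3)], of 0 0] by simp

lemma moment_bound: "(1 + norm z) * (1 + (norm z)\<^sup>2) \<le> 4 * exp (3 * norm z)"
proof -
  have 1: "1 + norm z \<le> exp (norm z)" by (rule exp_ge_add_one_self)
  have "1 + (norm z)\<^sup>2 \<le> (1 + norm z)\<^sup>2" by (simp add: power2_eq_square algebra_simps)
  also have "\<dots> \<le> (exp (norm z))\<^sup>2" using 1 by (intro power_mono) auto
  finally have "(1 + norm z) * (1 + (norm z)\<^sup>2) \<le> exp (norm z) * (exp (norm z))\<^sup>2"
    using 1 by (intro mult_mono) auto
  also have "\<dots> = exp (3 * norm z)" by (simp add: exp_double[symmetric] exp_add[symmetric])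
  finally show ?thesis using exp_ge_zero[of "3 * norm z"] by linarith
qed

lemma integrable_moment: "integrable lborel (\<lambda>z::'a::euclidean_space. (1 + norm z) * (1 + (norm z)\<^sup>2) * gauss 1 z)"
proof (rule integrable_poly_gauss[of 1 _ 4 3])
  fix z :: 'a
  have "0 \<le> (1 + norm z) * (1 + (norm z)\<^sup>2)" by simp
  then show "\<bar>(1 + norm z) * (1 + (norm z)\<^sup>2)\<bar> \<le> 4 * exp (3 * norm z)"
    using moment_bound[of z] by linarith
qed auto

lemma gauss_moment_nonneg: "0 \<le> gauss_moment TYPE('a::euclidean_space)"
  unfolding gauss_moment_def by (intro Bochner_Integration.integral_nonneg) (auto simp: gauss_nonneg)

text \<open>The bound on Q is imposed after scaling by \<sigma>, so the powers of \<sigma> are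
  collected in D and the remaining integral is a standard moment.\<close>

lemma gauss_weighted_bound:
  fixes Q :: "'a::euclidean_space \<Rightarrow> real"
  assumes [measurable]: "Q \<in> borel_measurable borel" and "0 < \<sigma>" "0 \<le> D"
    and Q: "\<And>z. 0 \<le> Q z" "\<And>z. Q (\<sigma> *\<^sub>R z) \<le> D * ((1 + norm z) * (1 + (norm z)\<^sup>2))"
  shows "integrable lborel (\<lambda>z. Q z * gauss \<sigma> z)"
    and "(\<integral>z. Q z * gauss \<sigma> z \<partial>lborel) \<le> D * gauss_moment TYPE('a)"
proof -
  have Qb: "\<bar>Q z\<bar> \<le> 4 * D * exp (3 / \<sigma> * norm z)" for z
  proof -
    have "Q z \<le> D * ((1 + norm (z /\<^sub>R \<sigma>)) * (1 + (norm (z /\<^sub>R \<sigma>))\<^sup>2))"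
      using Q(2)[of "z /\<^sub>R \<sigma>"] assms(2) by simp
    also have "\<dots> \<le> D * (4 * exp (3 * norm (z /\<^sub>R \<sigma>)))"
      by (intro mult_left_mono moment_bound assms(3))
    also have "3 * norm (z /\<^sub>R \<sigma>) = 3 / \<sigma> * norm z" using assms(2) by (simp add: divide_inverse)
    finally show ?thesis using Q(1)[of z] by (simp add: mult_ac)
  qed
  then show "integrable lborel (\<lambda>z. Q z * gauss \<sigma> z)"
    by (intro integrable_poly_gauss assms)
  have "\<bar>Q (\<sigma> *\<^sub>R z)\<bar> \<le> 4 * D * exp (3 * norm z)" for z
    using Qb[of "\<sigma> *\<^sub>R z"] assms(2) by simp
  then have i: "integrable lborel (\<lambda>z. Q (\<sigma> *\<^sub>R z) * gauss 1 z)"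
    by (intro integrable_poly_gauss[of 1 _ "4 * D" 3]) auto
  have "(\<integral>z. Q z * gauss \<sigma> z \<partial>lborel) = (\<integral>z. Q (\<sigma> *\<^sub>R z) * gauss 1 z \<partial>lborel)"
    by (intro gauss_integral_scale assms)
  also have "\<dots> \<le> (\<integral>z. D * ((1 + norm z) * (1 + (norm z)\<^sup>2) * gauss 1 (z::'a)) \<partial>lborel)"
    using i integrable_mult_right[OF integrable_moment, of D]
    by (intro integral_mono) (auto simp: gauss_nonneg mult.assoc[symmetric] intro!: mult_right_mono[OF Q(2)[unfolded mult.assoc[symmetric]]])
  also have "\<dots> = D * gauss_moment TYPE('a)" by (simp add: gauss_moment_def)
  finally show "(\<integral>z. Q z * gauss \<sigma> z \<partial>lborel) \<le> D * gauss_moment TYPE('a)" .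
qed

lemma smoothing_weighted_bound:
  fixes f :: "'a::euclidean_space \<Rightarrow> real"
  assumes [measurable]: "g \<in> borel_measurable borel" and "0 < \<sigma>" "0 \<le> D" "Q \<in> borel_measurable borel"
    and g: "\<And>y. \<bar>g y\<bar> \<le> Q (y - s *\<^sub>R x)"
    and Q: "\<And>z::'a. 0 \<le> Q z" "\<And>z. Q (\<sigma> *\<^sub>R z) \<le> D * ((1 + norm z) * (1 + (norm z)\<^sup>2))"
  shows "\<bar>\<integral>y. g y * gauss \<sigma> (y - s *\<^sub>R x) \<partial>lborel\<bar> \<le> D * gauss_moment TYPE('a)"
proof -
  note [measurable] = assms(4)
  have i: "integrable lborel (\<lambda>z. Q z * gauss \<sigma> z)" by (rule gauss_weighted_bound[OF assms(4,2,3) Q])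
  have "\<bar>\<integral>y. g y * gauss \<sigma> (y - s *\<^sub>R x) \<partial>lborel\<bar> = \<bar>\<integral>z. g (s *\<^sub>R x + z) * gauss \<sigma> z \<partial>lborel\<bar>"
    by (subst lborel_integral_shift[of _ "s *\<^sub>R x"]) auto
  also have "\<dots> \<le> (\<integral>z. Q z * gauss \<sigma> z \<partial>lborel)"
  proof (rule order_trans[OF integral_abs_bound], rule integral_mono[OF _ i])
    have le: "\<bar>g (s *\<^sub>R x + z) * gauss \<sigma> z\<bar> \<le> Q z * gauss \<sigma> z" for z
      using g[of "s *\<^sub>R x + z"] by (simp add: abs_mult gauss_nonneg mult_right_mono)
    then show "\<bar>g (s *\<^sub>R x + z) * gauss \<sigma> z\<bar> \<le> Q z * gauss \<sigma> z" for z .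
    show "integrable lborel (\<lambda>z. \<bar>g (s *\<^sub>R x + z) * gauss \<sigma> z\<bar>)"
      by (rule Bochner_Integration.integrable_bound[OF i]) (use le Q(1) in \<open>auto simp: abs_mult gauss_nonneg\<close>)
  qed
  also have "\<dots> \<le> D * gauss_moment TYPE('a)" by (rule gauss_weighted_bound[OF assms(4,2,3) Q])
  finally show ?thesis .
qed

text \<open>An average against a probability kernel. An almost everywhere bound is what the Hoelder
  class offers for derivatives of top order.\<close>

lemma smoothing_bound:
  assumes [measurable]: "f \<in> borel_measurable borel" and "0 < \<sigma>" and "AE y in lborel. \<bar>f y\<bar> \<le> C"
  shows "\<bar>smoothing s \<sigma> f x\<bar> \<le> C"
proof -
  have i: "integrable lborel (\<lambda>y. C * gauss \<sigma> (y - s *\<^sub>R x))"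
    by (rule integrable_smoothing[OF assms(2) exp_growth_const])
  have le: "AE y in lborel. norm (f y * gauss \<sigma> (y - s *\<^sub>R x)) \<le> C * gauss \<sigma> (y - s *\<^sub>R x)"
    using assms(3) by eventually_elim (simp add: abs_mult gauss_nonneg mult_right_mono)
  have "\<bar>smoothing s \<sigma> f x\<bar> \<le> (\<integral>y. C * gauss \<sigma> (y - s *\<^sub>R x) \<partial>lborel)"
    unfolding smoothing_def
  proof (rule order_trans[OF integral_abs_bound], rule integral_mono_AE[OF _ i])
    have "integrable lborel (\<lambda>y. f y * gauss \<sigma> (y - s *\<^sub>R x))"
      by (rule Bochner_Integration.integrable_bound[OF i]) (use le in \<open>auto elim!: eventually_mono\<close>)
    then show "integrable lborel (\<lambda>y. \<bar>f y * gauss \<sigma> (y - s *\<^sub>R x)\<bar>)" by (rule integrable_abs)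
    show "AE y in lborel. \<bar>f y * gauss \<sigma> (y - s *\<^sub>R x)\<bar> \<le> C * gauss \<sigma> (y - s *\<^sub>R x)"
      using le by simp
  qed
  also have "\<dots> = C" using smoothing_const[OF assms(2), of s C x] by (simp add: smoothing_def)
  finally show ?thesis .
qed

text \<open>On the scale of the kernel the weight \<open>v \<bullet> (y - s x)\<close> has size
  \<sigma>, and the prefactor is \<open>s / \<sigma>^2\<close>; this leaves
  \<open>1 / \<sigma>\<close>.\<close>

lemma smoothing_frechet_bound:
  fixes f :: "'a::euclidean_space \<Rightarrow> real"
  assumes [measurable]: "f \<in> borel_measurable borel" and "0 < \<sigma>" "\<And>y. \<bar>f y\<bar> \<le> C" "norm v \<le> 1" "0 \<le> s" "s \<le> 1"
  shows "\<bar>frechet_derivative (smoothing s \<sigma> f) (at x) v\<bar> \<le> C * gauss_moment TYPE('a) / \<sigma>"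
proof -
  have C: "0 \<le> C" using assms(3)[of 0] by linarith
  let ?I = "\<integral>y. f y * (v \<bullet> (y - s *\<^sub>R x)) * gauss \<sigma> (y - s *\<^sub>R x) \<partial>lborel"
  have "\<bar>?I\<bar> \<le> (C * \<sigma>) * gauss_moment TYPE('a)"
  proof (rule smoothing_weighted_bound[where Q = "\<lambda>z. C * norm z"])
    show "\<bar>f y * (v \<bullet> (y - s *\<^sub>R x))\<bar> \<le> C * norm (y - s *\<^sub>R x)" for y
    proof -
      have "\<bar>v \<bullet> (y - s *\<^sub>R x)\<bar> \<le> norm v * norm (y - s *\<^sub>R x)" by (rule Cauchy_Schwarz_ineq2)
      also have "\<dots> \<le> 1 * norm (y - s *\<^sub>R x)" using assms(4) by (intro mult_right_mono) auto
      finally show ?thesis unfolding abs_mult using assms(3) C by (intro mult_mono) auto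
    qed
    show "C * norm (\<sigma> *\<^sub>R z) \<le> C * \<sigma> * ((1 + norm z) * (1 + (norm z)\<^sup>2))" for z :: 'a
    proof -
      have "norm z \<le> (1 + norm z) * (1 + (norm z)\<^sup>2)" by (simp add: algebra_simps)
      then show ?thesis using C assms(2) by (simp add: mult_left_mono mult.assoc)
    qed
  qed (use C assms(2) in auto)
  then have "\<bar>s / \<sigma>\<^sup>2 * ?I\<bar> \<le> 1 / \<sigma>\<^sup>2 * ((C * \<sigma>) * gauss_moment TYPE('a))"
    unfolding abs_mult using assms by (intro mult_mono) (auto simp: divide_right_mono)
  also have "\<dots> = C * gauss_moment TYPE('a) / \<sigma>" using assms(2) by (simp add: power2_eq_square)
  finally show ?thesis
    using smoothing_frechet(1)[OF assms(2) exp_growth_bounded[OF assms(1,3)], of s x v] by simp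
qed

text \<open>Subtracting the constant \<open>f (s x)\<close> does not change the derivatives, but turns the
  Hoelder continuity of \<open>f\<close> into a gain of \<open>\<sigma> powr \<theta>\<close>.\<close>

lemma smoothing_frechet2_bound:
  fixes f :: "'a::euclidean_space \<Rightarrow> real"
  assumes [measurable]: "f \<in> borel_measurable borel" and "0 < \<sigma>" "\<And>y. \<bar>f y\<bar> \<le> C"
    and H: "\<And>x y. \<bar>f x - f y\<bar> \<le> C * norm (x - y) powr \<theta>" and "0 \<le> \<theta>" "\<theta> < 1"
    and uv: "norm u \<le> 1" "norm v \<le> 1" and s: "0 \<le> s" "s \<le> 1"
  shows "\<bar>frechet_derivative (\<lambda>x. frechet_derivative (smoothing s \<sigma> f) (at x) v) (at x) u\<bar>
    \<le> C * gauss_moment TYPE('a) * \<sigma> powr (\<theta> - 2)"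
proof -
  have C: "0 \<le> C" using assms(3)[of 0] by linarith
  have growth: "exp_growth f" by (rule exp_growth_bounded[OF assms(1,3)])
  define g where "g = (\<lambda>y. f y + (- f (s *\<^sub>R x)))"
  have g: "exp_growth g" unfolding g_def by (intro exp_growth_add growth exp_growth_const)
  have [measurable]: "g \<in> borel_measurable borel" using g by (rule exp_growth_measurable)
  have "smoothing s \<sigma> g = (\<lambda>x'. smoothing s \<sigma> f x' + (- f (s *\<^sub>R x)))"
    unfolding g_def by (rule ext) (simp only: smoothing_add[OF assms(2) growth exp_growth_const] smoothing_const[OF assms(2)])
  then have "(\<lambda>x. frechet_derivative (smoothing s \<sigma> g) (at x) v) = (\<lambda>x. frechet_derivative (smoothing s \<sigma> f) (at x) v)"
    by (simp only: frechet_add smooth_differentiable smooth_smoothing[OF assms(2) growth] smooth_const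
        frechet_derivative_eqI[OF has_derivative_const] add_0_right)
  then have eq: "frechet_derivative (\<lambda>x. frechet_derivative (smoothing s \<sigma> f) (at x) v) (at x) u =
      s\<^sup>2 / \<sigma>\<^sup>2 * (\<integral>y. g y * ((u \<bullet> (y - s *\<^sub>R x)) * (v \<bullet> (y - s *\<^sub>R x)) / \<sigma>\<^sup>2 - u \<bullet> v) * gauss \<sigma> (y - s *\<^sub>R x) \<partial>lborel)"
    using smoothing_frechet2(1)[OF assms(2) g, of s v x u] by simp
  have CS: "\<bar>w \<bullet> z\<bar> \<le> norm z" if "norm w \<le> 1" for w z :: 'a
    using Cauchy_Schwarz_ineq2[of w z] mult_right_mono[OF that, of "norm z"] by simp
  have "\<bar>\<integral>y. g y * ((u \<bullet> (y - s *\<^sub>R x)) * (v \<bullet> (y - s *\<^sub>R x)) / \<sigma>\<^sup>2 - u \<bullet> v) * gauss \<sigma> (y - s *\<^sub>R x) \<partial>lborel\<bar>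
    \<le> (C * \<sigma> powr \<theta>) * gauss_moment TYPE('a)"
  \<comment> \<open>Q is the Hoelder bound for g times a bound for the second order weight; scaling
    by \<sigma> extracts \<open>\<sigma> powr \<theta>\<close> and leaves a polynomial in
    \<open>norm z\<close>.\<close>
  proof (rule smoothing_weighted_bound[where Q = "\<lambda>z. C * norm z powr \<theta> * ((norm z)\<^sup>2 / \<sigma>\<^sup>2 + 1)"])
    show "\<bar>g y * ((u \<bullet> (y - s *\<^sub>R x)) * (v \<bullet> (y - s *\<^sub>R x)) / \<sigma>\<^sup>2 - u \<bullet> v)\<bar>
      \<le> C * norm (y - s *\<^sub>R x) powr \<theta> * ((norm (y - s *\<^sub>R x))\<^sup>2 / \<sigma>\<^sup>2 + 1)" for y
    proof -
      define z where "z = y - s *\<^sub>R x"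
      have "\<bar>(u \<bullet> z) * (v \<bullet> z)\<bar> \<le> norm z * norm z"
        unfolding abs_mult by (intro mult_mono CS uv) auto
      then have "\<bar>(u \<bullet> z) * (v \<bullet> z) / \<sigma>\<^sup>2\<bar> \<le> (norm z)\<^sup>2 / \<sigma>\<^sup>2"
        by (simp add: divide_right_mono power2_eq_square)
      moreover have "\<bar>u \<bullet> v\<bar> \<le> 1" using CS[OF uv(1), of v] uv(2) by linarith
      ultimately have "\<bar>(u \<bullet> z) * (v \<bullet> z) / \<sigma>\<^sup>2 - u \<bullet> v\<bar> \<le> (norm z)\<^sup>2 / \<sigma>\<^sup>2 + 1" by linarith
      moreover have "\<bar>g y\<bar> \<le> C * norm z powr \<theta>" using H[of y "s *\<^sub>R x"] by (simp add: g_def z_def)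
      ultimately show ?thesis
        unfolding z_def[symmetric] abs_mult using C by (intro mult_mono) auto
    qed
    show "C * norm (\<sigma> *\<^sub>R z) powr \<theta> * ((norm (\<sigma> *\<^sub>R z))\<^sup>2 / \<sigma>\<^sup>2 + 1) \<le> C * \<sigma> powr \<theta> * ((1 + norm z) * (1 + (norm z)\<^sup>2))" for z :: 'a
    proof -
      have "norm z powr \<theta> \<le> (1 + norm z) powr \<theta>" using assms(5) by (intro powr_mono2) auto
      also have "\<dots> \<le> (1 + norm z) powr 1" using assms(6) by (intro powr_mono) auto
      finally have "norm z powr \<theta> \<le> 1 + norm z" by simp
      then have "(C * \<sigma> powr \<theta>) * (norm z powr \<theta> * (1 + (norm z)\<^sup>2)) \<le> (C * \<sigma> powr \<theta>) * ((1 + norm z) * (1 + (norm z)\<^sup>2))"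
        using C by (intro mult_left_mono mult_right_mono) auto
      moreover have "norm (\<sigma> *\<^sub>R z) powr \<theta> = \<sigma> powr \<theta> * norm z powr \<theta>"
        using assms(2) by (simp add: powr_mult)
      moreover have "(norm (\<sigma> *\<^sub>R z))\<^sup>2 / \<sigma>\<^sup>2 = (norm z)\<^sup>2" using assms(2) by (simp add: power_mult_distrib)
      ultimately show ?thesis by (simp only: mult_ac add_ac)
    qed
  qed (use C assms(2) in auto)
  then have "\<bar>s\<^sup>2 / \<sigma>\<^sup>2 * (\<integral>y. g y * ((u \<bullet> (y - s *\<^sub>R x)) * (v \<bullet> (y - s *\<^sub>R x)) / \<sigma>\<^sup>2 - u \<bullet> v) * gauss \<sigma> (y - s *\<^sub>R x) \<partial>lborel)\<bar>
    \<le> 1 / \<sigma>\<^sup>2 * ((C * \<sigma> powr \<theta>) * gauss_moment TYPE('a))"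
    unfolding abs_mult using s by (intro mult_mono) (auto simp: divide_right_mono power_le_one)
  also have "\<dots> = C * gauss_moment TYPE('a) * \<sigma> powr (\<theta> - 2)"
    using assms(2) by (simp add: powr_diff powr_numeral)
  finally show ?thesis unfolding eq .
qed

text \<open>Dominated convergence and measurability of limits call for a sequence of difference
  quotients. The constant c will be the factor s by which smoothing scales displacements.\<close>

lemma differentiable_quotient_tendsto:
  fixes f :: "'a::euclidean_space \<Rightarrow> real"
  assumes "f differentiable (at x)"
  shows "(\<lambda>n. (f (x + (c / Suc n) *\<^sub>R v) - f x) / (1 / Suc n)) \<longlonglongrightarrow> c * frechet_derivative f (at x) v"
proof -
  let ?D = "frechet_derivative f (at x)"
  have D: "(f has_derivative ?D) (at x)" by (rule differentiable_has_derivative[OF assms])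
  have "((\<lambda>h::real. f (x + (h * c) *\<^sub>R v)) has_derivative (\<lambda>h. ?D ((h * c) *\<^sub>R v))) (at 0)"
    by (rule has_derivative_compose[of _ _ 0 UNIV f, simplified]) (auto intro!: derivative_eq_intros D)
  moreover have "?D ((h * c) *\<^sub>R v) = (c * ?D v) * h" for h
    using linear_frechet_derivative[OF assms] by (simp add: linear_cmul)
  ultimately have "((\<lambda>h::real. f (x + (h * c) *\<^sub>R v)) has_real_derivative c * ?D v) (at 0)"
    unfolding has_field_derivative_def by simp
  then have "((\<lambda>h. (f (x + (h * c) *\<^sub>R v) - f x) / h) \<longlongrightarrow> c * ?D v) (at 0)"
    by (simp add: DERIV_def)
  then have "(\<lambda>n. (f (x + (1 / Suc n * c) *\<^sub>R v) - f x) / (1 / Suc n)) \<longlonglongrightarrow> c * ?D v"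
  proof (rule filterlim_compose)
    show "filterlim (\<lambda>n. 1 / real (Suc n)) (at 0) sequentially"
      using LIMSEQ_inverse_real_of_nat by (auto simp: filterlim_at inverse_eq_divide)
  qed
  then show ?thesis by simp
qed

text \<open>A displacement of x by v moves the kernel by \<open>s v\<close>, and a substitution in y
  moves it onto f. The difference quotients of f are bounded through the Lipschitz constant and
  converge almost everywhere, so dominated convergence puts the derivative on f. The Lipschitz
  condition is what excludes singular parts of the derivative.\<close>

lemma smoothing_frechet_transfer:
  fixes f g :: "'a::euclidean_space \<Rightarrow> real"
  assumes "0 < \<sigma>" "exp_growth f" and lip: "L-lipschitz_on UNIV f"
    and g [measurable]: "g \<in> borel_measurable borel"
    and D: "AE y in lborel. f differentiable (at y) \<and> g y = frechet_derivative f (at y) v"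
  shows "frechet_derivative (smoothing s \<sigma> f) (at x) v = s * smoothing s \<sigma> g x"
proof -
  note [measurable] = exp_growth_measurable[OF assms(2)]
  have int: "integrable lborel (\<lambda>y. f (c + y) * gauss \<sigma> (y - s *\<^sub>R x))" for c
    using lborel_integrable_shift[of "\<lambda>y. f y * gauss \<sigma> (y - 1 *\<^sub>R (c + s *\<^sub>R x))" c]
      integrable_smoothing[OF assms(1,2), of 1 "c + s *\<^sub>R x"]
    by (simp add: algebra_simps)
  let ?q = "\<lambda>n y. (f (y + (s / Suc n) *\<^sub>R v) - f y) / (1 / Suc n)"
  have "(\<lambda>n. (smoothing s \<sigma> f (x + (1 / Suc n) *\<^sub>R v) - smoothing s \<sigma> f x) / (1 / Suc n))
     \<longlonglongrightarrow> 1 * frechet_derivative (smoothing s \<sigma> f) (at x) v"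
    by (intro differentiable_quotient_tendsto smooth_differentiable smooth_smoothing assms)
  moreover have "(smoothing s \<sigma> f (x + (1 / Suc n) *\<^sub>R v) - smoothing s \<sigma> f x) / (1 / Suc n) =
     (\<integral>y. ?q n y * gauss \<sigma> (y - s *\<^sub>R x) \<partial>lborel)" for n
  proof -
    have "smoothing s \<sigma> f (x + (1 / Suc n) *\<^sub>R v) =
       (\<integral>y. f ((s / Suc n) *\<^sub>R v + y) * gauss \<sigma> (y - s *\<^sub>R x) \<partial>lborel)"
      unfolding smoothing_def
      by (subst lborel_integral_shift[of _ "(s / Suc n) *\<^sub>R v"]) (auto simp: algebra_simps)
    moreover have "(\<integral>y. ?q n y * gauss \<sigma> (y - s *\<^sub>R x) \<partial>lborel) =
       (\<integral>y. (f ((s / Suc n) *\<^sub>R v + y) * gauss \<sigma> (y - s *\<^sub>R x) - f y * gauss \<sigma> (y - s *\<^sub>R x)) / (1 / Suc n) \<partial>lborel)"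
      by (intro Bochner_Integration.integral_cong) (auto simp: algebra_simps)
    moreover have "\<dots> = ((\<integral>y. f ((s / Suc n) *\<^sub>R v + y) * gauss \<sigma> (y - s *\<^sub>R x) \<partial>lborel) - (\<integral>y. f y * gauss \<sigma> (y - s *\<^sub>R x) \<partial>lborel)) / (1 / Suc n)"
      by (subst integral_divide_zero, subst Bochner_Integration.integral_diff) (use int[of "(s / Suc n) *\<^sub>R v"] int[of 0] in auto)
    ultimately show ?thesis unfolding smoothing_def by simp
  qed
  moreover have "(\<lambda>n. \<integral>y. ?q n y * gauss \<sigma> (y - s *\<^sub>R x) \<partial>lborel) \<longlonglongrightarrow> (\<integral>y. s * (g y * gauss \<sigma> (y - s *\<^sub>R x)) \<partial>lborel)"
  proof (rule integral_dominated_convergence)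
    show "integrable lborel (\<lambda>y. (L * \<bar>s\<bar> * norm v) * gauss \<sigma> (y - s *\<^sub>R x))"
      by (rule integrable_smoothing[OF assms(1) exp_growth_const])
    show "AE y in lborel. (\<lambda>n. ?q n y * gauss \<sigma> (y - s *\<^sub>R x)) \<longlonglongrightarrow> s * (g y * gauss \<sigma> (y - s *\<^sub>R x))"
      using D
    proof eventually_elim
      case (elim y)
      then show ?case
        using tendsto_mult_right[OF differentiable_quotient_tendsto[of f y s v], of "gauss \<sigma> (y - s *\<^sub>R x)"]
        by (simp add: mult.assoc)
    qed
    show "AE y in lborel. norm (?q n y * gauss \<sigma> (y - s *\<^sub>R x)) \<le> L * \<bar>s\<bar> * norm v * gauss \<sigma> (y - s *\<^sub>R x)" for n
    proof (rule AE_I2)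
      fix y
      have "\<bar>f (y + (s / Suc n) *\<^sub>R v) - f y\<bar> \<le> L * norm ((s / Suc n) *\<^sub>R v)"
        using lipschitz_onD[OF lip, of "y + (s / Suc n) *\<^sub>R v" y] by (simp add: dist_norm)
      then have "\<bar>f (y + (s / Suc n) *\<^sub>R v) - f y\<bar> * Suc n \<le> L * norm ((s / Suc n) *\<^sub>R v) * Suc n"
        by (intro mult_right_mono) auto
      moreover have "L * norm ((s / Suc n) *\<^sub>R v) * Suc n = L * \<bar>s\<bar> * norm v" by simp
      ultimately have "\<bar>?q n y\<bar> \<le> L * \<bar>s\<bar> * norm v"
        by (simp only: abs_divide) simp
      then show "norm (?q n y * gauss \<sigma> (y - s *\<^sub>R x)) \<le> L * \<bar>s\<bar> * norm v * gauss \<sigma> (y - s *\<^sub>R x)"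
        by (simp only: real_norm_def abs_mult abs_of_nonneg[OF gauss_nonneg] mult_right_mono gauss_nonneg)
    qed
  qed measurable
  ultimately have "(\<lambda>n. \<integral>y. ?q n y * gauss \<sigma> (y - s *\<^sub>R x) \<partial>lborel) \<longlonglongrightarrow> frechet_derivative (smoothing s \<sigma> f) (at x) v"
    "(\<lambda>n. \<integral>y. ?q n y * gauss \<sigma> (y - s *\<^sub>R x) \<partial>lborel) \<longlonglongrightarrow> s * smoothing s \<sigma> g x"
    by (simp_all add: smoothing_def)
  then show ?thesis by (rule LIMSEQ_unique)
qed

text \<open>By the Leibniz rule f enters only through derivatives of a Laplace transform, while the
  Gaussian prefactor is fixed. Derivative bounds can thus pass to a limit that is merely pointwise
  and bounded.\<close>

lemma dir_deriv_smoothing_tendsto: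
  fixes f :: "nat \<Rightarrow> 'a::euclidean_space \<Rightarrow> real"
  assumes "0 < \<sigma>" and f: "\<And>n. f n \<in> borel_measurable borel" "\<And>n y. \<bar>f n y\<bar> \<le> C" "\<And>y. (\<lambda>n. f n y) \<longlonglongrightarrow> g y"
  shows "(\<lambda>n. dir_deriv vs (smoothing s \<sigma> (f n)) x) \<longlonglongrightarrow> dir_deriv vs (smoothing s \<sigma> g) x"
proof -
  have C: "0 \<le> C" using f(2)[of 0 0] by linarith
  have g: "g \<in> borel_measurable borel" by (rule borel_measurable_LIMSEQ_real[OF f(3,1)])
  have gb: "\<bar>g y\<bar> \<le> C" for y
    by (rule LIMSEQ_le_const2[OF tendsto_rabs[OF f(3)]]) (use f(2) in auto)
  define \<gamma> where "\<gamma> = (\<lambda>y::'a. exp (- (y \<bullet> y) / (2 * \<sigma>\<^sup>2)))"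
  have t: "tame (\<lambda>y. h y * \<gamma> y)" if "h \<in> borel_measurable borel" "\<And>y. \<bar>h y\<bar> \<le> C" for h
    unfolding \<gamma>_def by (intro exp_growth_tame assms(1) exp_growth_bounded[of _ C] that)
  have *: "(\<lambda>n. dir_deriv b (laplace (s / \<sigma>\<^sup>2) (\<lambda>y. f n y * \<gamma> y)) x) \<longlonglongrightarrow> dir_deriv b (laplace (s / \<sigma>\<^sup>2) (\<lambda>y. g y * \<gamma> y)) x" for b
  proof (rule dir_deriv_laplace_tendsto[where W = "\<lambda>y. C * \<gamma> y"])
    show "\<bar>f n y * \<gamma> y\<bar> \<le> \<bar>C * \<gamma> y\<bar>" for n y
      unfolding abs_mult using f(2)[of n y] C by (intro mult_right_mono) auto
    show "(\<lambda>n. f n y * \<gamma> y) \<longlonglongrightarrow> g y * \<gamma> y" for y by (intro tendsto_intros f)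
    show "(\<lambda>y. f n y * \<gamma> y) \<in> borel_measurable borel" for n
      using f(1)[of n] unfolding \<gamma>_def by measurable
  qed (auto intro!: t f g gb C)
  have sum: "(\<lambda>n. \<Sum>(a, b)\<leftarrow>xs. A a * dir_deriv b (laplace (s / \<sigma>\<^sup>2) (\<lambda>y. f n y * \<gamma> y)) x) \<longlonglongrightarrow>
     (\<Sum>(a, b)\<leftarrow>xs. A a * dir_deriv b (laplace (s / \<sigma>\<^sup>2) (\<lambda>y. g y * \<gamma> y)) x)" for xs and A :: "'a list \<Rightarrow> real"
    by (induction xs) (auto intro!: tendsto_intros *)
  define G where "G = (\<lambda>x::'a. (1 / sqrt (2 * pi * \<sigma>\<^sup>2)) ^ DIM('a) * exp (- (s\<^sup>2 / (2 * \<sigma>\<^sup>2)) * (x \<bullet> x)))"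
  have G: "smooth G" unfolding G_def by (rule smooth_gauss_factor)
  have eq: "dir_deriv vs (smoothing s \<sigma> h) x =
      (\<Sum>(a, b)\<leftarrow>splits vs. dir_deriv a G x * dir_deriv b (laplace (s / \<sigma>\<^sup>2) (\<lambda>y. h y * \<gamma> y)) x)"
    if "h \<in> borel_measurable borel" "\<And>y. \<bar>h y\<bar> \<le> C" for h
    unfolding smoothing_eq[OF assms(1), abs_def] \<gamma>_def[symmetric]
    by (subst dir_deriv_mult[OF G smooth_laplace[OF t[OF that]], symmetric]) (simp only: G_def \<gamma>_def)
  show ?thesis unfolding eq[OF f(1,2)] eq[OF g gb] by (rule sum)
qed

lemma smoothing_tendsto:
  fixes f :: "'a::euclidean_space \<Rightarrow> real"
  assumes "continuous_on UNIV f" and bd: "\<And>y. \<bar>f y\<bar> \<le> C"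
  shows "(\<lambda>n. smoothing 1 (1 / Suc n) f x) \<longlonglongrightarrow> f x"
proof -
  have [measurable]: "f \<in> borel_measurable borel" by (rule borel_measurable_continuous_onI[OF assms(1)])
  have eq: "smoothing 1 (1 / Suc n) f x = (\<integral>z. f (x + (1 / Suc n) *\<^sub>R z) * gauss 1 z \<partial>lborel)" for n
    unfolding smoothing_def
    by (subst lborel_integral_shift[of _ x], measurable, simp, rule gauss_integral_scale) auto
  have "(\<lambda>n. \<integral>z. f (x + (1 / Suc n) *\<^sub>R z) * gauss 1 z \<partial>lborel) \<longlonglongrightarrow> (\<integral>z. f x * gauss 1 (z::'a) \<partial>lborel)"
  proof (rule integral_dominated_convergence[where w = "\<lambda>z. C * gauss 1 z"])
    show "integrable lborel (\<lambda>z::'a. C * gauss 1 z)" by (intro integrable_mult_right integrable_gauss) simp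
    show "AE z in lborel. norm (f (x + (1 / Suc n) *\<^sub>R z) * gauss 1 z) \<le> C * gauss 1 z" for n
      by (intro AE_I2) (simp only: real_norm_def abs_mult abs_of_nonneg[OF gauss_nonneg] mult_right_mono gauss_nonneg bd)
    show "AE z in lborel. (\<lambda>n. f (x + (1 / Suc n) *\<^sub>R z) * gauss 1 z) \<longlonglongrightarrow> f x * gauss 1 z"
    proof (rule AE_I2)
      fix z
      have "(\<lambda>n. 1 / real (Suc n)) \<longlonglongrightarrow> 0" using LIMSEQ_inverse_real_of_nat by (simp add: inverse_eq_divide)
      then have "(\<lambda>n. x + (1 / Suc n) *\<^sub>R z) \<longlonglongrightarrow> x + 0 *\<^sub>R z" by (intro tendsto_intros)
      then have "(\<lambda>n. f (x + (1 / Suc n) *\<^sub>R z)) \<longlonglongrightarrow> f x"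
        by (intro isCont_tendsto_compose[of x f]) (use assms(1) in \<open>auto simp: continuous_on_eq_continuous_at\<close>)
      then show "(\<lambda>n. f (x + (1 / Suc n) *\<^sub>R z) * gauss 1 z) \<longlonglongrightarrow> f x * gauss 1 z" by (intro tendsto_intros)
    qed
  qed measurable
  then show ?thesis unfolding eq by simp
qed

section \<open>Derivative bounds for products, exponentials and logarithms\<close>

definition unit_list :: "'a::euclidean_space list \<Rightarrow> bool" where
  "unit_list vs \<longleftrightarrow> (\<forall>v\<in>set vs. norm v \<le> 1)"

lemma unit_list_simps [simp]:
  "unit_list []" "unit_list (v # vs) \<longleftrightarrow> norm v \<le> 1 \<and> unit_list vs"
  "unit_list (us @ vs) \<longleftrightarrow> unit_list us \<and> unit_list vs"
  by (auto simp: unit_list_def)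

lemma unit_list_splits: "(a, b) \<in> set (splits vs) \<Longrightarrow> unit_list vs \<Longrightarrow> unit_list a \<and> unit_list b"
  using splits_sub[of a b vs] by (auto simp: unit_list_def)

text \<open>The Hoelder bound is required at every order up to m and not just at the top, since the
  product rule for increments pairs factors of low and high order.\<close>

definition holder_bounded :: "nat \<Rightarrow> real \<Rightarrow> real \<Rightarrow> ('a::euclidean_space \<Rightarrow> real) \<Rightarrow> bool" where
  "holder_bounded m \<theta> C f \<longleftrightarrow> smooth f \<and> (\<forall>vs x y. length vs \<le> m \<longrightarrow> unit_list vs \<longrightarrow>
     \<bar>dir_deriv vs f x\<bar> \<le> C \<and> \<bar>dir_deriv vs f x - dir_deriv vs f y\<bar> \<le> C * norm (x - y) powr \<theta>)"

lemma holder_boundedD: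
  fixes f :: "'a::euclidean_space \<Rightarrow> real"
  assumes "holder_bounded m \<theta> C f" "length vs \<le> m" "unit_list vs"
  shows "\<bar>dir_deriv vs f x\<bar> \<le> C" "\<bar>dir_deriv vs f x - dir_deriv vs f y\<bar> \<le> C * norm (x - y) powr \<theta>"
  using assms unfolding holder_bounded_def by blast+

lemma holder_bounded_smooth: "holder_bounded m \<theta> C f \<Longrightarrow> smooth f"
  by (simp add: holder_bounded_def)

lemma holder_bounded_nonneg: "holder_bounded m \<theta> C f \<Longrightarrow> 0 \<le> C"
  using holder_boundedD(1)[where vs = "[]" and x = 0 and f = f] by fastforce

lemma holder_bounded_mono:
  fixes f :: "'a::euclidean_space \<Rightarrow> real"
  assumes "holder_bounded m \<theta> C f" "C \<le> D" "n \<le> m" shows "holder_bounded n \<theta> D f"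
  unfolding holder_bounded_def
proof (intro conjI allI impI)
  show "smooth f" using assms(1) by (rule holder_bounded_smooth)
  fix vs :: "'a list" and x y :: 'a
  assume vs: "length vs \<le> n" "unit_list vs"
  have "C * norm (x - y) powr \<theta> \<le> D * norm (x - y) powr \<theta>" by (intro mult_right_mono assms) auto
  then show "\<bar>dir_deriv vs f x\<bar> \<le> D" "\<bar>dir_deriv vs f x - dir_deriv vs f y\<bar> \<le> D * norm (x - y) powr \<theta>"
    using holder_boundedD(1)[OF assms(1) _ vs(2), of x] holder_boundedD(2)[OF assms(1) _ vs(2), of x y] vs(1) assms(2,3) by auto
qed

lemma holder_bounded_Suc:
  fixes f :: "'a::euclidean_space \<Rightarrow> real"
  shows "holder_bounded (Suc m) \<theta> C f \<longleftrightarrow>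
    holder_bounded 0 \<theta> C f \<and> (\<forall>v. norm v \<le> 1 \<longrightarrow> holder_bounded m \<theta> C (\<lambda>x. frechet_derivative f (at x) v))"
proof safe
  assume f: "holder_bounded (Suc m) \<theta> C f"
  then show "holder_bounded 0 \<theta> C f" by (rule holder_bounded_mono) auto
  fix v :: 'a assume "norm v \<le> 1"
  then show "holder_bounded m \<theta> C (\<lambda>x. frechet_derivative f (at x) v)"
    unfolding holder_bounded_def
    using smooth_frechet[OF holder_bounded_smooth[OF f]]
      holder_boundedD(1)[OF f, of "v # vs" for vs] holder_boundedD(2)[OF f, of "v # vs" for vs] by auto
next
  assume f: "holder_bounded 0 \<theta> C f" "\<forall>v. norm v \<le> 1 \<longrightarrow> holder_bounded m \<theta> C (\<lambda>x. frechet_derivative f (at x) v)"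
  show "holder_bounded (Suc m) \<theta> C f"
    unfolding holder_bounded_def
  proof (intro conjI allI impI)
    fix vs :: "'a list" and x y :: 'a assume vs: "length vs \<le> Suc m" "unit_list vs"
    show "\<bar>dir_deriv vs f x\<bar> \<le> C" "\<bar>dir_deriv vs f x - dir_deriv vs f y\<bar> \<le> C * norm (x - y) powr \<theta>"
      using holder_boundedD[OF f(1), of "[]"] holder_boundedD[OF f(2)[rule_format], of "hd vs" "tl vs"] vs
      by (cases vs; auto)+
  qed (rule holder_bounded_smooth[OF f(1)])
qed

text \<open>Per Leibniz term the value is at most \<open>C * D\<close> and the increment at most
  \<open>2 * C * D\<close> times the Hoelder modulus, since one factor is varied at a time; there
  are at most \<open>2 ^ m\<close> terms.\<close>

lemma holder_bounded_mult:
  fixes f g :: "'a::euclidean_space \<Rightarrow> real"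
  assumes f: "holder_bounded m \<theta> C f" and g: "holder_bounded m \<theta> D g"
  shows "holder_bounded m \<theta> (2 ^ m * (2 * C * D)) (\<lambda>x. f x * g x)"
  unfolding holder_bounded_def
proof (intro conjI allI impI)
  have sm: "smooth f" "smooth g" using f g by (auto intro: holder_bounded_smooth)
  then show "smooth (\<lambda>x. f x * g x)" by (rule smooth_mult)
  have CD: "0 \<le> C" "0 \<le> D" using f g by (auto intro: holder_bounded_nonneg)
  fix vs :: "'a list" and x y :: 'a
  assume vs: "length vs \<le> m" "unit_list vs"
  have sp: "length a \<le> m" "length b \<le> m" "unit_list a" "unit_list b" if "(a, b) \<in> set (splits vs)" for a b
    using splits_sub[OF that] unit_list_splits[OF that] vs by auto
  have pow: "2 ^ length vs * r \<le> 2 ^ m * r" if "0 \<le> r" for r :: real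
    using vs(1) that by (intro mult_right_mono power_increasing) auto
  have "\<bar>dir_deriv vs (\<lambda>x. f x * g x) x - 0 * dir_deriv vs (\<lambda>x. f x * g x) x\<bar> \<le> 2 ^ length vs * (C * D)"
  proof (rule dir_deriv_mult_bound[OF sm])
    fix a b assume ab: "(a, b) \<in> set (splits vs)"
    have "\<bar>dir_deriv a f x\<bar> * \<bar>dir_deriv b g x\<bar> \<le> C * D"
      using sp[OF ab] CD by (intro mult_mono holder_boundedD(1)[OF f] holder_boundedD(1)[OF g]) auto
    then show "\<bar>dir_deriv a f x * dir_deriv b g x - 0 * (dir_deriv a f x * dir_deriv b g x)\<bar> \<le> C * D"
      by (simp add: abs_mult)
  qed
  also have "\<dots> \<le> 2 ^ m * (C * D)" using CD by (intro pow) auto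
  also have "\<dots> \<le> 2 ^ m * (2 * C * D)" using CD by simp
  finally show "\<bar>dir_deriv vs (\<lambda>x. f x * g x) x\<bar> \<le> 2 ^ m * (2 * C * D)" by simp
  define N where "N = norm (x - y) powr \<theta>"
  have N: "0 \<le> N" by (simp add: N_def)
  have "\<bar>dir_deriv vs (\<lambda>x. f x * g x) x - 1 * dir_deriv vs (\<lambda>x. f x * g x) y\<bar> \<le> 2 ^ length vs * (2 * C * D * N)"
  proof (rule dir_deriv_mult_bound[OF sm])
    fix a b assume ab: "(a, b) \<in> set (splits vs)"
    let ?a = "dir_deriv a f" and ?b = "dir_deriv b g"
    have "\<bar>?a x\<bar> * \<bar>?b x - ?b y\<bar> \<le> C * (D * N)" "\<bar>?a x - ?a y\<bar> * \<bar>?b y\<bar> \<le> (C * N) * D"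
      unfolding N_def using sp[OF ab] CD
      by (intro mult_mono holder_boundedD[OF f] holder_boundedD[OF g]; simp)+
    moreover have "?a x * ?b x - ?a y * ?b y = ?a x * (?b x - ?b y) + (?a x - ?a y) * ?b y"
      by (simp add: algebra_simps)
    moreover have "\<bar>?a x * (?b x - ?b y) + (?a x - ?a y) * ?b y\<bar> \<le> \<bar>?a x\<bar> * \<bar>?b x - ?b y\<bar> + \<bar>?a x - ?a y\<bar> * \<bar>?b y\<bar>"
      unfolding abs_mult[symmetric] by (rule abs_triangle_ineq)
    ultimately show "\<bar>?a x * ?b x - 1 * (?a y * ?b y)\<bar> \<le> 2 * C * D * N" by (simp add: mult_ac)
  qed
  also have "\<dots> \<le> 2 ^ m * (2 * C * D * N)" using CD N by (intro pow) auto
  finally show "\<bar>dir_deriv vs (\<lambda>x. f x * g x) x - dir_deriv vs (\<lambda>x. f x * g x) y\<bar> \<le> 2 ^ m * (2 * C * D) * norm (x - y) powr \<theta>"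
    by (simp add: N_def mult_ac)
qed

lemma exp_diff_le:
  fixes u v :: real assumes "u \<le> C" "v \<le> C" shows "\<bar>exp u - exp v\<bar> \<le> exp C * \<bar>u - v\<bar>"
proof -
  have *: "exp u - exp v \<le> exp C * \<bar>u - v\<bar>" if "u \<le> C" for u v :: real
  proof -
    have "exp u * (1 + (v - u)) \<le> exp u * exp (v - u)" by (intro mult_left_mono exp_ge_add_one_self) auto
    also have "\<dots> = exp v" by (simp add: exp_add[symmetric])
    finally have "exp u - exp v \<le> exp u * (u - v)" by (simp add: algebra_simps)
    also have "\<dots> \<le> exp u * \<bar>u - v\<bar>" by (intro mult_left_mono) auto
    also have "\<dots> \<le> exp C * \<bar>u - v\<bar>" using that by (intro mult_right_mono) auto
    finally show ?thesis .
  qed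
  show ?thesis using *[OF assms(1), of v] *[OF assms(2), of u] by (simp add: abs_minus_commute abs_le_iff)
qed

text \<open>D precedes a, so that one constant serves all mollifications. The derivative of
  \<open>exp a\<close> is \<open>exp a\<close> times that of a, so the product bound at order m
  gives order \<open>Suc m\<close>.\<close>

lemma holder_bounded_exp:
  "\<exists>D\<ge>0. \<forall>a::'a::euclidean_space \<Rightarrow> real. holder_bounded m \<theta> C a \<longrightarrow> holder_bounded m \<theta> D (\<lambda>x. exp (a x))"
proof (induction m)
  case 0
  have "holder_bounded 0 \<theta> (exp C * (1 + \<bar>C\<bar>)) (\<lambda>x. exp (a x))" if a: "holder_bounded 0 \<theta> C a" for a :: "'a \<Rightarrow> real"
    unfolding holder_bounded_def
  proof (intro conjI allI impI)
    show "smooth (\<lambda>x. exp (a x))" by (intro smooth_exp holder_bounded_smooth[OF a])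
    fix vs :: "'a list" and x y :: 'a
    assume "length vs \<le> 0"
    then have [simp]: "vs = []" by simp
    have C: "0 \<le> C" using a by (rule holder_bounded_nonneg)
    have le: "a z \<le> C" for z using holder_boundedD(1)[OF a, of "[]" z] by simp
    have "exp (a x) \<le> exp C" using le by simp
    also have "\<dots> \<le> exp C * (1 + \<bar>C\<bar>)" by simp
    finally show "\<bar>dir_deriv vs (\<lambda>x. exp (a x)) x\<bar> \<le> exp C * (1 + \<bar>C\<bar>)" by simp
    have "\<bar>exp (a x) - exp (a y)\<bar> \<le> exp C * \<bar>a x - a y\<bar>" by (intro exp_diff_le le)
    also have "\<dots> \<le> exp C * (C * norm (x - y) powr \<theta>)"
      using holder_boundedD(2)[OF a, of "[]" x y] by simp
    also have "\<dots> = (exp C * C) * norm (x - y) powr \<theta>" by simp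
    also have "\<dots> \<le> (exp C * (1 + \<bar>C\<bar>)) * norm (x - y) powr \<theta>" by (intro mult_right_mono) auto
    finally show "\<bar>dir_deriv vs (\<lambda>x. exp (a x)) x - dir_deriv vs (\<lambda>x. exp (a x)) y\<bar> \<le> exp C * (1 + \<bar>C\<bar>) * norm (x - y) powr \<theta>"
      by simp
  qed
  then show ?case by (intro exI[of _ "exp C * (1 + \<bar>C\<bar>)"]) auto
next
  case (Suc m)
  then obtain D where D: "D \<ge> 0" "\<And>a::'a \<Rightarrow> real. holder_bounded m \<theta> C a \<Longrightarrow> holder_bounded m \<theta> D (\<lambda>x. exp (a x))" by blast
  define E where "E = max D (2 ^ m * (2 * D * C))"
  have "holder_bounded (Suc m) \<theta> E (\<lambda>x. exp (a x))" if a: "holder_bounded (Suc m) \<theta> C a" for a :: "'a \<Rightarrow> real"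
    unfolding holder_bounded_Suc
  proof (intro conjI allI impI)
    have ea: "holder_bounded m \<theta> D (\<lambda>x. exp (a x))" by (intro D holder_bounded_mono[OF a]) auto
    show "holder_bounded 0 \<theta> E (\<lambda>x. exp (a x))" by (rule holder_bounded_mono[OF ea]) (auto simp: E_def)
    fix v :: 'a assume v: "norm v \<le> 1"
    have "(\<lambda>x. frechet_derivative (\<lambda>x. exp (a x)) (at x) v) = (\<lambda>x. exp (a x) * frechet_derivative a (at x) v)"
      using frechet_derivative_eqI[OF has_derivative_exp[OF smooth_has_derivative[OF holder_bounded_smooth[OF a]]]]
      by (simp add: fun_eq_iff mult.commute)
    moreover have "holder_bounded m \<theta> (2 ^ m * (2 * D * C)) (\<lambda>x. exp (a x) * frechet_derivative a (at x) v)"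
      by (intro holder_bounded_mult ea) (use a v holder_bounded_Suc in blast)
    ultimately show "holder_bounded m \<theta> E (\<lambda>x. frechet_derivative (\<lambda>x. exp (a x)) (at x) v)"
      by (simp add: E_def) (erule holder_bounded_mono, auto)
  qed
  then show ?case using D(1) by (intro exI[of _ E]) (auto simp: E_def)
qed

lemma differentiable_lipschitz:
  fixes f :: "'a::euclidean_space \<Rightarrow> real"
  assumes "\<And>x. f differentiable (at x)" and "\<And>v x. norm v \<le> 1 \<Longrightarrow> \<bar>frechet_derivative f (at x) v\<bar> \<le> C" and "0 \<le> C"
  shows "C-lipschitz_on UNIV f"
proof (rule lipschitz_onI)
  fix x y
  have "norm (f x - f y) \<le> C * norm (x - y)"
  proof (rule differentiable_bound[of UNIV f "\<lambda>x. frechet_derivative f (at x)"])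
    show "(f has_derivative frechet_derivative f (at x)) (at x within UNIV)" for x
      by (simp add: differentiable_has_derivative assms(1))
    show "onorm (frechet_derivative f (at x)) \<le> C" for x
    proof (rule onorm_le)
      interpret linear "frechet_derivative f (at x)" by (rule linear_frechet_derivative[OF assms(1)])
      fix v
      show "norm (frechet_derivative f (at x) v) \<le> C * norm v"
      proof (cases "v = 0")
        case False
        have "frechet_derivative f (at x) (v /\<^sub>R norm v) = frechet_derivative f (at x) v / norm v"
          by (simp add: scaleR divide_inverse mult.commute)
        then have "\<bar>frechet_derivative f (at x) v / norm v\<bar> \<le> C"
          using assms(2)[of "v /\<^sub>R norm v" x] False by simp
        then show ?thesis using False by (simp add: divide_le_eq)
      qed (simp add: zero)
    qed
  qed auto
  then show "dist (f x) (f y) \<le> C * dist x y" by (simp add: dist_norm)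
qed (fact assms)

lemma smooth_continuous: "smooth f \<Longrightarrow> continuous_on UNIV f"
  by (simp add: continuous_at_imp_continuous_on differentiable_imp_continuous_within smooth_differentiable)

lemma smooth_measurable: "smooth f \<Longrightarrow> f \<in> borel_measurable borel"
  by (intro borel_measurable_continuous_onI smooth_continuous)

text \<open>Up to the available regularity every derivative falls on g and costs a factor s, never a
  negative power of \<sigma>.\<close>

lemma dir_deriv_smoothing:
  fixes g :: "'a::euclidean_space \<Rightarrow> real"
  assumes "0 < \<sigma>" "holder_bounded m \<theta> C g" "length vs \<le> m" "unit_list vs"
  shows "dir_deriv vs (smoothing s \<sigma> g) = (\<lambda>x. s ^ length vs * smoothing s \<sigma> (dir_deriv vs g) x)"
  using assms(2-)
proof (induction vs arbitrary: g m)
  case (Cons v vs)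
  then obtain m' where m: "m = Suc m'" by (cases m) auto
  let ?g = "\<lambda>x. frechet_derivative g (at x) v"
  have g: "smooth g" using Cons.prems(1) by (rule holder_bounded_smooth)
  have g': "holder_bounded m' \<theta> C ?g" using Cons.prems m holder_bounded_Suc[of m' \<theta> C g] by auto
  have grow: "exp_growth h" if "holder_bounded n \<theta> C h" for h :: "'a \<Rightarrow> real" and n
    using holder_boundedD(1)[OF that, of "[]"] by (intro exp_growth_bounded smooth_measurable holder_bounded_smooth[OF that]) auto
  have "(\<lambda>x. frechet_derivative (smoothing s \<sigma> g) (at x) v) = (\<lambda>x. s * smoothing s \<sigma> ?g x)"
  proof (rule ext, rule smoothing_frechet_transfer[OF assms(1) grow[OF Cons.prems(1)]])
    show "C-lipschitz_on UNIV g"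
      using holder_boundedD(1)[OF Cons.prems(1), of "[w]" for w] m
      by (intro differentiable_lipschitz smooth_differentiable g holder_bounded_nonneg[OF Cons.prems(1)]) auto
    show "?g \<in> borel_measurable borel" by (intro smooth_measurable smooth_frechet g)
    show "AE y in lborel. g differentiable at y \<and> ?g y = frechet_derivative g (at y) v"
      using smooth_differentiable[OF g] by auto
  qed
  then show ?case
    using Cons.IH[OF g'] Cons.prems m
    by (simp add: fun_eq_iff dir_deriv_cmult smooth_smoothing[OF assms(1) grow[OF g']] mult.assoc)
qed simp

text \<open>The size in \<sigma> of a derivative of order n of the smoothed function, for n up to
  \<open>k + 2\<close>: orders up to k are borne by the function, the last two by the kernel, the
  second of them with the Hoelder gain.\<close>

definition weight :: "nat \<Rightarrow> real \<Rightarrow> real \<Rightarrow> nat \<Rightarrow> real" where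
  "weight k \<theta> \<sigma> n = (if n \<le> k then 1 else if n = Suc k then 1 / \<sigma> else \<sigma> powr (\<theta> - 2))"

lemma weight_nonneg: "0 < \<sigma> \<Longrightarrow> 0 \<le> weight k \<theta> \<sigma> n"
  by (auto simp: weight_def)

lemma weight_steps:
  fixes \<sigma> \<theta> :: real
  assumes "0 < \<sigma>" "\<sigma> \<le> 1" "0 \<le> \<theta>" "\<theta> < 1"
  shows "1 \<le> 1 / \<sigma>" "1 / \<sigma> \<le> \<sigma> powr (\<theta> - 2)"
proof -
  show "1 \<le> 1 / \<sigma>" using assms by (auto simp: le_divide_eq)
  have "\<sigma> powr (-1) \<le> \<sigma> powr (\<theta> - 2)" using assms by (intro powr_mono') auto
  then show "1 / \<sigma> \<le> \<sigma> powr (\<theta> - 2)" using assms by (simp add: powr_minus_divide)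
qed

text \<open>For \<open>k \<ge> 1\<close> a product of total order at most \<open>k + 2\<close> has at most one factor of order above \<open>k\<close>.\<close>

lemma weight_mult:
  assumes "0 < \<sigma>" "\<sigma> \<le> 1" "0 \<le> \<theta>" "\<theta> < 1" "1 \<le> k" "i + j \<le> k + 2"
  shows "weight k \<theta> \<sigma> i * weight k \<theta> \<sigma> j \<le> weight k \<theta> \<sigma> (i + j)"
  using weight_steps[OF assms(1-4)] assms(5,6) by (auto simp: weight_def)

text \<open>The first k directions are spent on g, which leaves a bounded and \<theta>-Hoelder
  function; the remaining one or two fall on the kernel.\<close>

lemma smoothing_weight_bound:
  fixes g :: "'a::euclidean_space \<Rightarrow> real"
  assumes g: "holder_bounded k \<theta> C g" and "0 < \<sigma>" "0 \<le> \<theta>" "\<theta> < 1" "0 \<le> s" "s \<le> 1"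
    and vs: "length vs \<le> k + 2" "unit_list vs"
  shows "\<bar>dir_deriv vs (smoothing s \<sigma> g) x\<bar> \<le> C * (1 + gauss_moment TYPE('a)) * weight k \<theta> \<sigma> (length vs)"
proof -
  define us where "us = take k vs"
  have us: "length us \<le> k" "unit_list us" using vs by (auto simp: us_def unit_list_def dest: in_set_takeD)
  have C: "0 \<le> C" using g by (rule holder_bounded_nonneg)
  let ?f = "dir_deriv us g"
  have f: "smooth ?f" by (intro smooth_dir_deriv holder_bounded_smooth[OF g])
  have fm: "?f \<in> borel_measurable borel" by (intro smooth_measurable f)
  have fb: "\<bar>?f y\<bar> \<le> C" for y by (rule holder_boundedD(1)[OF g us])
  have fH: "\<bar>?f y - ?f z\<bar> \<le> C * norm (y - z) powr \<theta>" for y z by (rule holder_boundedD(2)[OF g us])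
  have Tf: "smooth (smoothing s \<sigma> ?f)" by (intro smooth_smoothing assms exp_growth_bounded[OF fm fb])
  have pow: "\<bar>s ^ n * r\<bar> \<le> \<bar>r\<bar>" for n r
    using assms(5,6) mult_right_mono[of "s ^ n" 1 "\<bar>r\<bar>"] by (simp add: abs_mult power_le_one)
  have eq: "dir_deriv (us @ ws) (smoothing s \<sigma> g) x = s ^ length us * dir_deriv ws (smoothing s \<sigma> ?f) x" for ws
    unfolding dir_deriv_append dir_deriv_smoothing[OF assms(2) g us] by (rule dir_deriv_cmult[OF Tf])
  have M: "0 \<le> gauss_moment TYPE('a)" by (rule gauss_moment_nonneg)
  consider "length vs \<le> k" | "length vs = Suc k" | "length vs = Suc (Suc k)" using vs(1) by linarith
  then show ?thesis
  proof cases
    case 1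
    then have "vs = us @ []" by (simp add: us_def)
    then have "\<bar>dir_deriv vs (smoothing s \<sigma> g) x\<bar> \<le> \<bar>smoothing s \<sigma> ?f x\<bar>"
      using pow eq[of "[]"] by simp
    also have "\<dots> \<le> C" by (intro smoothing_bound fm assms) (simp add: fb)
    also have "\<dots> \<le> C * (1 + gauss_moment TYPE('a)) * weight k \<theta> \<sigma> (length vs)"
      using 1 C M by (simp add: weight_def algebra_simps)
    finally show ?thesis .
  next
    case 2
    then have "length (drop k vs) = Suc 0" by simp
    then obtain v where "drop k vs = [v]" by (metis length_0_conv length_Suc_conv)
    then have v: "vs = us @ [v]" unfolding us_def by (metis append_take_drop_id)
    then have "\<bar>dir_deriv vs (smoothing s \<sigma> g) x\<bar> \<le> \<bar>frechet_derivative (smoothing s \<sigma> ?f) (at x) v\<bar>"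
      using pow eq[of "[v]"] by simp
    also have "\<dots> \<le> C * gauss_moment TYPE('a) / \<sigma>"
      using vs(2) v by (intro smoothing_frechet_bound fm assms fb) auto
    also have "\<dots> \<le> C * (1 + gauss_moment TYPE('a)) * (1 / \<sigma>)"
      using C assms(2) by (simp add: divide_right_mono algebra_simps)
    finally show ?thesis using 2 by (simp add: weight_def)
  next
    case 3
    then have "length (drop k vs) = Suc (Suc 0)" by simp
    then obtain v u where "drop k vs = [v, u]" by (metis length_0_conv length_Suc_conv)
    then have v: "vs = us @ [v, u]" unfolding us_def by (metis append_take_drop_id)
    then have "\<bar>dir_deriv vs (smoothing s \<sigma> g) x\<bar> \<le> \<bar>frechet_derivative (\<lambda>x. frechet_derivative (smoothing s \<sigma> ?f) (at x) v) (at x) u\<bar>"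
      using pow eq[of "[v, u]"] by simp
    also have "\<dots> \<le> C * gauss_moment TYPE('a) * \<sigma> powr (\<theta> - 2)"
      using vs(2) v by (intro smoothing_frechet2_bound[OF fm assms(2) fb fH]) (use assms in auto)
    also have "\<dots> \<le> C * (1 + gauss_moment TYPE('a)) * \<sigma> powr (\<theta> - 2)"
      using C by (intro mult_right_mono mult_left_mono) auto
    finally show ?thesis using 3 by (simp add: weight_def)
  qed
qed

text \<open>The bound is a function of the order because the orders above k may blow up at different
  rates as \<sigma> tends to 0.\<close>

definition deriv_bounded :: "nat \<Rightarrow> (nat \<Rightarrow> real) \<Rightarrow> ('a::euclidean_space \<Rightarrow> real) \<Rightarrow> bool" where
  "deriv_bounded m w f \<longleftrightarrow> (\<forall>vs x. length vs \<le> m \<longrightarrow> unit_list vs \<longrightarrow> \<bar>dir_deriv vs f x\<bar> \<le> w (length vs))"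

lemma deriv_boundedD: "deriv_bounded m w f \<Longrightarrow> length vs \<le> m \<Longrightarrow> unit_list vs \<Longrightarrow> \<bar>dir_deriv vs f x\<bar> \<le> w (length vs)"
  by (simp add: deriv_bounded_def)

lemma deriv_bounded_mono:
  "deriv_bounded m w f \<Longrightarrow> n \<le> m \<Longrightarrow> (\<And>i. i \<le> n \<Longrightarrow> w i \<le> w' i) \<Longrightarrow> deriv_bounded n w' f"
  unfolding deriv_bounded_def by (meson order_trans)

lemma deriv_bounded_frechet:
  "deriv_bounded (Suc m) w f \<Longrightarrow> norm v \<le> 1 \<Longrightarrow> deriv_bounded m (\<lambda>n. w (Suc n)) (\<lambda>x. frechet_derivative f (at x) v)"
  unfolding deriv_bounded_def by (metis Suc_le_mono dir_deriv.simps(2) length_Cons unit_list_simps(2))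

text \<open>Three weights are kept apart because one factor may be a derivative, whose weight is
  shifted by one order.\<close>

lemma deriv_bounded_mult:
  fixes f g :: "'a::euclidean_space \<Rightarrow> real"
  assumes "smooth f" "smooth g" "deriv_bounded m (\<lambda>n. C * u n) f" "deriv_bounded m (\<lambda>n. D * v n) g" "0 \<le> C" "0 \<le> D"
    and nn: "\<And>n. 0 \<le> u n" "\<And>n. 0 \<le> w n" and uv: "\<And>i j. i + j \<le> m \<Longrightarrow> u i * v j \<le> w (i + j)"
  shows "deriv_bounded m (\<lambda>n. (2 ^ m * (C * D)) * w n) (\<lambda>x. f x * g x)"
  unfolding deriv_bounded_def
proof (intro allI impI)
  fix vs :: "'a list" and x :: 'a assume vs: "length vs \<le> m" "unit_list vs"
  have "\<bar>dir_deriv vs (\<lambda>x. f x * g x) x - 0 * dir_deriv vs (\<lambda>x. f x * g x) x\<bar> \<le> 2 ^ length vs * (C * D * w (length vs))"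
  proof (rule dir_deriv_mult_bound[OF assms(1,2)])
    fix a b assume ab: "(a, b) \<in> set (splits vs)"
    have *: "length a + length b = length vs" "unit_list a" "unit_list b"
      using splits_sub[OF ab] unit_list_splits[OF ab] vs by auto
    have "\<bar>dir_deriv a f x\<bar> * \<bar>dir_deriv b g x\<bar> \<le> (C * u (length a)) * (D * v (length b))"
      using * vs assms(5) nn(1) by (intro mult_mono deriv_boundedD[OF assms(3)] deriv_boundedD[OF assms(4)]) auto
    also have "\<dots> = C * D * (u (length a) * v (length b))" by simp
    also have "\<dots> \<le> C * D * w (length vs)"
      using uv[of "length a" "length b"] * vs assms(5,6) by (intro mult_left_mono) auto
    finally show "\<bar>dir_deriv a f x * dir_deriv b g x - 0 * (dir_deriv a f x * dir_deriv b g x)\<bar> \<le> C * D * w (length vs)"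
      by (simp add: abs_mult)
  qed
  also have "\<dots> \<le> 2 ^ m * (C * D * w (length vs))"
    using vs(1) assms(5,6) nn(2) by (intro mult_right_mono power_increasing) auto
  finally show "\<bar>dir_deriv vs (\<lambda>x. f x * g x) x\<bar> \<le> 2 ^ m * (C * D) * w (length vs)" by (simp add: mult.assoc)
qed

text \<open>The recursion is the derivative of \<open>1 / F\<close>, namely
  \<open>- (1 / F)^2\<close> times that of F, with two applications of the product bound. D is
  chosen before F and w: later w depends on \<sigma>, and D must not.\<close>

lemma deriv_bounded_inverse:
  assumes "0 < c" "0 \<le> C"
  shows "\<exists>D\<ge>0. \<forall>(F::'a::euclidean_space \<Rightarrow> real) w. smooth F \<longrightarrow> (\<forall>x. c \<le> F x) \<longrightarrow> deriv_bounded m (\<lambda>n. C * w n) F \<longrightarrow>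
     (\<forall>n. 0 \<le> w n) \<longrightarrow> w 0 = 1 \<longrightarrow> (\<forall>i j. i + j \<le> m \<longrightarrow> w i * w j \<le> w (i + j)) \<longrightarrow>
     deriv_bounded m (\<lambda>n. D * w n) (\<lambda>x. inverse (F x))"
proof (induction m)
  case 0
  have "\<bar>inverse (F x)\<bar> \<le> inverse c" if "\<forall>x. c \<le> F x" for F :: "'a \<Rightarrow> real" and x
    using that[rule_format, of x] assms(1) by (simp add: le_imp_inverse_le)
  then show ?case using assms(1) by (intro exI[of _ "inverse c"]) (auto simp: deriv_bounded_def)
next
  case (Suc m)
  then obtain D where D: "D \<ge> 0"
    "\<And>(F::'a \<Rightarrow> real) w. smooth F \<Longrightarrow> \<forall>x. c \<le> F x \<Longrightarrow> deriv_bounded m (\<lambda>n. C * w n) F \<Longrightarrow>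
     \<forall>n. 0 \<le> w n \<Longrightarrow> w 0 = 1 \<Longrightarrow> \<forall>i j. i + j \<le> m \<longrightarrow> w i * w j \<le> w (i + j) \<Longrightarrow>
     deriv_bounded m (\<lambda>n. D * w n) (\<lambda>x. inverse (F x))" by blast
  \<comment> \<open>The first entry covers order 0; the second is the constant that two product
    bounds give for \<open>(1 / F)^2\<close> times a derivative of F.\<close>
  define E where "E = max D (2 ^ m * (2 ^ m * (D * D) * C))"
  have "deriv_bounded (Suc m) (\<lambda>n. E * w n) (\<lambda>x. inverse (F x))"
    if F: "smooth F" "\<forall>x. c \<le> F x" "deriv_bounded (Suc m) (\<lambda>n. C * w n) F"
      and w: "\<forall>n. 0 \<le> w n" "w 0 = 1" "\<forall>i j. i + j \<le> Suc m \<longrightarrow> w i * w j \<le> w (i + j)" for F :: "'a \<Rightarrow> real" and w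
    unfolding deriv_bounded_def
  proof (intro allI impI)
    fix vs :: "'a list" and x :: 'a assume vs: "length vs \<le> Suc m" "unit_list vs"
    have pos: "0 < F x" for x using F(2) assms(1) by (meson less_le_trans)
    have w': "w i * w (Suc j) \<le> w (Suc (i + j))" if "i + j \<le> m" for i j
      using w(3)[rule_format, of i "Suc j"] that by simp
    have inv: "deriv_bounded m (\<lambda>n. D * w n) (\<lambda>x. inverse (F x))"
      by (intro D F w(1,2) deriv_bounded_mono[OF F(3)]) (use w(3) in auto)
    have sinv: "smooth (\<lambda>x. inverse (F x))" by (intro smooth_inverse F pos)
    show "\<bar>dir_deriv vs (\<lambda>x. inverse (F x)) x\<bar> \<le> E * w (length vs)"
    proof (cases vs)
      case Nil
      then show ?thesis using deriv_boundedD[OF inv, of "[]" x] w(2) by (simp add: E_def)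
    next
      case (Cons v ws)
      have sq: "deriv_bounded m (\<lambda>n. (2 ^ m * (D * D)) * w n) (\<lambda>x. inverse (F x) * inverse (F x))"
        by (intro deriv_bounded_mult[OF sinv sinv inv inv]) (use D(1) w in auto)
      have "deriv_bounded m (\<lambda>n. (2 ^ m * (2 ^ m * (D * D) * C)) * w (Suc n))
          (\<lambda>x. inverse (F x) * inverse (F x) * frechet_derivative F (at x) v)"
        by (rule deriv_bounded_mult[OF smooth_mult[OF sinv sinv] smooth_frechet[OF F(1)] sq deriv_bounded_frechet[OF F(3)]])
          (use D(1) assms w(1) w' Cons vs in auto)
      then have "\<bar>dir_deriv ws (\<lambda>x. inverse (F x) * inverse (F x) * frechet_derivative F (at x) v) x\<bar>
          \<le> (2 ^ m * (2 ^ m * (D * D) * C)) * w (length vs)"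
        using Cons vs by (simp add: deriv_bounded_def)
      also have "\<dots> \<le> E * w (length vs)" using w(1) by (intro mult_right_mono) (auto simp: E_def)
      finally have *: "\<bar>dir_deriv ws (\<lambda>x. inverse (F x) * inverse (F x) * frechet_derivative F (at x) v) x\<bar> \<le> E * w (length vs)" .
      have "(\<lambda>x. frechet_derivative (\<lambda>x. inverse (F x)) (at x) v) =
          (\<lambda>x. -1 * (inverse (F x) * inverse (F x) * frechet_derivative F (at x) v))"
      proof (rule ext)
        fix x
        have "F x \<noteq> 0" using pos[of x] by simp
        then have "((\<lambda>x. inverse (F x)) has_derivative (\<lambda>v. - (inverse (F x) * frechet_derivative F (at x) v * inverse (F x)))) (at x)"
          by (intro Deriv.has_derivative_inverse smooth_has_derivative F)
        from frechet_derivative_eqI[OF this] show "frechet_derivative (\<lambda>x. inverse (F x)) (at x) v =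
          -1 * (inverse (F x) * inverse (F x) * frechet_derivative F (at x) v)" by simp
      qed
      then have "dir_deriv vs (\<lambda>x. inverse (F x)) x = -1 * dir_deriv ws (\<lambda>x. inverse (F x) * inverse (F x) * frechet_derivative F (at x) v) x"
        unfolding Cons dir_deriv.simps
        by (simp only: dir_deriv_cmult[OF smooth_mult[OF smooth_mult[OF sinv sinv] smooth_frechet[OF F(1)]]])
      with * show ?thesis by simp
    qed
  qed
  then show ?case using D(1) by (intro exI[of _ E]) (auto simp: E_def)
qed

text \<open>The first direction turns \<open>ln F\<close> into \<open>1 / F\<close> times a
  derivative of F, to which the product bound applies. Order 0 is left out since the score only sees
  derivatives of \<open>ln F\<close>.\<close>

lemma deriv_bounded_ln:
  assumes "0 < c" "0 \<le> C"
  shows "\<exists>D\<ge>0. \<forall>(F::'a::euclidean_space \<Rightarrow> real) w. smooth F \<longrightarrow> (\<forall>x. c \<le> F x) \<longrightarrow> deriv_bounded (Suc m) (\<lambda>n. C * w n) F \<longrightarrow>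
     (\<forall>n. 0 \<le> w n) \<longrightarrow> w 0 = 1 \<longrightarrow> (\<forall>i j. i + j \<le> Suc m \<longrightarrow> w i * w j \<le> w (i + j)) \<longrightarrow>
     (\<forall>v vs x. length vs \<le> m \<longrightarrow> unit_list (v # vs) \<longrightarrow> \<bar>dir_deriv (v # vs) (\<lambda>x. ln (F x)) x\<bar> \<le> D * w (Suc (length vs)))"
proof -
  obtain D where D: "D \<ge> 0"
    "\<And>(F::'a \<Rightarrow> real) w. smooth F \<Longrightarrow> \<forall>x. c \<le> F x \<Longrightarrow> deriv_bounded m (\<lambda>n. C * w n) F \<Longrightarrow>
     \<forall>n. 0 \<le> w n \<Longrightarrow> w 0 = 1 \<Longrightarrow> \<forall>i j. i + j \<le> m \<longrightarrow> w i * w j \<le> w (i + j) \<Longrightarrow>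
     deriv_bounded m (\<lambda>n. D * w n) (\<lambda>x. inverse (F x))"
    using deriv_bounded_inverse[OF assms, of m] by blast
  have "\<bar>dir_deriv (v # vs) (\<lambda>x. ln (F x)) x\<bar> \<le> (2 ^ m * (D * C)) * w (Suc (length vs))"
    if F: "smooth F" "\<forall>x. c \<le> F x" "deriv_bounded (Suc m) (\<lambda>n. C * w n) F"
      and w: "\<forall>n. 0 \<le> w n" "w 0 = 1" "\<forall>i j. i + j \<le> Suc m \<longrightarrow> w i * w j \<le> w (i + j)"
      and vs: "length vs \<le> m" "unit_list (v # vs)" for F :: "'a \<Rightarrow> real" and w v vs x
  proof -
    have pos: "0 < F x" for x using F(2) assms(1) by (meson less_le_trans)
    have w': "w i * w (Suc j) \<le> w (Suc (i + j))" if "i + j \<le> m" for i j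
      using w(3)[rule_format, of i "Suc j"] that by simp
    have inv: "deriv_bounded m (\<lambda>n. D * w n) (\<lambda>x. inverse (F x))"
      by (intro D F w(1,2) deriv_bounded_mono[OF F(3)]) (use w(3) in auto)
    have sinv: "smooth (\<lambda>x. inverse (F x))" by (intro smooth_inverse F pos)
    have "deriv_bounded m (\<lambda>n. (2 ^ m * (D * C)) * w (Suc n)) (\<lambda>x. inverse (F x) * frechet_derivative F (at x) v)"
      by (rule deriv_bounded_mult[OF sinv smooth_frechet[OF F(1)] inv deriv_bounded_frechet[OF F(3)]])
        (use D(1) assms w(1) w' vs in auto)
    moreover have "(\<lambda>x. frechet_derivative (\<lambda>x. ln (F x)) (at x) v) = (\<lambda>x. inverse (F x) * frechet_derivative F (at x) v)"
    proof (rule ext)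
      fix x
      have "((\<lambda>x. ln (F x)) has_derivative (\<lambda>v. frechet_derivative F (at x) v * inverse (F x))) (at x)"
        by (intro has_derivative_ln pos smooth_has_derivative F)
      from frechet_derivative_eqI[OF this] show "frechet_derivative (\<lambda>x. ln (F x)) (at x) v =
          inverse (F x) * frechet_derivative F (at x) v" by simp
    qed
    ultimately show ?thesis using vs by (simp add: deriv_bounded_def)
  qed
  then show ?thesis using D(1) assms(2) by (intro exI[of _ "2 ^ m * (D * C)"]) auto
qed

section \<open>Functions of the Hoelder class\<close>

text \<open>The set where the bound fails is open and null, hence empty.\<close>

lemma continuous_AE_le_imp_le:
  fixes f :: "'a::euclidean_space \<Rightarrow> real"
  assumes "continuous_on UNIV f" "AE x in lborel. f x \<le> K"
  shows "f x \<le> K"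
proof (rule ccontr)
  assume "\<not> f x \<le> K"
  define S where "S = {x. K < f x}"
  have S: "open S" "x \<in> S"
    using open_Collect_less[OF continuous_on_const assms(1), of K] \<open>\<not> f x \<le> K\<close> by (auto simp: S_def)
  have "AE x in lborel. x \<notin> S" using assms(2) by (auto simp: S_def not_less)
  then have "negligible S"
    using AE_completion[of "\<lambda>x. x \<notin> S"] S(1)
    by (simp add: negligible_iff_null_sets AE_iff_null_sets null_sets_completionI)
  then show False using open_not_negligible S by blast
qed

lemma AE_lborel_shift:
  fixes c :: "'a::euclidean_space"
  assumes "AE y in lborel. P y" shows "AE z in lborel. P (c + z)"
proof (rule AE_distrD[of "(+) c" lborel borel])
  show "AE y in distr lborel borel ((+) c). P y" unfolding lborel_distr_plus by (rule assms)
qed simp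

text \<open>The same z is used for x and y, and for almost every z both \<open>x + z\<close> and
  \<open>y + z\<close> lie in the full set A. So a Hoelder bound known only on A becomes one
  everywhere, with the same constant.\<close>

lemma smoothing_diff_bound:
  fixes g :: "'a::euclidean_space \<Rightarrow> real"
  assumes [measurable]: "g \<in> borel_measurable borel" and "0 < \<sigma>" "AE y in lborel. \<bar>g y\<bar> \<le> C"
    and A: "AE y in lborel. y \<in> A" "\<And>y z. y \<in> A \<Longrightarrow> z \<in> A \<Longrightarrow> \<bar>g y - g z\<bar> \<le> B * norm (y - z) powr \<theta>"
  shows "\<bar>smoothing 1 \<sigma> g x - smoothing 1 \<sigma> g y\<bar> \<le> B * norm (x - y) powr \<theta>"
proof -
  have eq: "smoothing 1 \<sigma> g x = (\<integral>z. g (x + z) * gauss \<sigma> z \<partial>lborel)" for x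
    unfolding smoothing_def by (subst lborel_integral_shift[of _ x]) auto
  have i: "integrable lborel (\<lambda>z. g (x + z) * gauss \<sigma> z)" for x
  proof (rule Bochner_Integration.integrable_bound)
    show "integrable lborel (\<lambda>z::'a. C * gauss \<sigma> z)" using assms(2) by simp
    show "AE z in lborel. norm (g (x + z) * gauss \<sigma> z) \<le> norm (C * gauss \<sigma> z)"
      using AE_lborel_shift[OF assms(3), of x]
    proof eventually_elim
      case (elim z)
      then show ?case by (auto simp: abs_mult intro!: mult_right_mono)
    qed
  qed measurable
  define N where "N = norm (x - y) powr \<theta>"
  have "\<bar>smoothing 1 \<sigma> g x - smoothing 1 \<sigma> g y\<bar> = \<bar>\<integral>z. (g (x + z) - g (y + z)) * gauss \<sigma> z \<partial>lborel\<bar>"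
    unfolding eq by (simp add: left_diff_distrib i)
  also have "\<dots> \<le> (\<integral>z. B * N * gauss \<sigma> (z::'a) \<partial>lborel)"
  proof (rule order_trans[OF integral_abs_bound], rule integral_mono_AE)
    show "integrable lborel (\<lambda>z. \<bar>(g (x + z) - g (y + z)) * gauss \<sigma> z\<bar>)"
      by (simp add: left_diff_distrib i)
    show "AE z in lborel. \<bar>(g (x + z) - g (y + z)) * gauss \<sigma> z\<bar> \<le> B * N * gauss \<sigma> z"
      using AE_lborel_shift[OF A(1), of x] AE_lborel_shift[OF A(1), of y]
    proof eventually_elim
      case (elim z)
      then have "\<bar>g (x + z) - g (y + z)\<bar> \<le> B * N" using A(2)[of "x + z" "y + z"] by (simp add: N_def)
      then show ?case by (simp add: abs_mult gauss_nonneg mult_right_mono)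
    qed
  qed (use assms(2) in simp)
  also have "\<dots> = B * N" using assms(2) by simp
  finally show ?thesis by (simp add: N_def)
qed

section \<open>Multi-indices and lists of coordinate directions\<close>

lemma finite_mi_order: "finite {\<nu> :: 'n::finite \<Rightarrow> nat. mi_order \<nu> \<le> k}"
proof (rule finite_subset)
  show "finite {\<nu> :: 'n \<Rightarrow> nat. \<forall>i. (i \<in> UNIV \<longrightarrow> \<nu> i \<in> {..k}) \<and> (i \<notin> UNIV \<longrightarrow> \<nu> i = 0)}"
    by (rule finite_set_of_finite_funs) auto
  show "{\<nu>. mi_order \<nu> \<le> k} \<subseteq> {\<nu> :: 'n \<Rightarrow> nat. \<forall>i. (i \<in> UNIV \<longrightarrow> \<nu> i \<in> {..k}) \<and> (i \<notin> UNIV \<longrightarrow> \<nu> i = 0)}"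
  proof -
    have "\<nu> i \<le> mi_order \<nu>" for \<nu> :: "'n \<Rightarrow> nat" and i unfolding mi_order_def by (rule member_le_sum) auto
    then show ?thesis using order_trans by fastforce
  qed
qed

lemma mi_order_count_list: "mi_order (count_list is) = length is"
  unfolding mi_order_def by (rule sum_count_set) auto

abbreviation axes :: "'n::finite list \<Rightarrow> (real ^ 'n) list" where
  "axes is \<equiv> map (\<lambda>i. axis i 1) is"

text \<open>The list behind \<open>partial_deriv\<close> is an arbitrary choice; what is known of it
  is that it permutes the given one.\<close>

lemma partial_deriv_count_list:
  obtains js where "mset js = mset is" "partial_deriv (count_list is) f = dir_deriv (axes js) f"
proof
  let ?js = "SOME js. \<forall>i. count_list js i = count_list is i"
  have "\<forall>i. count_list ?js i = count_list is i" by (rule someI[of _ "is"]) simp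
  then show "mset ?js = mset is" by (simp add: multiset_eq_iff count_mset)
  show "partial_deriv (count_list is) f = dir_deriv (axes ?js) f" by (simp add: partial_deriv_def)
qed

text \<open>All summands of \<open>holder_norm\<close> are nonnegative, so each is at most K. The
  list js is the one picked by \<open>partial_deriv\<close>; at top order
  \<open>dir_deriv_perm\<close> does not allow exchanging it, because that derivative of a is only
  known to exist almost everywhere.\<close>

lemma holder_class_bounds:
  fixes a :: "real ^ 'n::finite \<Rightarrow> real"
  assumes a: "a \<in> holder_class \<beta> K" and "0 < K"
  defines "k \<equiv> nat \<lfloor>\<beta>\<rfloor>"
  shows "length is \<le> k \<Longrightarrow> \<exists>js. mset js = mset is \<and> (AE x in lborel. \<bar>dir_deriv (axes js) a x\<bar> \<le> K)
      \<and> (length is = k \<longrightarrow> (\<forall>x\<in>diff_points k a. \<forall>y\<in>diff_points k a.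
          \<bar>dir_deriv (axes js) a x - dir_deriv (axes js) a y\<bar> \<le> K * norm (x - y) powr (\<beta> - real k)))"
proof -
  assume len: "length is \<le> k"
  let ?S = "\<lambda>\<nu>. esssup lborel (\<lambda>x. ennreal \<bar>partial_deriv \<nu> a x\<bar>)"
  let ?H = "\<lambda>\<nu>. SUP (x, y) \<in> {(x, y). x \<in> diff_points k a \<and> y \<in> diff_points k a \<and> x \<noteq> y}.
            ennreal (\<bar>partial_deriv \<nu> a x - partial_deriv \<nu> a y\<bar> / norm (x - y) powr (\<beta> - real k))"
  have le: "(\<Sum>\<nu> | mi_order \<nu> \<le> k. ?S \<nu>) + (\<Sum>\<nu> | mi_order \<nu> = k. ?H \<nu>) \<le> ennreal K"
    using a by (simp add: holder_class_def holder_norm_def Let_def k_def)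
  obtain js where js: "mset js = mset is" "partial_deriv (count_list is) a = dir_deriv (axes js) a"
    by (rule partial_deriv_count_list)
  have "?S (count_list is) \<le> (\<Sum>\<nu> | mi_order \<nu> \<le> k. ?S \<nu>)"
    by (rule member_le_sum) (auto simp: finite_mi_order mi_order_count_list len)
  also have "\<dots> \<le> ennreal K" by (rule order_trans[OF _ le]) simp
  finally have S: "?S (count_list is) \<le> ennreal K" .
  have "AE x in lborel. \<bar>partial_deriv (count_list is) a x\<bar> \<le> K"
    using esssup_AE[of "\<lambda>x. ennreal \<bar>partial_deriv (count_list is) a x\<bar>" lborel]
  proof eventually_elim
    case (elim x)
    then show ?case using S \<open>0 < K\<close> by (meson ennreal_le_iff less_imp_le order_trans)
  qed
  moreover have "\<bar>dir_deriv (axes js) a x - dir_deriv (axes js) a y\<bar> \<le> K * norm (x - y) powr (\<beta> - real k)"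
    if "length is = k" "x \<in> diff_points k a" "y \<in> diff_points k a" for x y
  proof (cases "x = y")
    case False
    have fin: "finite {\<nu> :: 'n \<Rightarrow> nat. mi_order \<nu> = k}"
      by (rule finite_subset[OF _ finite_mi_order[of k]]) auto
    have "ennreal (\<bar>dir_deriv (axes js) a x - dir_deriv (axes js) a y\<bar> / norm (x - y) powr (\<beta> - real k)) \<le> ?H (count_list is)"
      using that False by (intro SUP_upper2[of "(x, y)"]) (auto simp: js(2))
    also have "\<dots> \<le> (\<Sum>\<nu> | mi_order \<nu> = k. ?H \<nu>)"
      by (rule member_le_sum) (auto simp: fin mi_order_count_list that)
    also have "\<dots> \<le> ennreal K" by (rule order_trans[OF _ le]) simp
    finally have "\<bar>dir_deriv (axes js) a x - dir_deriv (axes js) a y\<bar> / norm (x - y) powr (\<beta> - real k) \<le> K"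
      using \<open>0 < K\<close> by (simp add: ennreal_le_iff)
    then show ?thesis using False by (simp add: divide_le_eq)
  qed simp
  ultimately show ?thesis using js by auto
qed

lemma Basis_axes: "(Basis :: (real ^ 'n::finite) set) = range (\<lambda>i. axis i 1)"
  by (auto simp: Basis_vec_def)

lemma axes_exist: "set bs \<subseteq> (Basis :: (real ^ 'n::finite) set) \<Longrightarrow> \<exists>is. bs = axes is"
  unfolding Basis_axes by (metis ex_map_conv subset_iff imageE)

lemma frechet_bound_from_axes:
  fixes f :: "real ^ 'n::finite \<Rightarrow> real"
  assumes "f differentiable (at x)" "\<And>i. \<bar>frechet_derivative f (at x) (axis i 1)\<bar> \<le> K" "norm v \<le> 1"
  shows "\<bar>frechet_derivative f (at x) v\<bar> \<le> real DIM(real ^ 'n) * K"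
proof -
  have "\<bar>\<Sum>b\<in>Basis. (v \<bullet> b) * frechet_derivative f (at x) b\<bar> \<le> (\<Sum>b\<in>(Basis :: (real ^ 'n) set). K)"
  proof (rule order_trans[OF sum_abs], rule sum_mono)
    fix b :: "real ^ 'n" assume b: "b \<in> Basis"
    have "\<bar>v \<bullet> b\<bar> \<le> 1" using Cauchy_Schwarz_ineq2[of v b] b assms(3) by simp
    moreover have "\<bar>frechet_derivative f (at x) b\<bar> \<le> K" using b assms(2) by (auto simp: Basis_axes)
    ultimately show "\<bar>(v \<bullet> b) * frechet_derivative f (at x) b\<bar> \<le> K"
      using mult_mono[of "\<bar>v \<bullet> b\<bar>" 1 "\<bar>frechet_derivative f (at x) b\<bar>" K] by (simp add: abs_mult)
  qed
  then show ?thesis using frechet_expand[OF assms(1), of v] by simp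
qed

lemma dir_deriv_snoc: "dir_deriv (us @ [v]) f x = frechet_derivative (dir_deriv us f) (at x) v"
  by (simp add: dir_deriv_append)

lemma times_differentiable_dir_deriv:
  "times_differentiable (length vs + n) f \<Longrightarrow> times_differentiable n (dir_deriv vs f)"
  by (induction vs arbitrary: f) auto

text \<open>\<open>frechet_derivative\<close> has junk values off the points of differentiability, so that the top order
  derivatives of \<open>a\<close> need not be measurable.\<close>

lemma AE_measurable_version:
  fixes f :: "'a::euclidean_space \<Rightarrow> real"
  assumes [measurable]: "f \<in> borel_measurable borel" and "AE x in lborel. f differentiable (at x)"
  obtains g where "g \<in> borel_measurable borel" "AE x in lborel. f differentiable (at x) \<and> g x = frechet_derivative f (at x) v"
    "\<And>x. f differentiable (at x) \<Longrightarrow> g x = frechet_derivative f (at x) v"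
proof
  \<comment> \<open>Where f is differentiable this limit is the directional derivative; elsewhere
    \<open>lim\<close> may be a default value, and measurability holds regardless.\<close>
  let ?g = "\<lambda>x. lim (\<lambda>n. (f (x + (1 / Suc n) *\<^sub>R v) - f x) / (1 / Suc n))"
  show "?g \<in> borel_measurable borel" by measurable
  show *: "?g x = frechet_derivative f (at x) v" if "f differentiable (at x)" for x
    by (rule limI) (use differentiable_quotient_tendsto[OF that, of 1 v] in \<open>simp only: mult_1\<close>)
  show "AE x in lborel. f differentiable (at x) \<and> ?g x = frechet_derivative f (at x) v"
    using assms(2) by eventually_elim (use * in blast)
qed

text \<open>The third claim is uniform in the mollification width. Derivatives of a of order below k
  exist everywhere and are continuous; order k is handled almost everywhere, under the integral of
  the mollification.\<close>

lemma smoothing_holder_class: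
  fixes a :: "real ^ 'n::finite \<Rightarrow> real"
  assumes a: "a \<in> holder_class \<beta> K" and "0 < K" "1 \<le> \<beta>"
  defines "k \<equiv> nat \<lfloor>\<beta>\<rfloor>" and "d \<equiv> real DIM(real ^ 'n)"
  shows "continuous_on UNIV a" "\<And>x. \<bar>a x\<bar> \<le> K"
    and "\<And>\<epsilon>. 0 < \<epsilon> \<Longrightarrow> holder_bounded k (\<beta> - real k) (d ^ k * ((d + 2) * K)) (smoothing 1 \<epsilon> a)"
proof -
  define \<theta> where "\<theta> = \<beta> - real k"
  have "1 \<le> k" using assms(3) unfolding k_def by (simp add: le_nat_floor)
  \<comment> \<open>m = k - 1 is the order up to which a is known to be differentiable at every
    point.\<close>
  then obtain m where k: "k = Suc m" by (cases k) auto
  have \<theta>: "0 \<le> \<theta>" "\<theta> \<le> 1" unfolding \<theta>_def k_def using assms(3) by linarith+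
  have d: "1 \<le> d" unfolding d_def using DIM_positive[where 'a = "real ^ 'n"] by linarith
  have td: "times_differentiable m a" and lip: "\<And>vs. length vs = m \<Longrightarrow> \<exists>L. L-lipschitz_on UNIV (dir_deriv vs a)"
    and ae: "AE x in lborel. x \<in> diff_points k a"
    using a unfolding holder_class_def C_ae_def k_def[symmetric] by (auto simp: k)
  have diff: "dir_deriv vs a differentiable (at x)" if "length vs < m" for vs x
  proof -
    have "times_differentiable 1 (dir_deriv vs a)"
      by (rule times_differentiable_dir_deriv, rule times_differentiable_mono[OF _ td]) (use that in simp)
    then show ?thesis by simp
  qed
  have cont: "continuous_on UNIV (dir_deriv vs a)" if "length vs \<le> m" for vs
  proof (cases "length vs = m")
    case True
    then show ?thesis using lip lipschitz_on_continuous_on by blast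
  next
    case False
    then show ?thesis using that
      by (intro continuous_at_imp_continuous_on ballI differentiable_imp_continuous_within diff) auto
  qed
  \<comment> \<open>Up to order m the derivatives are symmetric and continuous, so the almost
    everywhere bound for one ordering holds at every point for each ordering.\<close>
  have bd: "\<bar>dir_deriv (axes is) a x\<bar> \<le> K" if len: "length is \<le> m" for "is" x
  proof -
    obtain js where js: "mset js = mset is" "AE x in lborel. \<bar>dir_deriv (axes js) a x\<bar> \<le> K"
    proof -
      have "length is \<le> nat \<lfloor>\<beta>\<rfloor>" using len k unfolding k_def by linarith
      from holder_class_bounds[OF a assms(2) this] show ?thesis using that by blast
    qed
    have "dir_deriv (axes is) a = dir_deriv (axes js) a"
      by (rule dir_deriv_perm) (use times_differentiable_mono[OF that td] js in auto)
    then show ?thesis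
      using continuous_AE_le_imp_le[OF continuous_on_rabs[OF cont] js(2)] js(1) that
      by (metis length_map size_mset)
  qed
  show ca: "continuous_on UNIV a" using cont[of "[]"] by simp
  show ba: "\<bar>a x\<bar> \<le> K" for x using bd[of "[]"] by simp
  have lip': "\<exists>L. L-lipschitz_on UNIV (dir_deriv (axes is) a)" if "length is \<le> m" for "is"
  proof (cases "length is = m")
    case True
    then show ?thesis using lip by simp
  next
    case False
    have "\<bar>frechet_derivative (dir_deriv (axes is) a) (at x) v\<bar> \<le> d * K" if "norm v \<le> 1" for v x
      unfolding d_def
    proof (rule frechet_bound_from_axes[OF diff _ that])
      show "\<bar>frechet_derivative (dir_deriv (axes is) a) (at x) (axis i 1)\<bar> \<le> K" for i
        using bd[of "is @ [i]" x] False \<open>length is \<le> m\<close> by (simp add: dir_deriv_snoc)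
    qed (use False \<open>length is \<le> m\<close> in simp)
    then show ?thesis using False that d assms(2)
      by (intro exI[of _ "d * K"] differentiable_lipschitz diff) auto
  qed
  have meas: "dir_deriv (axes is) a \<in> borel_measurable borel" if "length is \<le> m" for "is"
    by (intro borel_measurable_continuous_onI cont) (use that in simp)
  have grow: "exp_growth (dir_deriv (axes is) a)" if "length is \<le> m" for "is"
    by (rule exp_growth_bounded[OF meas[OF that] bd[OF that]])
  fix \<epsilon> :: real assume \<epsilon>: "0 < \<epsilon>"
  have sm: "smooth (smoothing 1 \<epsilon> a)" using smooth_smoothing[OF \<epsilon> grow[of "[]"]] by simp
  have eq: "dir_deriv (axes is) (smoothing 1 \<epsilon> a) = smoothing 1 \<epsilon> (dir_deriv (axes is) a)" if "length is \<le> m" for "is"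
    using that
  proof (induction "is" rule: rev_induct)
    case (snoc i "is")
    obtain L where L: "L-lipschitz_on UNIV (dir_deriv (axes is) a)" using lip'[of "is"] snoc.prems by auto
    have h: "frechet_derivative (smoothing 1 \<epsilon> (dir_deriv (axes is) a)) (at x) (axis i 1) =
        1 * smoothing 1 \<epsilon> (\<lambda>x. frechet_derivative (dir_deriv (axes is) a) (at x) (axis i 1)) x" for x
      by (rule smoothing_frechet_transfer[OF \<epsilon> grow L])
        (use snoc.prems diff meas[of "is @ [i]"] in \<open>auto simp: dir_deriv_append\<close>)
    have IH: "dir_deriv (axes is) (smoothing 1 \<epsilon> a) = smoothing 1 \<epsilon> (dir_deriv (axes is) a)"
      using snoc by simp
    show ?case by (rule ext) (simp only: map_append list.map dir_deriv_append dir_deriv.simps IH h mult_1)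
  qed simp
  have main: "\<bar>dir_deriv (axes is) (smoothing 1 \<epsilon> a) x\<bar> \<le> K"
    "length is = k \<Longrightarrow> \<bar>dir_deriv (axes is) (smoothing 1 \<epsilon> a) x - dir_deriv (axes is) (smoothing 1 \<epsilon> a) y\<bar> \<le> K * norm (x - y) powr \<theta>"
    if len: "length is \<le> k" for "is" x y
  proof -
    obtain js where js: "mset js = mset is" "AE x in lborel. \<bar>dir_deriv (axes js) a x\<bar> \<le> K"
      "length is = k \<Longrightarrow> \<forall>x\<in>diff_points k a. \<forall>y\<in>diff_points k a.
          \<bar>dir_deriv (axes js) a x - dir_deriv (axes js) a y\<bar> \<le> K * norm (x - y) powr \<theta>"
      using holder_class_bounds[OF a assms(2), of "is"] len unfolding k_def[symmetric] \<theta>_def by auto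
    have ljs: "length js = length is" using js(1) by (metis size_mset)
    have perm: "dir_deriv (axes is) (smoothing 1 \<epsilon> a) = dir_deriv (axes js) (smoothing 1 \<epsilon> a)"
      by (rule dir_deriv_perm) (use sm js(1) in \<open>auto simp: smooth_def\<close>)
    \<comment> \<open>g represents the derivative of a along js, made measurable at top order; it
      agrees with it on \<open>diff_points k a\<close>, where the Hoelder bound is known. The
      exchange of \<open>is\<close> and js has taken place on the smooth mollification.\<close>
    obtain g where g: "g \<in> borel_measurable borel" "AE x in lborel. \<bar>g x\<bar> \<le> K"
      "dir_deriv (axes js) (smoothing 1 \<epsilon> a) = smoothing 1 \<epsilon> g"
      "length is = k \<Longrightarrow> \<forall>x\<in>diff_points k a. g x = dir_deriv (axes js) a x"
    proof (cases "length js \<le> m")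
      case True
      show ?thesis
        by (rule that[of "dir_deriv (axes js) a"]) (use eq True meas js(2) ljs k in auto)
    next
      case False
      then have "length js = Suc m" using len ljs k by simp
      then obtain us i where us: "js = us @ [i]" "length us = m" by (metis length_Suc_conv_rev)
      let ?f = "dir_deriv (axes us) a"
      have dp: "?f differentiable (at x)" if "x \<in> diff_points k a" for x
        using that us k unfolding diff_points_def by auto
      then have aed: "AE x in lborel. ?f differentiable (at x)" using ae by auto
      obtain g where g: "g \<in> borel_measurable borel"
        "AE x in lborel. ?f differentiable (at x) \<and> g x = frechet_derivative ?f (at x) (axis i 1)"
        "\<And>x. ?f differentiable (at x) \<Longrightarrow> g x = frechet_derivative ?f (at x) (axis i 1)"
        using AE_measurable_version[OF meas aed, of "axis i 1"] us by auto
      obtain L where L: "L-lipschitz_on UNIV ?f" using lip'[of us] us by auto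
      show ?thesis
      proof (rule that[OF g(1)])
        show "AE x in lborel. \<bar>g x\<bar> \<le> K"
          using g(2) js(2) by eventually_elim (simp add: us dir_deriv_snoc)
        have "frechet_derivative (smoothing 1 \<epsilon> ?f) (at x) (axis i 1) = 1 * smoothing 1 \<epsilon> g x" for x
          by (rule smoothing_frechet_transfer[OF \<epsilon> grow L g(1,2)]) (simp add: us)
        then show "dir_deriv (axes js) (smoothing 1 \<epsilon> a) = smoothing 1 \<epsilon> g"
          by (intro ext) (simp only: us map_append list.map dir_deriv_append dir_deriv.simps eq[OF eq_refl[OF us(2)]] mult_1)
        show "\<forall>x\<in>diff_points k a. g x = dir_deriv (axes js) a x"
          using g(3) dp us by (simp add: dir_deriv_snoc)
      qed
    qed
    show "\<bar>dir_deriv (axes is) (smoothing 1 \<epsilon> a) x\<bar> \<le> K"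
      unfolding perm g(3) by (rule smoothing_bound[OF g(1) \<epsilon> g(2)])
    assume "length is = k"
    then show "\<bar>dir_deriv (axes is) (smoothing 1 \<epsilon> a) x - dir_deriv (axes is) (smoothing 1 \<epsilon> a) y\<bar> \<le> K * norm (x - y) powr \<theta>"
      unfolding perm g(3) using js(3) g(4)
      by (intro smoothing_diff_bound[OF g(1) \<epsilon> g(2) ae]) auto
  qed
  \<comment> \<open>Below order k, \<open>d * K\<close> is a Lipschitz constant, used at distances
    up to 1, and \<open>2 * K\<close> bounds the oscillation at larger distances; the sum covers
    both.\<close>
  define C where "C = (d + 2) * K"
  have C: "K \<le> C" using d assms(2) by (simp add: C_def)
  have hold: "\<bar>dir_deriv (axes is) (smoothing 1 \<epsilon> a) x - dir_deriv (axes is) (smoothing 1 \<epsilon> a) y\<bar> \<le> C * norm (x - y) powr \<theta>"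
    if len: "length is \<le> k" for "is" x y
  proof (cases "length is = k")
    case True
    then have "\<bar>dir_deriv (axes is) (smoothing 1 \<epsilon> a) x - dir_deriv (axes is) (smoothing 1 \<epsilon> a) y\<bar> \<le> K * norm (x - y) powr \<theta>"
      by (intro main) auto
    also have "\<dots> \<le> C * norm (x - y) powr \<theta>" using C by (intro mult_right_mono) auto
    finally show ?thesis .
  next
    case False
    let ?f = "dir_deriv (axes is) (smoothing 1 \<epsilon> a)"
    have sf: "smooth ?f" by (intro smooth_dir_deriv sm)
    have "(d * K)-lipschitz_on UNIV ?f"
    proof (rule differentiable_lipschitz[OF smooth_differentiable[OF sf]])
      show "\<bar>frechet_derivative ?f (at x) v\<bar> \<le> d * K" if "norm v \<le> 1" for v x
        unfolding d_def
      proof (rule frechet_bound_from_axes[OF smooth_differentiable[OF sf] _ that])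
        show "\<bar>frechet_derivative ?f (at x) (axis i 1)\<bar> \<le> K" for i
          using main(1)[of "is @ [i]" x] False len by (simp add: dir_deriv_snoc)
      qed
    qed (use d assms(2) in simp)
    then have l: "\<bar>?f x - ?f y\<bar> \<le> d * K * norm (x - y)"
      using lipschitz_onD[of "d * K" UNIV ?f x y] by (simp add: dist_norm)
    have b: "\<bar>?f x - ?f y\<bar> \<le> 2 * K" using main(1)[OF len, of x] main(1)[OF len, of y] by linarith
    have dK: "0 \<le> d * K" using d assms(2) by simp
    show ?thesis
    proof (cases "norm (x - y) \<le> 1")
      case True
      have "norm (x - y) \<le> norm (x - y) powr \<theta>"
        using powr_mono'[OF \<theta>(2), of "norm (x - y)"] True by simp
      then have "d * K * norm (x - y) \<le> C * norm (x - y) powr \<theta>"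
        using d assms(2) by (intro mult_mono) (auto simp: C_def)
      then show ?thesis using l by linarith
    next
      case False
      then have "1 \<le> norm (x - y) powr \<theta>" using \<theta>(1) by (simp add: ge_one_powr_ge_zero)
      then have "2 * K * 1 \<le> C * norm (x - y) powr \<theta>"
        using d assms(2) by (intro mult_mono) (auto simp: C_def algebra_simps)
      then show ?thesis using b by linarith
    qed
  qed
  show "holder_bounded k (\<beta> - real k) (d ^ k * ((d + 2) * K)) (smoothing 1 \<epsilon> a)"
    unfolding holder_bounded_def C_def[symmetric] \<theta>_def[symmetric]
  proof (intro conjI allI impI)
    fix vs :: "(real ^ 'n) list" and x y
    assume vs: "length vs \<le> k" "unit_list vs"
    \<comment> \<open>Each passage from coordinate directions to a unit direction costs a factor d,
      hence \<open>d ^ k\<close>.\<close>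
    have pow: "d ^ length vs * r \<le> d ^ k * r" if "0 \<le> r" for r
      using vs(1) d that by (intro mult_right_mono power_increasing) auto
    have C0: "0 \<le> C" using C assms(2) by simp
    have "\<bar>dir_deriv vs (smoothing 1 \<epsilon> a) x - 0 * dir_deriv vs (smoothing 1 \<epsilon> a) x\<bar> \<le> d ^ length vs * C"
      unfolding d_def
    proof (rule dir_deriv_bound_from_Basis[OF sm _ refl])
      fix bs :: "(real ^ 'n) list" assume bs: "length bs = length vs" "set bs \<subseteq> Basis"
      then obtain "is" where "is": "bs = axes is" using axes_exist by blast
      then show "\<bar>dir_deriv bs (smoothing 1 \<epsilon> a) x - 0 * dir_deriv bs (smoothing 1 \<epsilon> a) x\<bar> \<le> C"
        using main(1)[of "is" x] bs vs C by auto
    qed (use vs in \<open>auto simp: unit_list_def\<close>)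
    also have "\<dots> \<le> d ^ k * C" by (rule pow[OF C0])
    finally show "\<bar>dir_deriv vs (smoothing 1 \<epsilon> a) x\<bar> \<le> d ^ k * C" by simp
    have "\<bar>dir_deriv vs (smoothing 1 \<epsilon> a) x - 1 * dir_deriv vs (smoothing 1 \<epsilon> a) y\<bar> \<le> d ^ length vs * (C * norm (x - y) powr \<theta>)"
      unfolding d_def
    proof (rule dir_deriv_bound_from_Basis[OF sm _ refl])
      fix bs :: "(real ^ 'n) list" assume bs: "length bs = length vs" "set bs \<subseteq> Basis"
      then obtain "is" where "is": "bs = axes is" using axes_exist by blast
      then show "\<bar>dir_deriv bs (smoothing 1 \<epsilon> a) x - 1 * dir_deriv bs (smoothing 1 \<epsilon> a) y\<bar> \<le> C * norm (x - y) powr \<theta>"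
        using hold[of "is" x y] bs vs by simp
    qed (use vs in \<open>auto simp: unit_list_def\<close>)
    also have "\<dots> \<le> d ^ k * (C * norm (x - y) powr \<theta>)" using C0 by (intro pow) simp
    finally show "\<bar>dir_deriv vs (smoothing 1 \<epsilon> a) x - dir_deriv vs (smoothing 1 \<epsilon> a) y\<bar> \<le> d ^ k * C * norm (x - y) powr \<theta>"
      by (simp add: mult.assoc)
  qed (fact sm)
qed

section \<open>Uniform bounds for the logarithm of the smoothed exponential\<close>

lemma smoothing_lower_bound:
  assumes "0 < \<sigma>" "exp_growth f" "\<And>y. c \<le> f y" shows "c \<le> smoothing s \<sigma> f x"
proof -
  have "smoothing s \<sigma> (\<lambda>y. c) x \<le> smoothing s \<sigma> f x"
    unfolding smoothing_def
    by (intro integral_mono integrable_smoothing assms exp_growth_const mult_right_mono gauss_nonneg)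
  then show ?thesis by (simp add: smoothing_const assms)
qed

text \<open>D comes before a, s and \<sigma>. Lists \<open>v # vs\<close> reach order
  \<open>k + 2\<close>, one more than the top order asked of the score, since the score is a
  gradient.\<close>

lemma ln_smoothing_bounds:
  fixes \<beta> K :: real
  assumes "1 \<le> \<beta>" "0 < K"
  defines "k \<equiv> nat \<lfloor>\<beta>\<rfloor>"
  shows "\<exists>D\<ge>0. \<forall>a \<in> holder_class \<beta> K. \<forall>s \<sigma>. 0 \<le> s \<and> s \<le> 1 \<and> 0 < \<sigma> \<and> \<sigma> \<le> 1 \<longrightarrow>
    smooth (smoothing s \<sigma> (\<lambda>y. exp (a y))) \<and> (\<forall>x. 0 < smoothing s \<sigma> (\<lambda>y. exp (a y)) x) \<and>
    (\<forall>v vs (x :: real ^ 'n::finite). length vs \<le> Suc k \<longrightarrow> unit_list (v # vs) \<longrightarrow>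
      \<bar>dir_deriv (v # vs) (\<lambda>x. ln (smoothing s \<sigma> (\<lambda>y. exp (a y)) x)) x\<bar> \<le> D * weight k (\<beta> - real k) \<sigma> (Suc (length vs)))"
proof -
  define \<theta> where "\<theta> = \<beta> - real k"
  have k: "1 \<le> k" using assms(1) unfolding k_def by (simp add: le_nat_floor)
  have \<theta>: "0 \<le> \<theta>" "\<theta> < 1" unfolding \<theta>_def k_def using assms(1) by linarith+
  define d where "d = real DIM(real ^ 'n)"
  \<comment> \<open>C1, C2 and C3 bound the mollified a, its exponential, and (with weights) the
    smoothed exponential.\<close>
  define C1 where "C1 = d ^ k * ((d + 2) * K)"
  obtain C2 where C2: "C2 \<ge> 0" "\<And>a :: real ^ 'n \<Rightarrow> real. holder_bounded k \<theta> C1 a \<Longrightarrow> holder_bounded k \<theta> C2 (\<lambda>x. exp (a x))"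
    using holder_bounded_exp[of k \<theta> C1] by blast
  define C3 where "C3 = C2 * (1 + gauss_moment TYPE(real ^ 'n))"
  have C3: "0 \<le> C3" unfolding C3_def using C2(1) gauss_moment_nonneg[where 'a = "real ^ 'n"] by simp
  obtain D where D: "D \<ge> 0" "\<And>(F :: real ^ 'n \<Rightarrow> real) w v vs x. smooth F \<Longrightarrow> \<forall>x. exp (- K) \<le> F x \<Longrightarrow>
     deriv_bounded (Suc (Suc k)) (\<lambda>n. C3 * w n) F \<Longrightarrow> \<forall>n. 0 \<le> w n \<Longrightarrow> w 0 = 1 \<Longrightarrow>
     \<forall>i j. i + j \<le> Suc (Suc k) \<longrightarrow> w i * w j \<le> w (i + j) \<Longrightarrow> length vs \<le> Suc k \<Longrightarrow> unit_list (v # vs) \<Longrightarrow>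
     \<bar>dir_deriv (v # vs) (\<lambda>x. ln (F x)) x\<bar> \<le> D * w (Suc (length vs))"
    using deriv_bounded_ln[of "exp (- K)" C3 "Suc k", where 'a = "real ^ 'n"] C3 by (metis exp_gt_zero)
  show ?thesis
  proof (intro exI[of _ D] conjI ballI allI impI D(1))
    fix a :: "real ^ 'n \<Rightarrow> real" and s \<sigma> :: real
    assume a: "a \<in> holder_class \<beta> K" and s: "0 \<le> s \<and> s \<le> 1 \<and> 0 < \<sigma> \<and> \<sigma> \<le> 1"
    note A = smoothing_holder_class[OF a assms(2,1), folded k_def, folded d_def, folded C1_def, folded \<theta>_def]
    let ?F = "smoothing s \<sigma> (\<lambda>y. exp (a y))"
    have em: "(\<lambda>y. exp (a y)) \<in> borel_measurable borel"
      using borel_measurable_continuous_onI[OF A(1)] by measurable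
    have le: "a y \<le> K" "- K \<le> a y" for y using A(2)[of y] by auto
    have eg: "exp_growth (\<lambda>y. exp (a y))" by (rule exp_growth_bounded[OF em, of "exp K"]) (use le in simp)
    show F: "smooth ?F" using s by (intro smooth_smoothing eg) auto
    have lb: "exp (- K) \<le> ?F x" for x using s le by (intro smoothing_lower_bound eg) auto
    then show "0 < ?F x" for x by (rule less_le_trans[OF exp_gt_zero])
    have bd: "deriv_bounded (Suc (Suc k)) (\<lambda>n. C3 * weight k \<theta> \<sigma> n) ?F"
      unfolding deriv_bounded_def
    proof (intro allI impI)
      fix vs :: "(real ^ 'n) list" and x assume vs: "length vs \<le> Suc (Suc k)" "unit_list vs"
      \<comment> \<open>a is mollified before exp is taken. The bounds are the same for every n, and
        the convergence of the derivatives of the smoothings carries them to the limit.\<close>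
      let ?g = "\<lambda>n y. exp (smoothing 1 (1 / Suc n) a y)"
      have hb: "holder_bounded k \<theta> C2 (?g n)" for n by (intro C2(2) A(3)) simp
      have "\<bar>dir_deriv vs (smoothing s \<sigma> (?g n)) x\<bar> \<le> C3 * weight k \<theta> \<sigma> (length vs)" for n
        unfolding C3_def using s vs \<theta> by (intro smoothing_weight_bound hb) auto
      moreover have "(\<lambda>n. dir_deriv vs (smoothing s \<sigma> (?g n)) x) \<longlonglongrightarrow> dir_deriv vs ?F x"
      proof (rule dir_deriv_smoothing_tendsto)
        show "?g n \<in> borel_measurable borel" for n by (intro smooth_measurable holder_bounded_smooth[OF hb])
        show "\<bar>?g n y\<bar> \<le> C2" for n y using holder_boundedD(1)[OF hb, of "[]"] by simp
        show "(\<lambda>n. ?g n y) \<longlonglongrightarrow> exp (a y)" for y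
          by (rule tendsto_exp, rule smoothing_tendsto[OF A(1,2)])
      qed (use s in simp)
      ultimately show "\<bar>dir_deriv vs ?F x\<bar> \<le> C3 * weight k \<theta> \<sigma> (length vs)"
        by (intro LIMSEQ_le_const2[OF tendsto_rabs]) auto
    qed
    fix v :: "real ^ 'n" and vs x assume vs: "length vs \<le> Suc k" "unit_list (v # vs)"
    have "\<bar>dir_deriv (v # vs) (\<lambda>x. ln (?F x)) x\<bar> \<le> D * weight k \<theta> \<sigma> (Suc (length vs))"
      by (rule D(2)[OF F _ bd]) (use lb s vs weight_mult[of \<sigma> \<theta> k] \<theta> k in \<open>auto simp: weight_nonneg weight_def[of k \<theta> \<sigma> 0]\<close>)
    then show "\<bar>dir_deriv (v # vs) (\<lambda>x. ln (?F x)) x\<bar> \<le> D * weight k (\<beta> - real k) \<sigma> (Suc (length vs))"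
      by (simp add: \<theta>_def)
  qed
qed

section \<open>The marginal densities of the Ornstein--Uhlenbeck process\<close>

text \<open>The error terms of the Riemann sums are
  \<open>e\<^sup>t\<^sub>j (e\<^sup>h - 1 - h) y (t\<^sub>j\<^sub>+\<^sub>1)\<close> and \<open>e\<^sup>t\<^sub>j \<integral> y (t\<^sub>j\<^sub>+\<^sub>1) - y u du\<close>.\<close>

lemma ou_riemann_sum:
  fixes y :: "real \<Rightarrow> 'a::euclidean_space"
  assumes t: "0 < t" and cont: "continuous_on {0..t} y"
  defines "\<tau> \<equiv> \<lambda>m j. t * real j / real (Suc m)"
  shows "(\<lambda>m. \<Sum>j<Suc m. exp (\<tau> m j - t) *\<^sub>R (y (\<tau> m (Suc j)) - y (\<tau> m j) + integral {\<tau> m j..\<tau> m (Suc j)} y))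
    \<longlonglongrightarrow> y t - exp (- t) *\<^sub>R y 0"
proof (rule LIMSEQ_I)
  fix r :: real assume r: "0 < r"
  obtain Y where "\<forall>z\<in>y ` {0..t}. norm z \<le> Y"
    using compact_imp_bounded[OF compact_continuous_image[OF cont]] unfolding bounded_iff by blast
  then have Y: "norm (y u) \<le> Y" if "u \<in> {0..t}" for u using that by blast
  have Y0: "0 \<le> Y" using Y[of 0] t norm_ge_zero[of "y 0"] by (meson atLeastAtMost_iff less_imp_le order_refl order_trans)
  \<comment> \<open>Each step errs by at most \<open>2 * \<eta> * h\<close>, hence the sum by at
    most \<open>2 * \<eta> * t = r / 2\<close>.\<close>
  define \<eta> where "\<eta> = r / (4 * t)"
  have \<eta>: "0 < \<eta>" using r t by (simp add: \<eta>_def)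
  obtain \<delta> where \<delta>: "0 < \<delta>" "\<And>u v. u \<in> {0..t} \<Longrightarrow> v \<in> {0..t} \<Longrightarrow> dist u v < \<delta> \<Longrightarrow> dist (y u) (y v) < \<eta>"
    using compact_uniformly_continuous[OF cont] \<eta> unfolding uniformly_continuous_on_def by (metis compact_Icc dist_commute)
  have h0: "(\<lambda>m. t / real (Suc m)) \<longlonglongrightarrow> 0"
    using tendsto_mult_right_zero[OF LIMSEQ_inverse_real_of_nat, of t] by (simp add: divide_inverse)
  then have "(\<lambda>m. t / real (Suc m) * exp (t / real (Suc m)) * Y) \<longlonglongrightarrow> 0 * exp 0 * Y"
    by (intro tendsto_intros)
  then have "eventually (\<lambda>m. t / real (Suc m) * exp (t / real (Suc m)) * Y < \<eta>) sequentially"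
    using \<eta> by (intro order_tendstoD(2)) auto
  moreover have "eventually (\<lambda>m. t / real (Suc m) < \<delta>) sequentially"
    using order_tendstoD(2)[OF h0 \<delta>(1)] .
  ultimately have "eventually (\<lambda>m. norm ((\<Sum>j<Suc m. exp (\<tau> m j - t) *\<^sub>R (y (\<tau> m (Suc j)) - y (\<tau> m j) + integral {\<tau> m j..\<tau> m (Suc j)} y))
      - (y t - exp (- t) *\<^sub>R y 0)) < r) sequentially"
  proof eventually_elim
    case (elim m)
    define h where "h = t / real (Suc m)"
    have h: "0 < h" "h < \<delta>" "h * exp h * Y < \<eta>" "real (Suc m) * h = t"
      using elim t by (simp_all add: h_def)
    have step: "\<tau> m (Suc j) = \<tau> m j + h" for j by (simp add: \<tau>_def h_def add_divide_distrib distrib_left)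
    have \<tau>0: "0 \<le> \<tau> m j" for j using t by (simp add: \<tau>_def)
    have \<tau>t: "\<tau> m j \<le> t" if "j \<le> Suc m" for j
      using t that by (simp add: \<tau>_def divide_le_eq)
    have end_pts: "\<tau> m 0 = 0" "\<tau> m (Suc m) = t" by (simp_all add: \<tau>_def)
    \<comment> \<open>R j is the error of one step against the telescoping increment of
      \<open>exp (u - t) * y u\<close>.\<close>
    define R where "R = (\<lambda>j. exp (\<tau> m j - t) *\<^sub>R (y (\<tau> m (Suc j)) - y (\<tau> m j) + integral {\<tau> m j..\<tau> m (Suc j)} y)
        - (exp (\<tau> m (Suc j) - t) *\<^sub>R y (\<tau> m (Suc j)) - exp (\<tau> m j - t) *\<^sub>R y (\<tau> m j)))"
    have "(\<Sum>j<Suc m. exp (\<tau> m (Suc j) - t) *\<^sub>R y (\<tau> m (Suc j)) - exp (\<tau> m j - t) *\<^sub>R y (\<tau> m j)) = y t - exp (- t) *\<^sub>R y 0"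
      by (subst sum_lessThan_telescope) (simp add: end_pts)
    then have eq: "(\<Sum>j<Suc m. exp (\<tau> m j - t) *\<^sub>R (y (\<tau> m (Suc j)) - y (\<tau> m j) + integral {\<tau> m j..\<tau> m (Suc j)} y))
      - (y t - exp (- t) *\<^sub>R y 0) = (\<Sum>j<Suc m. R j)"
      by (simp only: R_def sum_subtractf)
    have "norm (R j) \<le> h * (2 * \<eta>)" if j: "j < Suc m" for j
    proof -
      let ?a = "\<tau> m j" and ?b = "\<tau> m (Suc j)"
      have ab: "0 \<le> ?a" "?b \<le> t" "?b = ?a + h" using \<tau>0 \<tau>t[of "Suc j"] j step by auto
      have ca: "y integrable_on {?a..?b}"
        by (rule integrable_continuous_real, rule continuous_on_subset[OF cont]) (use ab in auto)
      have "integral {?a..?b} (\<lambda>u. y u - y ?b) = integral {?a..?b} y - h *\<^sub>R y ?b"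
        by (subst Henstock_Kurzweil_Integration.integral_diff[OF ca integrable_const_ivl]) (use ab h(1) in simp)
      moreover have "norm (integral {?a..?b} (\<lambda>u. y u - y ?b)) \<le> \<eta> * (?b - ?a)"
      proof (rule integral_bound)
        show "continuous_on {?a..?b} (\<lambda>u. y u - y ?b)"
          by (intro continuous_intros continuous_on_subset[OF cont]) (use ab in auto)
        fix u assume "u \<in> {?a..?b}"
        then have "dist (y u) (y ?b) < \<eta>" using ab h by (intro \<delta>(2)) (auto simp: dist_real_def)
        then show "norm (y u - y ?b) \<le> \<eta>" by (simp add: dist_norm)
      qed (use ab h in simp)
      ultimately have i: "norm (integral {?a..?b} y - h *\<^sub>R y ?b) \<le> \<eta> * h" using ab by simp
      have "\<bar>exp h - 1 - h\<bar> \<le> h\<^sup>2 * exp h" using exp_remainder[of h] h(1) by simp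
      then have "norm ((exp h - 1 - h) *\<^sub>R y ?b) \<le> (h\<^sup>2 * exp h) * Y"
        unfolding norm_scaleR using Y[of ?b] ab h(1) by (intro mult_mono) auto
      also have "\<dots> \<le> h * \<eta>" using h by (simp add: power2_eq_square mult.assoc)
      finally have e: "norm ((exp h - 1 - h) *\<^sub>R y ?b) \<le> \<eta> * h" by (simp add: mult.commute)
      have "exp (?b - t) = exp (?a - t) * exp h" by (simp add: ab exp_add[symmetric])
      then have "R j = exp (?a - t) *\<^sub>R ((integral {?a..?b} y - h *\<^sub>R y ?b) - (exp h - 1 - h) *\<^sub>R y ?b)"
        by (simp add: R_def algebra_simps)
      also have "norm \<dots> \<le> 1 * norm ((integral {?a..?b} y - h *\<^sub>R y ?b) - (exp h - 1 - h) *\<^sub>R y ?b)"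
        unfolding norm_scaleR using ab h by (intro mult_right_mono) auto
      also have "\<dots> \<le> \<eta> * h + \<eta> * h"
        unfolding mult_1 by (rule order_trans[OF norm_triangle_ineq4]) (use i e in linarith)
      finally show ?thesis by (simp add: mult_ac)
    qed
    then have "norm (\<Sum>j<Suc m. R j) \<le> of_nat (card {..<Suc m}) * (h * (2 * \<eta>))"
      by (intro sum_norm_bound) auto
    also have "\<dots> = t * (2 * \<eta>)" using h(4) by (simp add: mult.assoc[symmetric])
    also have "\<dots> < r" using t r by (simp add: \<eta>_def)
    finally show ?case unfolding eq .
  qed
  then show "\<exists>no. \<forall>n\<ge>no. norm ((\<Sum>j<Suc n. exp (\<tau> n j - t) *\<^sub>R (y (\<tau> n (Suc j)) - y (\<tau> n j) + integral {\<tau> n j..\<tau> n (Suc j)} y))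
      - (y t - exp (- t) *\<^sub>R y 0)) < r"
    by (simp only: eventually_sequentially)
qed

text \<open>The variance of the weighted increments is a geometric sum, and its limit reduces to
  \<open>(exp x - 1) / x\<close> tending to 1. The value is the integral of
  \<open>2 * exp (2 * (u - t))\<close> over \<open>[0, t]\<close>.\<close>

lemma ou_variance_sum:
  assumes t: "0 < t"
  shows "(\<lambda>m. \<Sum>j<Suc m. (sqrt 2 * exp (t * real j / real (Suc m) - t))\<^sup>2 * (t / real (Suc m))) \<longlonglongrightarrow> 1 - exp (- 2 * t)"
proof -
  have eq: "(\<Sum>j<Suc m. (sqrt 2 * exp (t * real j / real (Suc m) - t))\<^sup>2 * (t / real (Suc m))) =
     (1 - exp (- 2 * t)) / ((exp (2 * (t / real (Suc m))) - 1) / (2 * (t / real (Suc m))))" for m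
  proof -
    define h where "h = t / real (Suc m)"
    have h: "0 < h" "real (Suc m) * h = t" using t by (simp_all add: h_def)
    have "(sqrt 2 * exp (t * real j / real (Suc m) - t))\<^sup>2 = 2 * exp (- 2 * t) * exp (2 * h) ^ j" for j
    proof -
      have "exp (t * real j / real (Suc m) - t) = exp (- t) * exp h ^ j"
        by (simp add: h_def exp_of_nat_mult[symmetric] exp_add[symmetric] mult.commute)
      then have "(sqrt 2 * exp (t * real j / real (Suc m) - t))\<^sup>2 = 2 * (exp (- t))\<^sup>2 * ((exp h)\<^sup>2) ^ j"
        by (simp add: power_mult_distrib power_mult[symmetric] mult.commute[of j])
      then show ?thesis by (simp add: exp_double[symmetric])
    qed
    then have "(\<Sum>j<Suc m. (sqrt 2 * exp (t * real j / real (Suc m) - t))\<^sup>2 * (t / real (Suc m))) =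
       2 * exp (- 2 * t) * h * (\<Sum>j<Suc m. exp (2 * h) ^ j)"
      by (simp only: h_def[symmetric] sum_distrib_left mult_ac)
    also have "(\<Sum>j<Suc m. exp (2 * h) ^ j) = (exp (2 * h) ^ Suc m - 1) / (exp (2 * h) - 1)"
      using h(1) by (intro geometric_sum) simp
    also have "exp (2 * h) ^ Suc m = exp (2 * t)"
      using h(2) by (simp only: exp_of_nat_mult[symmetric]) (simp add: mult.left_commute)
    finally show ?thesis
      unfolding h_def[symmetric] using h(1) by (simp add: field_simps exp_minus)
  qed
  have "(\<lambda>m. t / real (Suc m)) \<longlonglongrightarrow> 0"
    using tendsto_mult_right_zero[OF LIMSEQ_inverse_real_of_nat, of t] by (simp add: divide_inverse)
  then have "(\<lambda>m. 2 * (t / real (Suc m))) \<longlonglongrightarrow> 2 * 0" by (intro tendsto_intros)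
  then have "filterlim (\<lambda>m. 2 * (t / real (Suc m))) (at 0) sequentially"
    using t by (auto simp: filterlim_at)
  from filterlim_compose[OF lim_exp_minus_1 this]
  have "(\<lambda>m. (exp (2 * (t / real (Suc m))) - 1) / (2 * (t / real (Suc m)))) \<longlonglongrightarrow> 1" .
  then have "(\<lambda>m. (1 - exp (- 2 * t)) / ((exp (2 * (t / real (Suc m))) - 1) / (2 * (t / real (Suc m))))) \<longlonglongrightarrow> (1 - exp (- 2 * t)) / 1"
    by (intro tendsto_divide tendsto_const) auto
  then show ?thesis unfolding eq by simp
qed

text \<open>Coordinatewise, substituting \<open>w * u\<close> turns this into the convolution of two
  one-dimensional normal densities.\<close>

lemma gauss_convolution_nn:
  fixes x :: "'a::euclidean_space"
  assumes "0 < a" "0 < \<tau>" "0 < w"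
  shows "(\<integral>\<^sup>+z. ennreal (gauss \<tau> z) * ennreal (gauss a (x - w *\<^sub>R z)) \<partial>lborel) = ennreal (gauss (sqrt (a\<^sup>2 + w\<^sup>2 * \<tau>\<^sup>2)) x)"
proof -
  have one: "(\<integral>\<^sup>+u. ennreal (normal_density 0 \<tau> u * normal_density 0 a (c - w * u)) \<partial>lborel) =
      ennreal (normal_density 0 (sqrt (a\<^sup>2 + w\<^sup>2 * \<tau>\<^sup>2)) c)" for c
  proof -
    have "normal_density 0 \<tau> u = w * normal_density 0 (w * \<tau>) (w * u)" for u
      using assms by (simp add: normal_density_def real_sqrt_mult power_mult_distrib)
    then have "(\<integral>\<^sup>+u. ennreal (normal_density 0 \<tau> u * normal_density 0 a (c - w * u)) \<partial>lborel) =
       (\<integral>\<^sup>+u. ennreal w * ennreal (normal_density 0 a (c - (0 + w * u)) * normal_density 0 (w * \<tau>) (0 + w * u)) \<partial>lborel)"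
      using assms(3) by (simp add: ennreal_mult[symmetric] mult_ac)
    also have "\<dots> = ennreal \<bar>w\<bar> * (\<integral>\<^sup>+u. ennreal (normal_density 0 a (c - (0 + w * u)) * normal_density 0 (w * \<tau>) (0 + w * u)) \<partial>lborel)"
      using assms(3) by (subst nn_integral_cmult) auto
    also have "\<dots> = (\<integral>\<^sup>+u. ennreal (normal_density 0 a (c - u) * normal_density 0 (w * \<tau>) u) \<partial>lborel)"
      using assms(3) by (intro nn_integral_real_affine[symmetric]) auto
    also have "\<dots> = ennreal (normal_density 0 (sqrt (a\<^sup>2 + (w * \<tau>)\<^sup>2)) c)"
      using fun_cong[OF conv_normal_density_zero_mean[of a "w * \<tau>"], of c] assms by simp
    finally show ?thesis by (simp add: power_mult_distrib)
  qed
  have "(\<integral>\<^sup>+z. ennreal (gauss \<tau> z) * ennreal (gauss a (x - w *\<^sub>R z)) \<partial>lborel) =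
     (\<integral>\<^sup>+z. (\<Prod>b\<in>Basis. ennreal (normal_density 0 \<tau> (z \<bullet> b) * normal_density 0 a (x \<bullet> b - w * (z \<bullet> b)))) \<partial>lborel)"
    unfolding gauss_def
    by (simp add: prod_ennreal ennreal_mult[symmetric] prod_nonneg prod.distrib inner_diff_left)
  also have "\<dots> = (\<Prod>b\<in>Basis. \<integral>\<^sup>+u. ennreal (normal_density 0 \<tau> u * normal_density 0 a (x \<bullet> b - w * u)) \<partial>lborel)"
    by (rule nn_integral_lborel_prod) auto
  also have "\<dots> = ennreal (gauss (sqrt (a\<^sup>2 + w\<^sup>2 * \<tau>\<^sup>2)) x)"
    unfolding one gauss_def by (simp add: prod_ennreal)
  finally show ?thesis .
qed

text \<open>Under independence the joint law is a product, so this is Fubini pulled back to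
  M.\<close>

lemma (in prob_space) indep_nn_integral:
  assumes ind: "indep_var borel X borel Z"
    and f: "case_prod f \<in> borel_measurable (borel \<Otimes>\<^sub>M borel)"
  shows "(\<integral>\<^sup>+\<omega>. f (X \<omega>) (Z \<omega>) \<partial>M) = (\<integral>\<^sup>+\<omega>. \<integral>\<^sup>+\<omega>'. f (X \<omega>) (Z \<omega>') \<partial>M \<partial>M)"
proof -
  have X[measurable]: "X \<in> borel_measurable M" using ind by (rule indep_var_rv1)
  have Z[measurable]: "Z \<in> borel_measurable M" using ind by (rule indep_var_rv2)
  note [measurable] = f
  interpret Z: prob_space "distr M borel Z" by (rule prob_space_distr) simp
  have "(\<integral>\<^sup>+\<omega>. f (X \<omega>) (Z \<omega>) \<partial>M) = (\<integral>\<^sup>+q. case_prod f q \<partial>distr M (borel \<Otimes>\<^sub>M borel) (\<lambda>\<omega>. (X \<omega>, Z \<omega>)))"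
    by (subst nn_integral_distr) auto
  also have "\<dots> = (\<integral>\<^sup>+q. case_prod f q \<partial>(distr M borel X \<Otimes>\<^sub>M distr M borel Z))"
    using ind by (simp add: indep_var_distribution_eq)
  also have "\<dots> = (\<integral>\<^sup>+u. \<integral>\<^sup>+v. f u v \<partial>distr M borel Z \<partial>distr M borel X)"
    by (subst Z.nn_integral_fst[symmetric]) (auto simp: measurable_distr_eq1 cong: measurable_cong_sets)
  also have "\<dots> = (\<integral>\<^sup>+\<omega>. \<integral>\<^sup>+v. f (X \<omega>) v \<partial>distr M borel Z \<partial>M)"
    by (subst nn_integral_distr) (auto intro!: Z.borel_measurable_nn_integral simp: measurable_distr_eq1 cong: measurable_cong_sets)
  also have "\<dots> = (\<integral>\<^sup>+\<omega>. \<integral>\<^sup>+\<omega>'. f (X \<omega>) (Z \<omega>') \<partial>M \<partial>M)"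
    by (subst nn_integral_distr) auto
  finally show ?thesis .
qed

text \<open>Averaging over the last increment convolves the test kernel with a Gaussian, so its
  variance moves into the kernel and the induction needs a arbitrary. The law of the sum enters only
  through this test.\<close>

lemma (in prob_space) indep_gauss_sum:
  fixes \<Delta> :: "nat \<Rightarrow> 'a \<Rightarrow> 'b::euclidean_space"
  assumes ind: "indep_vars (\<lambda>_. borel) \<Delta> {..<n}"
    and law: "\<And>j. j < n \<Longrightarrow> distributed M lborel (\<Delta> j) (\<lambda>z. ennreal (gauss \<tau> z))" and "0 < \<tau>" and w: "\<And>j. 0 < w j"
    and "m \<le> n" "0 < a"
  shows "(\<integral>\<^sup>+\<omega>. ennreal (gauss a (x - (\<Sum>j<m. w j *\<^sub>R \<Delta> j \<omega>))) \<partial>M) =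
    ennreal (gauss (sqrt (a\<^sup>2 + (\<Sum>j<m. (w j)\<^sup>2 * \<tau>\<^sup>2))) x)"
  using assms(5,6)
proof (induction m arbitrary: a)
  case 0
  then show ?case by (simp add: emeasure_space_1)
next
  case (Suc m)
  define S where "S = (\<lambda>\<omega>. \<Sum>j<m. w j *\<^sub>R \<Delta> j \<omega>)"
  have "indep_var borel ((\<lambda>g. \<Sum>j<m. w j *\<^sub>R g j) \<circ> (\<lambda>\<omega>. restrict (\<lambda>i. \<Delta> i \<omega>) {..<m}))
      borel ((\<lambda>g. g m) \<circ> (\<lambda>\<omega>. restrict (\<lambda>i. \<Delta> i \<omega>) {m}))"
    using Suc.prems by (intro indep_var_compose[OF indep_var_restrict[OF ind]]) auto
  also have "((\<lambda>g. \<Sum>j<m. w j *\<^sub>R g j) \<circ> (\<lambda>\<omega>. restrict (\<lambda>i. \<Delta> i \<omega>) {..<m})) = S" by (auto simp: S_def)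
  also have "((\<lambda>g. g m) \<circ> (\<lambda>\<omega>. restrict (\<lambda>i. \<Delta> i \<omega>) {m})) = \<Delta> m" by auto
  finally have iv: "indep_var borel S borel (\<Delta> m)" .
  have "(\<integral>\<^sup>+\<omega>. ennreal (gauss a (x - (\<Sum>j<Suc m. w j *\<^sub>R \<Delta> j \<omega>))) \<partial>M) =
      (\<integral>\<^sup>+\<omega>. ennreal (gauss a (x - S \<omega> - w m *\<^sub>R \<Delta> m \<omega>)) \<partial>M)"
    by (simp add: S_def algebra_simps)
  also have "\<dots> = (\<integral>\<^sup>+\<omega>. \<integral>\<^sup>+\<omega>'. ennreal (gauss a (x - S \<omega> - w m *\<^sub>R \<Delta> m \<omega>')) \<partial>M \<partial>M)"
    by (rule indep_nn_integral[OF iv]) measurable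
  also have "\<dots> = (\<integral>\<^sup>+\<omega>. ennreal (gauss (sqrt (a\<^sup>2 + (w m)\<^sup>2 * \<tau>\<^sup>2)) (x - S \<omega>)) \<partial>M)"
  proof (rule nn_integral_cong)
    fix \<omega>
    have "(\<integral>\<^sup>+\<omega>'. ennreal (gauss a (x - S \<omega> - w m *\<^sub>R \<Delta> m \<omega>')) \<partial>M) =
       (\<integral>\<^sup>+z. ennreal (gauss \<tau> z) * ennreal (gauss a (x - S \<omega> - w m *\<^sub>R z)) \<partial>lborel)"
      using Suc.prems by (intro distributed_nn_integral[OF law, symmetric]) auto
    then show "(\<integral>\<^sup>+\<omega>'. ennreal (gauss a (x - S \<omega> - w m *\<^sub>R \<Delta> m \<omega>')) \<partial>M) = ennreal (gauss (sqrt (a\<^sup>2 + (w m)\<^sup>2 * \<tau>\<^sup>2)) (x - S \<omega>))"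
      using gauss_convolution_nn[OF Suc.prems(2) assms(3) w] by simp
  qed
  also have "\<dots> = ennreal (gauss (sqrt ((sqrt (a\<^sup>2 + (w m)\<^sup>2 * \<tau>\<^sup>2))\<^sup>2 + (\<Sum>j<m. (w j)\<^sup>2 * \<tau>\<^sup>2))) x)"
    unfolding S_def using Suc.prems by (intro Suc.IH) (auto simp: add_pos_nonneg)
  finally show ?case by (simp add: add_ac)
qed

section \<open>The marginal density tested against Gaussian kernels\<close>

lemma gauss_tendsto:
  assumes "(\<lambda>n. b n) \<longlonglongrightarrow> c" "0 < c" shows "(\<lambda>n. gauss (b n) z) \<longlonglongrightarrow> gauss c z"
  unfolding gauss_eq by (intro tendsto_intros assms) (use assms in auto)

lemma continuous_gauss: "continuous_on UNIV (gauss \<sigma>)"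
  unfolding gauss_eq[abs_def] by (cases "\<sigma> = 0") (auto intro!: continuous_intros)

text \<open>The inequality from Fatou's lemma suffices to identify \<open>\<mu>\<close>: the limit \<open>r\<close>, as a function of \<open>x\<close>, will be a
  continuous density as well.\<close>

lemma density_le_mollification_limit:
  fixes \<mu> :: "'a::euclidean_space \<Rightarrow> real"
  assumes cont: "continuous_on UNIV \<mu>" and nn: "\<And>y. 0 \<le> \<mu> y"
    and lim: "(\<lambda>n. \<integral>\<^sup>+y. ennreal (\<mu> y * gauss (1 / Suc n) (x - y)) \<partial>lborel) \<longlonglongrightarrow> ennreal r" and r: "0 \<le> r"
  shows "\<mu> x \<le> r"
proof -
  have [measurable]: "\<mu> \<in> borel_measurable borel" by (rule borel_measurable_continuous_onI[OF cont])
  have eq: "(\<integral>\<^sup>+y. ennreal (\<mu> y * gauss \<epsilon> (x - y)) \<partial>lborel) = (\<integral>\<^sup>+z. ennreal (\<mu> (x + \<epsilon> *\<^sub>R z) * gauss 1 z) \<partial>lborel)"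
    if "0 < \<epsilon>" for \<epsilon>
  proof -
    note * = gauss_scale[OF that]
    have "(\<integral>\<^sup>+y. ennreal (\<mu> y * gauss \<epsilon> (x - y)) \<partial>lborel) =
      (\<integral>\<^sup>+y. ennreal (\<mu> y * gauss \<epsilon> (x - y)) \<partial>(density (distr lborel borel (\<lambda>z. x + \<epsilon> *\<^sub>R z)) (\<lambda>_. ennreal (\<bar>\<epsilon>\<bar> ^ DIM('a)))))"
      by (rule arg_cong[OF lborel_affine[of \<epsilon> x], where f = "\<lambda>M. \<integral>\<^sup>+y. ennreal (\<mu> y * gauss \<epsilon> (x - y)) \<partial>M"])
        (use that in simp)
    also have "\<dots> = (\<integral>\<^sup>+z. ennreal (\<epsilon> ^ DIM('a)) * ennreal (\<mu> (x + \<epsilon> *\<^sub>R z) * gauss \<epsilon> (- (\<epsilon> *\<^sub>R z))) \<partial>lborel)"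
      using that by (subst nn_integral_density) (auto simp: nn_integral_distr)
    also have "\<dots> = (\<integral>\<^sup>+z. ennreal (\<mu> (x + \<epsilon> *\<^sub>R z) * gauss 1 z) \<partial>lborel)"
      using that nn by (simp add: gauss_minus *[symmetric] ennreal_mult[symmetric] gauss_nonneg mult_ac)
    finally show ?thesis .
  qed
  have "ennreal (\<mu> x) = (\<integral>\<^sup>+z. ennreal (\<mu> x) * ennreal (gauss 1 (z::'a)) \<partial>lborel)"
    by (subst nn_integral_cmult) (auto simp: nn_integral_gauss)
  also have "\<dots> = (\<integral>\<^sup>+z. liminf (\<lambda>n. ennreal (\<mu> (x + (1 / Suc n) *\<^sub>R z) * gauss 1 z)) \<partial>lborel)"
  proof (rule nn_integral_cong)
    fix z :: 'a
    have "(\<lambda>n. 1 / real (Suc n)) \<longlonglongrightarrow> 0" using LIMSEQ_inverse_real_of_nat by (simp add: inverse_eq_divide)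
    then have "(\<lambda>n. x + (1 / Suc n) *\<^sub>R z) \<longlonglongrightarrow> x + 0 *\<^sub>R z" by (intro tendsto_intros)
    then have "(\<lambda>n. \<mu> (x + (1 / Suc n) *\<^sub>R z)) \<longlonglongrightarrow> \<mu> x"
      by (intro isCont_tendsto_compose[of x \<mu>]) (use cont in \<open>auto simp: continuous_on_eq_continuous_at\<close>)
    then have "(\<lambda>n. ennreal (\<mu> (x + (1 / Suc n) *\<^sub>R z) * gauss 1 z)) \<longlonglongrightarrow> ennreal (\<mu> x * gauss 1 z)"
      by (intro tendsto_ennrealI tendsto_intros)
    from lim_imp_Liminf[OF sequentially_bot this]
    show "ennreal (\<mu> x) * ennreal (gauss 1 z) = liminf (\<lambda>n. ennreal (\<mu> (x + (1 / Suc n) *\<^sub>R z) * gauss 1 z))"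
      by (simp only: ennreal_mult[OF nn[of x] gauss_nonneg])
  qed
  also have "\<dots> \<le> liminf (\<lambda>n. \<integral>\<^sup>+z. ennreal (\<mu> (x + (1 / Suc n) *\<^sub>R z) * gauss 1 z) \<partial>lborel)"
    by (rule nn_integral_liminf) measurable
  also have "\<dots> = liminf (\<lambda>n. \<integral>\<^sup>+y. ennreal (\<mu> y * gauss (1 / Suc n) (x - y)) \<partial>lborel)"
    by (simp add: eq)
  also have "\<dots> = ennreal r" by (rule lim_imp_Liminf[OF sequentially_bot lim])
  finally show ?thesis using r by simp
qed

lemma gauss_vec: "gauss \<sigma> (z :: real ^ 'n::finite) = (\<Prod>i\<in>UNIV. normal_density 0 \<sigma> (z $ i))"
proof -
  have "inj (\<lambda>i::'n. axis i (1::real))" by (auto simp: inj_on_def axis_eq_axis)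
  then show ?thesis unfolding gauss_def Basis_axes by (subst prod.reindex) (auto simp: inner_axis)
qed

text \<open>Both sides equal the expectation of \<open>gauss a (x - Y t)\<close>: the left by the
  density of \<open>Y t\<close>, the right by writing \<open>Y t\<close> as
  \<open>exp (- t) Y 0\<close> plus the pathwise limit of the sums S m, which are independent of
  \<open>Y 0\<close>. The bounded continuous kernel carries the limit through the
  expectation.\<close>

lemma ou_mollified_density:
  fixes p :: "real ^ 'n::finite \<Rightarrow> real" and M :: "'w measure"
  assumes ou: "ornstein_uhlenbeck M B p Y" and md: "marginal_densities M Y \<mu>"
    and pm[measurable]: "p \<in> borel_measurable borel" and p0: "\<And>y. 0 \<le> p y" and t: "0 < t" and a: "0 < a"
  shows "(\<integral>\<^sup>+y. ennreal (\<mu> t y * gauss a (x - y)) \<partial>lborel) =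
    (\<integral>\<^sup>+y. ennreal (p y * gauss (sqrt (a\<^sup>2 + (1 - exp (- 2 * t)))) (x - exp (- t) *\<^sub>R y)) \<partial>lborel)"
proof -
  have bm: "brownian_motion M B" using ou by (simp add: ornstein_uhlenbeck_def)
  interpret prob_space M using bm by (simp add: brownian_motion_def)
  have Bm: "B u \<in> borel_measurable M" if "0 \<le> u" for u using bm that by (simp add: brownian_motion_def)
  have Ym: "Y u \<in> borel_measurable M" if "0 \<le> u" for u using ou that by (simp add: ornstein_uhlenbeck_def)
  have dist: "distributed M lborel (\<lambda>\<omega>. B v \<omega> - B u \<omega>) (\<lambda>x. ennreal (\<Prod>i\<in>UNIV. normal_density 0 (sqrt (v - u)) (x $ i)))"
    if "0 \<le> u" "u < v" for u v using bm that by (simp add: brownian_motion_def)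
  define \<tau> where "\<tau> = (\<lambda>m j. t * real j / real (Suc m))"
  \<comment> \<open>Left endpoint values of the integrand \<open>sqrt 2 * exp (u - t)\<close> in the
    formal solution of the equation.\<close>
  define w where "w = (\<lambda>m j. sqrt 2 * exp (\<tau> m j - t))"
  define \<Delta> where "\<Delta> = (\<lambda>m j \<omega>. B (\<tau> m (Suc j)) \<omega> - B (\<tau> m j) \<omega>)"
  define S where "S = (\<lambda>m \<omega>. \<Sum>j<Suc m. w m j *\<^sub>R \<Delta> m j \<omega>)"
  define V where "V = (\<lambda>m. \<Sum>j<Suc m. (w m j)\<^sup>2 * (t / real (Suc m)))"
  define s where "s = exp (- t)"
  have \<tau>0: "0 \<le> \<tau> m j" for m j using t by (simp add: \<tau>_def)
  have [measurable]: "S m \<in> borel_measurable M" for m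
    unfolding S_def \<Delta>_def by (intro borel_measurable_sum borel_measurable_scaleR borel_measurable_diff Bm \<tau>0) auto
  have [measurable]: "Y 0 \<in> borel_measurable M" "Y t \<in> borel_measurable M" using t by (auto intro: Ym)
  have V0: "0 \<le> V m" for m unfolding V_def using t by (intro sum_nonneg) auto
  have Vlim: "V \<longlonglongrightarrow> 1 - exp (- 2 * t)"
    unfolding V_def w_def \<tau>_def by (rule ou_variance_sum[OF t])
  have noise: "(\<integral>\<^sup>+\<omega>. ennreal (gauss a (z - S m \<omega>)) \<partial>M) = ennreal (gauss (sqrt (a\<^sup>2 + V m)) z)" for m z
  proof -
    define h where "h = t / real (Suc m)"
    have h: "0 < h" using t by (simp add: h_def)
    have "(\<integral>\<^sup>+\<omega>. ennreal (gauss a (z - (\<Sum>j<Suc m. w m j *\<^sub>R \<Delta> m j \<omega>))) \<partial>M) =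
      ennreal (gauss (sqrt (a\<^sup>2 + (\<Sum>j<Suc m. (w m j)\<^sup>2 * (sqrt h)\<^sup>2))) z)"
    proof (rule indep_gauss_sum)
      have "mono (\<tau> m)" using t by (auto simp: \<tau>_def intro!: monoI divide_right_mono)
      then show "indep_vars (\<lambda>_. borel) (\<Delta> m) {..<Suc m}"
        using bm \<tau>0[of m 0] unfolding \<Delta>_def brownian_motion_def by blast
      show "distributed M lborel (\<Delta> m j) (\<lambda>z. ennreal (gauss (sqrt h) z))" for j
      proof -
        have "\<tau> m (Suc j) - \<tau> m j = h" by (simp add: \<tau>_def h_def diff_divide_distrib[symmetric] algebra_simps)
        moreover have "\<tau> m j < \<tau> m (Suc j)" using calculation h by linarith
        ultimately show ?thesis
          using dist[OF \<tau>0[of m j], of "\<tau> m (Suc j)"] by (simp add: \<Delta>_def gauss_vec)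
      qed
    qed (use h a in \<open>auto simp: w_def\<close>)
    then show ?thesis by (simp only: S_def V_def h_def[symmetric] real_sqrt_pow2[OF less_imp_le[OF h]])
  qed
  \<comment> \<open>S m is a function of finitely many B u, hence measurable for the sigma-algebra
    of B, which is independent of that of \<open>Y 0\<close>.\<close>
  have ind: "indep_var borel (Y 0) borel (S m)" for m
  proof -
    let ?P = "\<Pi>\<^sub>M u\<in>{0::real..}. (borel :: (real ^ 'n) measure)"
    let ?VB = "vimage_algebra (space M) (\<lambda>\<omega>. \<lambda>u\<in>{0..}. B u \<omega>) ?P"
    have vb: "(\<lambda>\<omega>. \<lambda>u\<in>{0..}. B u \<omega>) \<in> measurable ?VB ?P"
      by (rule measurable_vimage_algebra1) (auto simp: space_PiM)
    have "(\<lambda>\<omega>. (\<lambda>u\<in>{0..}. B u \<omega>) u) \<in> borel_measurable ?VB" if "0 \<le> u" for u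
      by (rule measurable_compose[OF vb measurable_component_singleton]) (use that in simp)
    then have BV: "B u \<in> borel_measurable ?VB" if "0 \<le> u" for u using that by fastforce
    then have SV: "S m \<in> borel_measurable ?VB"
      unfolding S_def \<Delta>_def by (intro borel_measurable_sum borel_measurable_scaleR borel_measurable_diff BV \<tau>0 measurable_const) auto
    have "sigma_sets (space M) {S m -` A \<inter> space M |A. A \<in> sets borel} \<subseteq> sets ?VB"
    proof -
      have "{S m -` A \<inter> space M |A. A \<in> sets borel} \<subseteq> sets ?VB"
        using measurable_sets[OF SV] by auto
      then show ?thesis using sets.sigma_sets_subset[of _ ?VB] by simp
    qed
    moreover have "indep_set (sets (vimage_algebra (space M) (Y 0) borel)) (sets ?VB)"
      using ou by (simp add: ornstein_uhlenbeck_def)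
    ultimately have "indep_set (sigma_sets (space M) {Y 0 -` A \<inter> space M |A. A \<in> sets borel})
        (sigma_sets (space M) {S m -` A \<inter> space M |A. A \<in> sets borel})"
      unfolding indep_set_def sets_vimage_algebra[of "space M" "Y 0"]
      by (elim indep_sets_mono_sets) (auto split: bool.split)
    then show ?thesis unfolding indep_var_eq by simp
  qed
  have Y0: "distributed M lborel (Y 0) (\<lambda>y. ennreal (p y))" using ou by (simp add: ornstein_uhlenbeck_def)
  have eq_m: "(\<integral>\<^sup>+\<omega>. ennreal (gauss a (x - s *\<^sub>R Y 0 \<omega> - S m \<omega>)) \<partial>M) =
     (\<integral>\<^sup>+y. ennreal (p y * gauss (sqrt (a\<^sup>2 + V m)) (x - s *\<^sub>R y)) \<partial>lborel)" for m
  proof -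
    have "(\<integral>\<^sup>+\<omega>. ennreal (gauss a (x - s *\<^sub>R Y 0 \<omega> - S m \<omega>)) \<partial>M) =
        (\<integral>\<^sup>+\<omega>. \<integral>\<^sup>+\<omega>'. ennreal (gauss a (x - s *\<^sub>R Y 0 \<omega> - S m \<omega>')) \<partial>M \<partial>M)"
      by (rule indep_nn_integral[OF ind]) measurable
    also have "\<dots> = (\<integral>\<^sup>+\<omega>. ennreal (gauss (sqrt (a\<^sup>2 + V m)) (x - s *\<^sub>R Y 0 \<omega>)) \<partial>M)"
      by (simp add: noise)
    also have "\<dots> = (\<integral>\<^sup>+y. ennreal (p y) * ennreal (gauss (sqrt (a\<^sup>2 + V m)) (x - s *\<^sub>R y)) \<partial>lborel)"
      by (rule distributed_nn_integral[OF Y0, symmetric]) measurable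
    finally show ?thesis using p0 by (simp add: ennreal_mult gauss_nonneg)
  qed
  have path: "AE \<omega> in M. (\<lambda>m. S m \<omega>) \<longlonglongrightarrow> Y t \<omega> - s *\<^sub>R Y 0 \<omega>"
  proof -
    have "AE \<omega> in M. continuous_on {0..} (\<lambda>t. Y t \<omega>) \<and>
        (\<forall>t\<ge>0. Y t \<omega> = Y 0 \<omega> - integral {0..t} (\<lambda>u. Y u \<omega>) + sqrt 2 *\<^sub>R B t \<omega>)"
      using ou by (simp add: ornstein_uhlenbeck_def)
    then show ?thesis
    proof eventually_elim
      case (elim \<omega>)
      let ?y = "\<lambda>u. Y u \<omega>"
      have cont: "continuous_on {0..u} ?y" for u using elim by (auto intro: continuous_on_subset)
      \<comment> \<open>The integral equation at u and v expresses increments of B through the path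
        of Y, the form treated by \<open>ou_riemann_sum\<close>.\<close>
      have inc: "sqrt 2 *\<^sub>R (B v \<omega> - B u \<omega>) = ?y v - ?y u + integral {u..v} ?y" if "0 \<le> u" "u \<le> v" for u v
      proof -
        have I: "integral {0..u} ?y + integral {u..v} ?y = integral {0..v} ?y"
          by (intro Henstock_Kurzweil_Integration.integral_combine integrable_continuous_real cont that)
        have "sqrt 2 *\<^sub>R B u \<omega> = ?y u - ?y 0 + integral {0..u} ?y" "sqrt 2 *\<^sub>R B v \<omega> = ?y v - ?y 0 + integral {0..v} ?y"
          using elim[THEN conjunct2, rule_format, of u] elim[THEN conjunct2, rule_format, of v] that
          by (simp_all add: algebra_simps)
        then show ?thesis unfolding scaleR_diff_right I[symmetric] by simp
      qed
      have "S m \<omega> = (\<Sum>j<Suc m. exp (\<tau> m j - t) *\<^sub>R (?y (\<tau> m (Suc j)) - ?y (\<tau> m j) + integral {\<tau> m j..\<tau> m (Suc j)} ?y))" for m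
        unfolding S_def
      proof (rule sum.cong[OF refl])
        fix j
        have "\<tau> m j \<le> \<tau> m (Suc j)" using t by (auto simp: \<tau>_def intro!: divide_right_mono)
        have "w m j *\<^sub>R \<Delta> m j \<omega> = exp (\<tau> m j - t) *\<^sub>R (sqrt 2 *\<^sub>R (B (\<tau> m (Suc j)) \<omega> - B (\<tau> m j) \<omega>))"
          by (simp add: w_def \<Delta>_def)
        also have "\<dots> = exp (\<tau> m j - t) *\<^sub>R (?y (\<tau> m (Suc j)) - ?y (\<tau> m j) + integral {\<tau> m j..\<tau> m (Suc j)} ?y)"
          by (simp only: inc[OF \<tau>0 \<open>\<tau> m j \<le> \<tau> m (Suc j)\<close>])
        finally show "w m j *\<^sub>R \<Delta> m j \<omega> = exp (\<tau> m j - t) *\<^sub>R (?y (\<tau> m (Suc j)) - ?y (\<tau> m j) + integral {\<tau> m j..\<tau> m (Suc j)} ?y)" .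
      qed
      then show ?case
        using ou_riemann_sum[OF t cont] unfolding \<tau>_def s_def by simp
    qed
  qed
  \<comment> \<open>G is the maximum of \<open>gauss a\<close>, an integrable majorant on the
    probability space; the wider kernels of variance \<open>a\<^sup>2 + V m\<close> lie below it as
    well.\<close>
  define G where "G = (1 / sqrt (2 * pi * a\<^sup>2)) ^ DIM(real ^ 'n)"
  have G0: "0 \<le> G" unfolding G_def by simp
  have lim1: "(\<lambda>m. \<integral>\<^sup>+\<omega>. ennreal (gauss a (x - s *\<^sub>R Y 0 \<omega> - S m \<omega>)) \<partial>M) \<longlonglongrightarrow> (\<integral>\<^sup>+\<omega>. ennreal (gauss a (x - Y t \<omega>)) \<partial>M)"
  proof (rule nn_integral_dominated_convergence[where w = "\<lambda>_. ennreal G"])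
    show "AE \<omega> in M. ennreal (gauss a (x - s *\<^sub>R Y 0 \<omega> - S m \<omega>)) \<le> ennreal G" for m
      unfolding G_def by (intro AE_I2 ennreal_leI gauss_le a)
    show "AE \<omega> in M. (\<lambda>m. ennreal (gauss a (x - s *\<^sub>R Y 0 \<omega> - S m \<omega>))) \<longlonglongrightarrow> ennreal (gauss a (x - Y t \<omega>))"
      using path
    proof eventually_elim
      case (elim \<omega>)
      then have "(\<lambda>m. x - s *\<^sub>R Y 0 \<omega> - S m \<omega>) \<longlonglongrightarrow> x - s *\<^sub>R Y 0 \<omega> - (Y t \<omega> - s *\<^sub>R Y 0 \<omega>)"
        by (intro tendsto_intros)
      then have "(\<lambda>m. x - s *\<^sub>R Y 0 \<omega> - S m \<omega>) \<longlonglongrightarrow> x - Y t \<omega>" by simp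
      then show ?case
        by (intro tendsto_ennrealI isCont_tendsto_compose[of _ "gauss a"])
          (use continuous_gauss[of a] in \<open>auto simp: continuous_on_eq_continuous_at\<close>)
    qed
    show "(\<integral>\<^sup>+\<omega>. ennreal G \<partial>M) < \<infinity>" by (simp add: emeasure_space_1)
  qed measurable
  have p1: "(\<integral>\<^sup>+y. ennreal (p y) \<partial>lborel) = 1"
    using distributed_nn_integral[OF Y0, of "\<lambda>_. 1"] by (simp add: emeasure_space_1)
  have lim2: "(\<lambda>m. \<integral>\<^sup>+y. ennreal (p y * gauss (sqrt (a\<^sup>2 + V m)) (x - s *\<^sub>R y)) \<partial>lborel) \<longlonglongrightarrow>
      (\<integral>\<^sup>+y. ennreal (p y * gauss (sqrt (a\<^sup>2 + (1 - exp (- 2 * t)))) (x - s *\<^sub>R y)) \<partial>lborel)"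
  proof (rule nn_integral_dominated_convergence[where w = "\<lambda>y. ennreal (p y * G)"])
    show "AE y in lborel. ennreal (p y * gauss (sqrt (a\<^sup>2 + V m)) (x - s *\<^sub>R y)) \<le> ennreal (p y * G)" for m
    proof (intro AE_I2 ennreal_leI mult_left_mono p0)
      fix y
      have b': "0 < a\<^sup>2 + V m" using a V0[of m] by (intro add_pos_nonneg) auto
      then have b: "0 < sqrt (a\<^sup>2 + V m)" by (rule real_sqrt_gt_zero)
      have "gauss (sqrt (a\<^sup>2 + V m)) (x - s *\<^sub>R y) \<le> (1 / sqrt (2 * pi * (sqrt (a\<^sup>2 + V m))\<^sup>2)) ^ DIM(real ^ 'n)"
        by (rule gauss_le[OF b])
      also have "\<dots> \<le> G"
        unfolding G_def using a V0[of m] b'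
        by (intro power_mono divide_left_mono real_sqrt_le_mono mult_left_mono) (auto intro: real_le_rsqrt)
      finally show "gauss (sqrt (a\<^sup>2 + V m)) (x - s *\<^sub>R y) \<le> G" .
    qed
    have "0 < a\<^sup>2 + (1 - exp (- 2 * t))" using a t by (simp add: add_pos_nonneg)
    then show "AE y in lborel. (\<lambda>m. ennreal (p y * gauss (sqrt (a\<^sup>2 + V m)) (x - s *\<^sub>R y))) \<longlonglongrightarrow>
        ennreal (p y * gauss (sqrt (a\<^sup>2 + (1 - exp (- 2 * t)))) (x - s *\<^sub>R y))"
      by (intro AE_I2 tendsto_ennrealI tendsto_mult tendsto_const gauss_tendsto tendsto_real_sqrt tendsto_add Vlim) simp
    show "(\<integral>\<^sup>+y. ennreal (p y * G) \<partial>lborel) < \<infinity>"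
      using p0 G0 p1 by (simp add: ennreal_mult nn_integral_multc)
  qed measurable
  have Yt: "distributed M lborel (Y t) (\<lambda>y. ennreal (\<mu> t y))" and \<mu>0: "\<And>y. 0 \<le> \<mu> t y"
    using md t by (auto simp: marginal_densities_def)
  have "(\<integral>\<^sup>+\<omega>. ennreal (gauss a (x - Y t \<omega>)) \<partial>M) = (\<integral>\<^sup>+y. ennreal (\<mu> t y) * ennreal (gauss a (x - y)) \<partial>lborel)"
    by (rule distributed_nn_integral[OF Yt, symmetric]) measurable
  then have "(\<integral>\<^sup>+\<omega>. ennreal (gauss a (x - Y t \<omega>)) \<partial>M) = (\<integral>\<^sup>+y. ennreal (\<mu> t y * gauss a (x - y)) \<partial>lborel)"
    using \<mu>0 by (simp add: ennreal_mult gauss_nonneg)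
  then show ?thesis
    using LIMSEQ_unique[OF lim1[unfolded eq_m] lim2] by (simp add: s_def)
qed

text \<open>As the width a tends to 0, \<open>density_le_mollification_limit\<close> gives
  \<open>\<mu> t \<le> \<rho>\<close> pointwise. Both have total mass 1, so they agree almost
  everywhere, and by continuity everywhere.\<close>

lemma ou_marginal_density:
  fixes p :: "real ^ 'n::finite \<Rightarrow> real" and M :: "'w measure"
  assumes ou: "ornstein_uhlenbeck M B p Y" and md: "marginal_densities M Y \<mu>"
    and pm[measurable]: "p \<in> borel_measurable borel" and p0: "\<And>y. 0 \<le> p y" and t: "0 < t"
  defines "\<rho> \<equiv> \<lambda>x. \<integral>y. p y * gauss (sqrt (1 - exp (- 2 * t))) (x - exp (- t) *\<^sub>R y) \<partial>lborel"
  assumes cont: "continuous_on UNIV \<rho>"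
  shows "\<mu> t x = \<rho> x"
proof -
  define \<sigma> where "\<sigma> = sqrt (1 - exp (- 2 * t))"
  define s where "s = exp (- t)"
  have \<sigma>: "0 < \<sigma>" using t by (simp add: \<sigma>_def)
  have \<sigma>2: "\<sigma>\<^sup>2 = 1 - exp (- 2 * t)" using t by (simp add: \<sigma>_def)
  interpret prob_space M using ou by (simp add: ornstein_uhlenbeck_def brownian_motion_def)
  have Y0: "distributed M lborel (Y 0) (\<lambda>y. ennreal (p y))" using ou by (simp add: ornstein_uhlenbeck_def)
  have Yt: "distributed M lborel (Y t) (\<lambda>y. ennreal (\<mu> t y))" and \<mu>0: "\<And>y. 0 \<le> \<mu> t y"
    and \<mu>c: "continuous_on UNIV (\<mu> t)"
    using md t by (auto simp: marginal_densities_def)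
  have [measurable]: "\<mu> t \<in> borel_measurable borel" "\<rho> \<in> borel_measurable borel"
    by (intro borel_measurable_continuous_onI \<mu>c cont)+
  have p1: "(\<integral>\<^sup>+y. ennreal (p y) \<partial>lborel) = 1"
    using distributed_nn_integral[OF Y0, of "\<lambda>_. 1"] by (simp add: emeasure_space_1)
  have \<mu>1: "(\<integral>\<^sup>+y. ennreal (\<mu> t y) \<partial>lborel) = 1"
    using distributed_nn_integral[OF Yt, of "\<lambda>_. 1"] by (simp add: emeasure_space_1)
  have \<rho>: "ennreal (\<rho> x) = (\<integral>\<^sup>+y. ennreal (p y * gauss \<sigma> (x - s *\<^sub>R y)) \<partial>lborel)" for x
  proof -
    define G where "G = (1 / sqrt (2 * pi * \<sigma>\<^sup>2)) ^ DIM(real ^ 'n)"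
    have pi: "integrable lborel p" by (rule integrableI_nonneg) (use p0 p1 in auto)
    have "integrable lborel (\<lambda>y. p y * gauss \<sigma> (x - s *\<^sub>R y))"
    proof (rule Bochner_Integration.integrable_bound)
      show "integrable lborel (\<lambda>y. p y * G)" using pi by simp
      show "AE y in lborel. norm (p y * gauss \<sigma> (x - s *\<^sub>R y)) \<le> norm (p y * G)"
      proof (rule AE_I2)
        fix y
        have "gauss \<sigma> (x - s *\<^sub>R y) \<le> G" unfolding G_def by (rule gauss_le[OF \<sigma>])
        then have "p y * gauss \<sigma> (x - s *\<^sub>R y) \<le> p y * G" by (rule mult_left_mono[OF _ p0])
        then show "norm (p y * gauss \<sigma> (x - s *\<^sub>R y)) \<le> norm (p y * G)"
          using p0[of y] gauss_nonneg[of \<sigma> "x - s *\<^sub>R y"] by simp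
      qed
    qed measurable
    then show ?thesis
      unfolding \<rho>_def \<sigma>_def[symmetric] s_def[symmetric]
      by (intro nn_integral_eq_integral[symmetric]) (use p0 in \<open>auto simp: gauss_nonneg\<close>)
  qed
  have \<rho>0: "0 \<le> \<rho> x" for x
    unfolding \<rho>_def by (intro Bochner_Integration.integral_nonneg mult_nonneg_nonneg p0 gauss_nonneg)
  have le: "\<mu> t x \<le> \<rho> x" for x
  proof (rule density_le_mollification_limit[OF \<mu>c \<mu>0 _ \<rho>0])
    have "(\<lambda>n. \<integral>\<^sup>+y. ennreal (p y * gauss (sqrt ((1 / Suc n)\<^sup>2 + \<sigma>\<^sup>2)) (x - s *\<^sub>R y)) \<partial>lborel) \<longlonglongrightarrow>
       (\<integral>\<^sup>+y. ennreal (p y * gauss \<sigma> (x - s *\<^sub>R y)) \<partial>lborel)"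
    proof (rule nn_integral_dominated_convergence[where w = "\<lambda>y. ennreal (p y * (1 / sqrt (2 * pi * \<sigma>\<^sup>2)) ^ DIM(real ^ 'n))"])
      show "AE y in lborel. ennreal (p y * gauss (sqrt ((1 / Suc n)\<^sup>2 + \<sigma>\<^sup>2)) (x - s *\<^sub>R y)) \<le> ennreal (p y * (1 / sqrt (2 * pi * \<sigma>\<^sup>2)) ^ DIM(real ^ 'n))" for n
      proof (intro AE_I2 ennreal_leI mult_left_mono p0)
        fix y
        have b': "0 < (1 / Suc n)\<^sup>2 + \<sigma>\<^sup>2" using \<sigma> by (intro add_nonneg_pos) auto
        then have b: "0 < sqrt ((1 / Suc n)\<^sup>2 + \<sigma>\<^sup>2)" by (rule real_sqrt_gt_zero)
        have "gauss (sqrt ((1 / Suc n)\<^sup>2 + \<sigma>\<^sup>2)) (x - s *\<^sub>R y) \<le> (1 / sqrt (2 * pi * (sqrt ((1 / Suc n)\<^sup>2 + \<sigma>\<^sup>2))\<^sup>2)) ^ DIM(real ^ 'n)"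
          by (rule gauss_le[OF b])
        also have "\<dots> \<le> (1 / sqrt (2 * pi * \<sigma>\<^sup>2)) ^ DIM(real ^ 'n)"
          using \<sigma> real_sqrt_gt_zero[OF b']
          by (intro power_mono divide_left_mono real_sqrt_le_mono mult_left_mono) (auto simp: real_sqrt_mult)
        finally show "gauss (sqrt ((1 / Suc n)\<^sup>2 + \<sigma>\<^sup>2)) (x - s *\<^sub>R y) \<le> (1 / sqrt (2 * pi * \<sigma>\<^sup>2)) ^ DIM(real ^ 'n)" .
      qed
      have "(\<lambda>n. 1 / real (Suc n)) \<longlonglongrightarrow> 0" using LIMSEQ_inverse_real_of_nat by (simp add: inverse_eq_divide)
      then have "(\<lambda>n. sqrt ((1 / Suc n)\<^sup>2 + \<sigma>\<^sup>2)) \<longlonglongrightarrow> sqrt (0\<^sup>2 + \<sigma>\<^sup>2)" by (intro tendsto_intros)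
      then have "(\<lambda>n. sqrt ((1 / Suc n)\<^sup>2 + \<sigma>\<^sup>2)) \<longlonglongrightarrow> \<sigma>" using \<sigma> by simp
      then show "AE y in lborel. (\<lambda>n. ennreal (p y * gauss (sqrt ((1 / Suc n)\<^sup>2 + \<sigma>\<^sup>2)) (x - s *\<^sub>R y))) \<longlonglongrightarrow> ennreal (p y * gauss \<sigma> (x - s *\<^sub>R y))"
        by (intro AE_I2 tendsto_ennrealI tendsto_mult tendsto_const gauss_tendsto \<sigma>)
      show "(\<integral>\<^sup>+y. ennreal (p y * (1 / sqrt (2 * pi * \<sigma>\<^sup>2)) ^ DIM(real ^ 'n)) \<partial>lborel) < \<infinity>"
        using p0 p1 by (subst ennreal_mult) (auto simp: nn_integral_multc)
    qed measurable
    then show "(\<lambda>n. \<integral>\<^sup>+y. ennreal (\<mu> t y * gauss (1 / Suc n) (x - y)) \<partial>lborel) \<longlonglongrightarrow> ennreal (\<rho> x)"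
      unfolding \<rho> by (subst ou_mollified_density[OF ou md pm p0 t]) (simp_all add: \<sigma>2 s_def)
  qed
  have \<rho>1: "(\<integral>\<^sup>+x. ennreal (\<rho> x) \<partial>lborel) = 1"
  proof -
    have g1: "(\<integral>\<^sup>+x. ennreal (gauss \<sigma> (x - c)) \<partial>lborel) = 1" for c :: "real ^ 'n"
    proof -
      have "(\<integral>\<^sup>+x. ennreal (gauss \<sigma> (x - c)) \<partial>lborel) = (\<integral>\<^sup>+x. ennreal (gauss \<sigma> (x - c)) \<partial>distr lborel borel ((+) c))"
        by (simp only: lborel_distr_plus)
      also have "\<dots> = 1" by (subst nn_integral_distr) (auto simp: nn_integral_gauss[OF \<sigma>])
      finally show ?thesis .
    qed
    have "(\<integral>\<^sup>+x. ennreal (\<rho> x) \<partial>lborel) = (\<integral>\<^sup>+y. \<integral>\<^sup>+x. ennreal (p y * gauss \<sigma> (x - s *\<^sub>R y)) \<partial>lborel \<partial>lborel)"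
      unfolding \<rho> by (rule lborel_pair.Fubini') measurable
    also have "\<dots> = (\<integral>\<^sup>+y. ennreal (p y) \<partial>lborel)"
      using p0 by (simp add: ennreal_mult gauss_nonneg nn_integral_cmult g1)
    finally show ?thesis using p1 by simp
  qed
  have int: "integrable lborel \<rho>" "integrable lborel (\<mu> t)"
    by (rule integrableI_nonneg; use \<rho>0 \<mu>0 \<rho>1 \<mu>1 in auto)+
  have "(\<integral>x. \<rho> x - \<mu> t x \<partial>lborel) = 0"
    using int \<rho>1 \<mu>1 by (simp add: integral_eq_nn_integral \<rho>0 \<mu>0)
  then have "AE x in lborel. \<rho> x - \<mu> t x = 0"
    using int le by (subst (asm) integral_nonneg_eq_0_iff_AE) auto
  then have "\<rho> x - \<mu> t x \<le> 0"
    by (intro continuous_AE_le_imp_le continuous_intros cont \<mu>c) auto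
  then show ?thesis using le[of x] by linarith
qed

section \<open>The score\<close>

lemma has_derivative_vec_lambda:
  fixes f :: "'i::finite \<Rightarrow> 'a::euclidean_space \<Rightarrow> real"
  assumes "\<And>i. (f i has_derivative f' i) (at x)"
  shows "((\<lambda>x. \<chi> i. f i x) has_derivative (\<lambda>v. \<chi> i. f' i v)) (at x)"
proof (subst has_derivative_componentwise_within, intro ballI)
  fix b :: "real ^ 'i" assume "b \<in> Basis"
  then obtain i where "b = axis i 1" by (auto simp: Basis_axes)
  then show "((\<lambda>x. (\<chi> i. f i x) \<bullet> b) has_derivative (\<lambda>v. (\<chi> i. f' i v) \<bullet> b)) (at x)"
    using assms[of i] by (simp add: inner_axis)
qed

lemma times_differentiable_vec_lambda:
  fixes f :: "'i::finite \<Rightarrow> 'a::euclidean_space \<Rightarrow> real"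
  shows "(\<And>i. smooth (f i)) \<Longrightarrow> times_differentiable m (\<lambda>x. \<chi> i. f i x)"
proof (induction m arbitrary: f)
  case (Suc m)
  show ?case
    by (rule times_differentiable_SucI[OF has_derivative_vec_lambda[OF smooth_has_derivative]])
      (auto intro!: Suc smooth_frechet)
qed simp

lemma dir_deriv_vec_lambda:
  fixes f :: "'i::finite \<Rightarrow> 'a::euclidean_space \<Rightarrow> real"
  shows "(\<And>i. smooth (f i)) \<Longrightarrow> dir_deriv vs (\<lambda>x. \<chi> i. f i x) x = (\<chi> i. dir_deriv vs (f i) x)"
proof (induction vs arbitrary: f)
  case (Cons v vs)
  have "(\<lambda>x. frechet_derivative (\<lambda>x. \<chi> i. f i x) (at x) v) = (\<lambda>x. \<chi> i. frechet_derivative (f i) (at x) v)"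
    by (intro ext frechet_derivative_eqI has_derivative_vec_lambda smooth_has_derivative Cons.prems)
  then show ?case using Cons.IH[of "\<lambda>i x. frechet_derivative (f i) (at x) v"] Cons.prems by (simp add: smooth_frechet)
qed simp

lemma norm_vec_lambda_le:
  fixes f :: "'i::finite \<Rightarrow> real"
  assumes "\<And>i. \<bar>f i\<bar> \<le> A" shows "norm (\<chi> i. f i) \<le> real CARD('i) * A"
proof -
  have "norm (\<chi> i. f i) \<le> (\<Sum>i\<in>UNIV. \<bar>f i\<bar>)" using norm_le_l1_cart[of "\<chi> i. f i"] by simp
  also have "\<dots> \<le> (\<Sum>i\<in>(UNIV :: 'i set). A)" by (intro sum_mono assms)
  finally show ?thesis by simp
qed

lemma frechet_half_square:
  "frechet_derivative (\<lambda>x. - (1 / 2) * (x \<bullet> x)) (at x) v = - (v \<bullet> x)"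
  by (rule frechet_derivative_eqI) (auto intro!: derivative_eq_intros simp: inner_commute)

text \<open>The Hessian is minus the identity and higher derivatives vanish, so the linear drift
  adds at most 1 to each component of a derivative of the score of positive order.\<close>

lemma dir_deriv_half_square_bound:
  assumes "norm u \<le> 1" "norm v \<le> 1"
  shows "\<bar>dir_deriv (u # v # vs) (\<lambda>x. - (1 / 2) * (x \<bullet> x)) x\<bar> \<le> 1"
proof -
  have "frechet_derivative (\<lambda>x. - (u \<bullet> x)) (at x) v = - (u \<bullet> v)" for x
    by (rule frechet_derivative_eqI) (auto intro!: derivative_eq_intros)
  then have eq: "dir_deriv (u # v # vs) (\<lambda>x. - (1 / 2) * (x \<bullet> x)) x = dir_deriv vs (\<lambda>x. - (u \<bullet> v)) x"
    by (simp only: dir_deriv.simps frechet_half_square)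
  show ?thesis
  proof (cases vs)
    case Nil
    have "\<bar>u \<bullet> v\<bar> \<le> norm u * norm v" by (rule Cauchy_Schwarz_ineq2)
    also have "\<dots> \<le> 1 * 1" using assms by (intro mult_mono) auto
    finally show ?thesis using eq Nil by simp
  next
    case (Cons w ws)
    then show ?thesis using eq by (simp only: dir_deriv_const)
  qed
qed

text \<open>Detailed balance: the transition kernel of the process is reversible for the standard
  Gaussian. This exchanges x and y in the kernel and pulls the Gaussian factor in x out of the
  integral.\<close>

lemma tilted_gauss_eq:
  fixes x y :: "'a::euclidean_space"
  assumes "0 < \<sigma>" "s\<^sup>2 + \<sigma>\<^sup>2 = 1"
  shows "exp (- ((norm y)\<^sup>2 / 2) + c) * gauss \<sigma> (x - s *\<^sub>R y) = exp (- (1 / 2) * (x \<bullet> x)) * (exp c * gauss \<sigma> (y - s *\<^sub>R x))"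
proof -
  define X Y W where "X = x \<bullet> x" and "Y = y \<bullet> y" and "W = x \<bullet> y"
  have i: "(x - s *\<^sub>R y) \<bullet> (x - s *\<^sub>R y) = X - 2 * s * W + s\<^sup>2 * Y" "(y - s *\<^sub>R x) \<bullet> (y - s *\<^sub>R x) = Y - 2 * s * W + s\<^sup>2 * X"
    by (simp_all add: X_def Y_def W_def inner_diff_left inner_diff_right inner_commute power2_eq_square)
  have s: "s\<^sup>2 = 1 - \<sigma>\<^sup>2" using assms(2) by simp
  have "- (Y / 2) + - (X - 2 * s * W + s\<^sup>2 * Y) / (2 * \<sigma>\<^sup>2) = - (1 / 2) * X + - (Y - 2 * s * W + s\<^sup>2 * X) / (2 * \<sigma>\<^sup>2)"
    unfolding s using assms(1) by (simp add: field_simps)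
  then have "exp (- (Y / 2) + c) * exp (- (X - 2 * s * W + s\<^sup>2 * Y) / (2 * \<sigma>\<^sup>2)) =
      exp (- (1 / 2) * X) * (exp c * exp (- (Y - 2 * s * W + s\<^sup>2 * X) / (2 * \<sigma>\<^sup>2)))"
    unfolding exp_add[symmetric] by (simp add: algebra_simps)
  then show ?thesis
    unfolding gauss_eq i by (simp add: X_def[symmetric] Y_def[symmetric] power2_norm_eq_inner mult_ac)
qed

text \<open>The smoothing factor is \<open>Q_s r\<close> with \<open>s = exp (- t)\<close>, up to
  the normalization \<open>(2 pi)^(d/2)\<close> of the standard Gaussian, which the logarithmic
  derivative does not see.\<close>

lemma ou_density_formula:
  fixes a :: "real ^ 'n::finite \<Rightarrow> real" and M :: "'w measure"
  assumes ou: "ornstein_uhlenbeck M B p Y" and md: "marginal_densities M Y \<mu>"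
    and p: "\<And>x. p x = exp (- ((norm x)\<^sup>2 / 2) + a x)"
    and a: "continuous_on UNIV a" "\<And>x. \<bar>a x\<bar> \<le> K" and t: "0 < t"
  shows "\<mu> t = (\<lambda>x. exp (- (1 / 2) * (x \<bullet> x)) * smoothing (exp (- t)) (sqrt (1 - exp (- 2 * t))) (\<lambda>y. exp (a y)) x)"
    (is "_ = ?R")
proof
  fix x
  define s \<sigma> where "s = exp (- t)" and "\<sigma> = sqrt (1 - exp (- 2 * t))"
  have \<sigma>: "0 < \<sigma>" using t by (simp add: \<sigma>_def)
  have s\<sigma>: "s\<^sup>2 + \<sigma>\<^sup>2 = 1" using t by (simp add: s_def \<sigma>_def exp_double[symmetric])
  have am: "a \<in> borel_measurable borel" by (rule borel_measurable_continuous_onI[OF a(1)])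
  have le: "a y \<le> K" for y using a(2)[of y] by linarith
  have eg: "exp_growth (\<lambda>y. exp (a y))"
    by (rule exp_growth_bounded[of _ "exp K"]) (use am le in auto)
  have eq: "(\<integral>y. p y * gauss \<sigma> (x - s *\<^sub>R y) \<partial>lborel) = ?R x" for x
    unfolding s_def[symmetric] \<sigma>_def[symmetric] p tilted_gauss_eq[OF \<sigma> s\<sigma>] smoothing_def
    by (rule integral_mult_right_zero)
  have "smooth ?R"
    unfolding s_def[symmetric] \<sigma>_def[symmetric]
    by (intro smooth_mult smooth_exp smooth_cmult smooth_inner_self smooth_smoothing \<sigma> eg)
  then have "continuous_on UNIV (\<lambda>x. \<integral>y. p y * gauss \<sigma> (x - s *\<^sub>R y) \<partial>lborel)"
    unfolding eq by (rule smooth_continuous)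
  moreover have "p \<in> borel_measurable borel" unfolding p[abs_def] using am by measurable
  moreover have "0 \<le> p y" for y by (simp add: p)
  ultimately have "\<mu> t x = (\<integral>y. p y * gauss \<sigma> (x - s *\<^sub>R y) \<partial>lborel)"
    unfolding s_def \<sigma>_def by (intro ou_marginal_density[OF ou md _ _ t])
  then show "\<mu> t x = ?R x" by (simp add: eq)
qed

text \<open>From \<open>exp (- 2 t) \<le> 1 / (1 + 2 t) \<le> 1 - t / 4\<close> follows
  \<open>\<sigma> \<ge> sqrt t / 2\<close>. A power \<open>\<sigma> powr (- e)\<close> therefore
  costs a factor \<open>2 powr e\<close>, at most 4 for the exponents in use.\<close>

lemma noise_scale_bounds:
  fixes t :: real
  assumes "0 < t" "t < 1"
  defines "\<sigma> \<equiv> sqrt (1 - exp (- 2 * t))"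
  shows "0 < \<sigma>" "\<sigma> \<le> 1" "1 / \<sigma> \<le> 2 * t powr (- 1 / 2)"
    "0 \<le> \<theta> \<Longrightarrow> \<theta> < 1 \<Longrightarrow> \<sigma> powr (\<theta> - 2) \<le> 4 * t powr (\<theta> / 2 - 1)"
proof -
  show \<sigma>: "0 < \<sigma>" "\<sigma> \<le> 1" using assms by (simp_all add: \<sigma>_def)
  have "1 + 2 * t \<le> exp (2 * t)" by (rule exp_ge_add_one_self)
  then have "exp (- 2 * t) \<le> 1 / (1 + 2 * t)"
    using assms(1) by (simp add: exp_minus inverse_eq_divide frac_le)
  also have "\<dots> \<le> 1 - t / 4"
  proof -
    have "t * (7 - 2 * t) \<ge> 0" using assms by simp
    moreover have "(1 - t / 4) * (1 + 2 * t) = 1 + t * (7 - 2 * t) / 4" by (simp add: field_simps)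
    ultimately have "1 \<le> (1 - t / 4) * (1 + 2 * t)" by simp
    then show ?thesis using assms by (subst pos_divide_le_eq) auto
  qed
  finally have "sqrt (t / 4) \<le> \<sigma>" unfolding \<sigma>_def by simp
  then have le: "t powr (1 / 2) / 2 \<le> \<sigma>" using assms by (simp add: real_sqrt_divide powr_half_sqrt)
  have b: "\<sigma> powr (- e) \<le> 2 powr e * t powr (- (e / 2))" if "0 \<le> e" for e
  proof -
    have "\<sigma> powr (- e) \<le> (t powr (1 / 2) / 2) powr (- e)"
      using le that assms by (intro powr_mono2') auto
    also have "\<dots> = 2 powr e * t powr (- (e / 2))"
      using assms by (simp add: powr_divide powr_powr powr_minus_divide)
    finally show ?thesis .
  qed
  show "1 / \<sigma> \<le> 2 * t powr (- 1 / 2)" using b[of 1] \<sigma> by (simp add: powr_minus_divide)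
  assume \<theta>: "0 \<le> \<theta>" "\<theta> < 1"
  have "2 powr (2 - \<theta>) \<le> 2 powr 2" using \<theta> by (intro powr_mono) auto
  then have "2 powr (2 - \<theta>) * t powr (\<theta> / 2 - 1) \<le> 4 * t powr (\<theta> / 2 - 1)"
    by (intro mult_right_mono) (simp_all add: powr_numeral)
  then show "\<sigma> powr (\<theta> - 2) \<le> 4 * t powr (\<theta> / 2 - 1)"
    using b[of "2 - \<theta>"] \<theta> by (simp add: diff_divide_distrib)
qed

text \<open>For t < 1 the factor \<open>exp (- t)\<close> is at least 1/3, so it is bought by a
  factor 3; with the 4 from \<open>noise_scale_bounds\<close> this makes 12.\<close>

lemma final_ennreal_bound:
  assumes "0 \<le> A" "X \<le> 4 * A * P" "0 \<le> P" "0 < t" "t < 1" "12 * A \<le> C"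
  shows "ennreal X \<le> ennreal (C * exp (- t)) * (1 + ennreal P)"
proof -
  have C: "0 \<le> C" using assms by linarith
  have "exp (- 1) \<le> exp (- t)" using assms by simp
  moreover have "1 / 3 \<le> exp (- 1 :: real)" using exp_le by (simp add: exp_minus inverse_eq_divide frac_le)
  ultimately have e: "1 / 3 \<le> exp (- t)" by linarith
  have "X \<le> (C / 3) * P" using assms mult_right_mono[OF assms(6,3)] by simp
  also have "\<dots> \<le> (C * exp (- t)) * (1 + P)"
    using C e assms(3) mult_left_mono[OF e C] by (intro mult_mono) auto
  finally have "ennreal X \<le> ennreal ((C * exp (- t)) * (1 + P))" by (rule ennreal_leI)
  also have "\<dots> = ennreal (C * exp (- t)) * (1 + ennreal P)"
    using C assms(3) by (simp add: ennreal_mult ennreal_plus)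
  finally show ?thesis .
qed

text \<open>For t > 0 the score is -x plus a bounded field, so at order 0 the supremum is that of
  the score plus x; from order 1 on the drift contributes a bounded amount and the score itself is
  estimated. The positivity and differentiability claims ensure that \<open>grad\<close> and
  \<open>deriv_norm\<close> denote genuine derivatives and not default values of
  \<open>frechet_derivative\<close>. At t = 0 both right-hand sides are infinite.\<close>

theorem corollary4:
  fixes \<beta> K :: real
  assumes "1 \<le> \<beta>" and "0 < K"
  shows "\<exists>C>0. \<forall>(p :: real ^ 'n::finite \<Rightarrow> real) a (M :: 'w measure) B Y \<mu>.
    prob_space (density lborel (\<lambda>x. ennreal (p x))) \<and>
    (\<forall>x. p x = exp (- ((norm x)\<^sup>2 / 2) + a x)) \<and>
    a \<in> holder_class \<beta> K \<and>
    ornstein_uhlenbeck M B p Y \<and>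
    marginal_densities M Y \<mu> \<longrightarrow>
    (\<forall>t. 0 < t \<and> t < 1 \<longrightarrow>
      (\<forall>x. 0 < \<mu> t x) \<and>
      (\<forall>x. (\<lambda>y. ln (\<mu> t y)) differentiable (at x)) \<and>
      times_differentiable (nat \<lfloor>\<beta>\<rfloor> + 1) (score \<mu> t)) \<and>
    (\<forall>t. 0 \<le> t \<and> t < 1 \<longrightarrow>
      (SUP x. ennreal (norm (score \<mu> t x + x))) +
      (\<Sum>k = 1..nat \<lfloor>\<beta>\<rfloor>. SUP x. deriv_norm k (score \<mu> t) x)
        \<le> ennreal (C * exp (- t)) * (1 + neg_powr t (- 1 / 2)) \<and>
      (SUP x. deriv_norm (nat \<lfloor>\<beta>\<rfloor> + 1) (score \<mu> t) x)
        \<le> ennreal (C * exp (- t)) * (1 + neg_powr t ((\<beta> - real (nat \<lfloor>\<beta>\<rfloor>)) / 2 - 1)))"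
proof -
  define k where "k = nat \<lfloor>\<beta>\<rfloor>"
  define \<theta> where "\<theta> = \<beta> - real k"
  have k: "1 \<le> k" using assms(1) unfolding k_def by (simp add: le_nat_floor)
  have \<theta>: "0 \<le> \<theta>" "\<theta> < 1" unfolding \<theta>_def k_def using assms(1) by linarith+
  obtain D where D: "D \<ge> 0"
    "\<And>(a :: real ^ 'n \<Rightarrow> real) s \<sigma>. a \<in> holder_class \<beta> K \<Longrightarrow> 0 \<le> s \<Longrightarrow> s \<le> 1 \<Longrightarrow> 0 < \<sigma> \<Longrightarrow> \<sigma> \<le> 1 \<Longrightarrow>
      smooth (smoothing s \<sigma> (\<lambda>y. exp (a y))) \<and> (\<forall>x. 0 < smoothing s \<sigma> (\<lambda>y. exp (a y)) x) \<and>
      (\<forall>v vs x. length vs \<le> Suc k \<longrightarrow> unit_list (v # vs) \<longrightarrow>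
      \<bar>dir_deriv (v # vs) (\<lambda>x. ln (smoothing s \<sigma> (\<lambda>y. exp (a y)) x)) x\<bar> \<le> D * weight k \<theta> \<sigma> (Suc (length vs)))"
    using ln_smoothing_bounds[OF assms, where 'n = 'n] unfolding k_def[symmetric] \<theta>_def[symmetric] by metis
  \<comment> \<open>\<open>CARD('n)\<close> comes from estimating a norm by the sum of components,
    the 1 from the quadratic part of the log-density, and D from \<open>ln F\<close>. In A' the
    factor \<open>1 + k\<close> counts the orders 0 to k, and the summand 1 in C makes it
    positive.\<close>
  define A where "A = real CARD('n) * (1 + D)"
  define A' where "A' = (1 + real k) * A"
  define C where "C = 12 * A' + 1"
  have A0: "0 \<le> A" unfolding A_def using D(1) by simp
  have A': "0 \<le> A'" "A \<le> A'" using A0 mult_right_mono[of 1 "1 + real k" A] by (auto simp: A'_def)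
  have C: "0 < C" "12 * A' \<le> C" using A' by (simp_all add: C_def)
  have main: "(\<forall>x. 0 < \<mu> t x) \<and> (\<forall>x. (\<lambda>y. ln (\<mu> t y)) differentiable (at x)) \<and>
      times_differentiable (k + 1) (score \<mu> t)" (is ?th1)
    "(SUP x. ennreal (norm (score \<mu> t x + x))) + (\<Sum>k = 1..k. SUP x. deriv_norm k (score \<mu> t) x)
        \<le> ennreal (C * exp (- t)) * (1 + neg_powr t (- 1 / 2))" (is ?th2)
    "(SUP x. deriv_norm (k + 1) (score \<mu> t) x) \<le> ennreal (C * exp (- t)) * (1 + neg_powr t (\<theta> / 2 - 1))" (is ?th3)
    if p: "\<forall>x. p x = exp (- ((norm x)\<^sup>2 / 2) + a x)" and a: "a \<in> holder_class \<beta> K"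
      and ou: "ornstein_uhlenbeck M B p Y" and md: "marginal_densities M Y \<mu>" and t: "0 < t" "t < 1"
    for p a :: "real ^ 'n \<Rightarrow> real" and M :: "'w measure" and B Y \<mu> t
  proof -
    define s \<sigma> where "s = exp (- t)" and "\<sigma> = sqrt (1 - exp (- 2 * t))"
    note \<sigma> = noise_scale_bounds[OF t, folded \<sigma>_def]
    define F where "F = smoothing s \<sigma> (\<lambda>y. exp (a y))"
    have F: "smooth F" "\<And>x. 0 < F x"
      "\<And>v vs x. length vs \<le> Suc k \<Longrightarrow> unit_list (v # vs) \<Longrightarrow>
      \<bar>dir_deriv (v # vs) (\<lambda>x. ln (F x)) x\<bar> \<le> D * weight k \<theta> \<sigma> (Suc (length vs))"
      unfolding F_def using D(2)[OF a, of s \<sigma>] \<sigma>(1,2) t by (auto simp: s_def)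
    have \<mu>: "\<mu> t = (\<lambda>x. exp (- (1 / 2) * (x \<bullet> x)) * F x)"
      unfolding F_def s_def \<sigma>_def
      by (rule ou_density_formula[OF ou md _ _ _ t(1)]) (use p smoothing_holder_class(1,2)[OF a assms(2,1)] in auto)
    let ?q = "\<lambda>x :: real ^ 'n. - (1 / 2) * (x \<bullet> x)"
    define h where "h = (\<lambda>x. ?q x + ln (F x))"
    have sq: "smooth ?q" by (intro smooth_cmult smooth_inner_self)
    have sl: "smooth (\<lambda>x. ln (F x))" by (rule smooth_ln[OF F(2,1)])
    have sh: "smooth h" unfolding h_def by (intro smooth_add sq sl)
    have pos: "0 < \<mu> t x" for x using F(2) by (simp add: \<mu>)
    have ln\<mu>: "(\<lambda>y. ln (\<mu> t y)) = h"
      unfolding \<mu> h_def by (intro ext) (subst ln_mult_pos, auto simp: F(2))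
    have score: "score \<mu> t = (\<lambda>x. \<chi> i. frechet_derivative h (at x) (axis i 1))"
      by (simp add: fun_eq_iff score_def grad_def ln\<mu>)
    have "times_differentiable (k + 1) (score \<mu> t)"
      unfolding score by (intro times_differentiable_vec_lambda smooth_frechet sh)
    then show ?th1 using pos smooth_differentiable[OF sh] unfolding ln\<mu> by blast
    have ws: "1 \<le> 1 / \<sigma>" "1 / \<sigma> \<le> \<sigma> powr (\<theta> - 2)" by (rule weight_steps[OF \<sigma>(1,2) \<theta>])+
    \<comment> \<open>With weights at least 1, the contribution of the quadratic part is absorbed
      into \<open>(1 + D) * weight\<close>.\<close>
    have w1: "1 \<le> weight k \<theta> \<sigma> n" for n using ws by (auto simp: weight_def)
    have s0: "norm (score \<mu> t x + x) \<le> A" for x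
    proof -
      have "frechet_derivative h (at x) (axis i 1) + x $ i = frechet_derivative (\<lambda>x. ln (F x)) (at x) (axis i 1)" for i
        unfolding h_def
        by (subst frechet_add[OF smooth_differentiable[OF sq] smooth_differentiable[OF sl]], subst frechet_half_square)
          (simp add: inner_axis inner_commute)
      then have "score \<mu> t x + x = (\<chi> i. frechet_derivative (\<lambda>x. ln (F x)) (at x) (axis i 1))"
        by (simp add: score vec_eq_iff)
      also have "norm \<dots> \<le> real CARD('n) * D"
      proof (rule norm_vec_lambda_le)
        show "\<bar>frechet_derivative (\<lambda>x. ln (F x)) (at x) (axis i 1)\<bar> \<le> D" for i
          using F(3)[of "[]" "axis i 1" x] k by (simp add: weight_def)
      qed
      also have "\<dots> \<le> A" unfolding A_def by (intro mult_left_mono) auto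
      finally show ?thesis .
    qed
    \<comment> \<open>A derivative of order j of the score has components of order
      \<open>Suc j\<close> of the log-density, hence the weight at \<open>Suc j\<close>; j may reach
      \<open>Suc k\<close> because the bounds for \<open>ln F\<close> reach order
      \<open>k + 2\<close>.\<close>
    have dn: "deriv_norm j (score \<mu> t) x \<le> ennreal (A * weight k \<theta> \<sigma> (Suc j))" if j: "1 \<le> j" "j \<le> Suc k" for j x
      unfolding deriv_norm_def
    proof (rule SUP_least, clarsimp)
      fix vs :: "(real ^ 'n) list" assume vs: "\<forall>v\<in>set vs. norm v \<le> 1" "j = length vs"
      then obtain v ws where v: "vs = v # ws" using j by (cases vs) auto
      have "dir_deriv vs (score \<mu> t) x = (\<chi> i. dir_deriv (axis i 1 # vs) h x)"
        unfolding score by (subst dir_deriv_vec_lambda) (auto intro!: smooth_frechet sh)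
      also have "norm \<dots> \<le> real CARD('n) * ((1 + D) * weight k \<theta> \<sigma> (Suc j))"
      proof (rule norm_vec_lambda_le)
        fix i
        have "\<bar>dir_deriv (axis i 1 # vs) ?q x\<bar> \<le> 1"
          unfolding v using vs v by (intro dir_deriv_half_square_bound) auto
        moreover have "\<bar>dir_deriv (axis i 1 # vs) (\<lambda>x. ln (F x)) x\<bar> \<le> D * weight k \<theta> \<sigma> (Suc j)"
          using F(3)[of vs "axis i 1" x] vs j by (auto simp: unit_list_def)
        moreover have "dir_deriv (axis i 1 # vs) h x = dir_deriv (axis i 1 # vs) ?q x + dir_deriv (axis i 1 # vs) (\<lambda>x. ln (F x)) x"
          unfolding h_def by (rule dir_deriv_add[OF sq sl])
        ultimately show "\<bar>dir_deriv (axis i 1 # vs) h x\<bar> \<le> (1 + D) * weight k \<theta> \<sigma> (Suc j)"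
          using w1[of "Suc j"] by (simp only: distrib_right mult_1)
      qed
      finally show "ennreal (norm (dir_deriv vs (score \<mu> t) x)) \<le> ennreal (A * weight k \<theta> \<sigma> (Suc (length vs)))"
        using vs by (intro ennreal_leI) (simp add: A_def mult.assoc)
    qed
    have w2: "weight k \<theta> \<sigma> (Suc j) \<le> 1 / \<sigma>" if "j \<le> k" for j using that ws by (auto simp: weight_def)
    have "(SUP x. ennreal (norm (score \<mu> t x + x))) \<le> ennreal (A * (1 / \<sigma>))"
    proof (rule SUP_least, rule ennreal_leI)
      fix x
      have "A * 1 \<le> A * (1 / \<sigma>)" by (rule mult_left_mono[OF ws(1) A0])
      then show "norm (score \<mu> t x + x) \<le> A * (1 / \<sigma>)" using s0[of x] by linarith
    qed
    moreover have "(\<Sum>j = 1..k. SUP x. deriv_norm j (score \<mu> t) x) \<le> (\<Sum>j = 1..k. ennreal (A * (1 / \<sigma>)))"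
    proof (rule sum_mono, rule SUP_least)
      fix j x assume j: "j \<in> {1..k}"
      have "ennreal (A * weight k \<theta> \<sigma> (Suc j)) \<le> ennreal (A * (1 / \<sigma>))"
        using j by (intro ennreal_leI mult_left_mono w2 A0) auto
      then show "deriv_norm j (score \<mu> t) x \<le> ennreal (A * (1 / \<sigma>))"
        using dn[of j x] j by (meson atLeastAtMost_iff le_SucI order_trans)
    qed
    ultimately have "(SUP x. ennreal (norm (score \<mu> t x + x))) + (\<Sum>k = 1..k. SUP x. deriv_norm k (score \<mu> t) x)
        \<le> ennreal (A * (1 / \<sigma>)) + (\<Sum>j = 1..k. ennreal (A * (1 / \<sigma>)))"
      by (rule add_mono)
    also have "\<dots> = ennreal (A' * (1 / \<sigma>))"
    proof -
      have n: "0 \<le> A * (1 / \<sigma>)" using A0 \<sigma>(1) by simp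
      then have "(\<Sum>j = 1..k. ennreal (A * (1 / \<sigma>))) = ennreal (real k * (A * (1 / \<sigma>)))"
        by (subst sum_ennreal) auto
      moreover have "A' * (1 / \<sigma>) = A * (1 / \<sigma>) + real k * (A * (1 / \<sigma>))"
        unfolding A'_def by (simp only: distrib_right mult_1 mult.assoc)
      ultimately show ?thesis using n by (simp only: ennreal_plus mult_nonneg_nonneg of_nat_0_le_iff)
    qed
    also have "\<dots> \<le> ennreal (C * exp (- t)) * (1 + ennreal (t powr (- 1 / 2)))"
    proof (rule final_ennreal_bound[OF A'(1) _ _ t C(2)])
      have "A' * (1 / \<sigma>) \<le> A' * (4 * t powr (- 1 / 2))"
        using \<sigma>(3) powr_ge_zero[of t "- 1 / 2"] by (intro mult_left_mono A') linarith
      then show "A' * (1 / \<sigma>) \<le> 4 * A' * t powr (- 1 / 2)" by (simp only: mult_ac)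
    qed simp
    finally show ?th2 using t by (simp add: neg_powr_def)
    have "(SUP x. deriv_norm (k + 1) (score \<mu> t) x) \<le> ennreal (A * \<sigma> powr (\<theta> - 2))"
      using dn[of "Suc k"] by (intro SUP_least) (simp add: weight_def)
    also have "\<dots> \<le> ennreal (C * exp (- t)) * (1 + ennreal (t powr (\<theta> / 2 - 1)))"
    proof (rule final_ennreal_bound[OF A'(1) _ _ t C(2)])
      have "A * \<sigma> powr (\<theta> - 2) \<le> A' * (4 * t powr (\<theta> / 2 - 1))"
        by (intro mult_mono A' \<sigma>(4) \<theta>) auto
      then show "A * \<sigma> powr (\<theta> - 2) \<le> 4 * A' * t powr (\<theta> / 2 - 1)" by (simp only: mult_ac)
    qed simp
    finally show ?th3 using t by (simp add: neg_powr_def)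
  qed
  \<comment> \<open>At t = 0 \<open>neg_powr\<close> is infinite and C is positive, so the estimates
    there say nothing about the score.\<close>
  have zero: "ennreal (C * exp (- t)) * (1 + neg_powr t e) = \<top>" if "t = 0" for t e
    using C(1) that by (simp add: neg_powr_def ennreal_mult_eq_top_iff)
  show ?thesis
    unfolding k_def[symmetric] \<theta>_def[symmetric]
  proof (intro exI[of _ C] conjI allI impI C(1); (elim conjE)?)
    fix p a :: "real ^ 'n \<Rightarrow> real" and M :: "'w measure" and B Y \<mu> and t :: real
    assume H: "\<forall>x. p x = exp (- ((norm x)\<^sup>2 / 2) + a x)" "a \<in> holder_class \<beta> K"
      "ornstein_uhlenbeck M B p Y" "marginal_densities M Y \<mu>"
    {
      assume t: "0 < t" "t < 1"
      show "0 < \<mu> t x" "(\<lambda>y. ln (\<mu> t y)) differentiable (at x)" "times_differentiable (k + 1) (score \<mu> t)" for x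
        using main(1)[OF H t] by auto
    next
      assume t: "0 \<le> t" "t < 1"
      show "(SUP x. ennreal (norm (score \<mu> t x + x))) + (\<Sum>k = 1..k. SUP x. deriv_norm k (score \<mu> t) x)
        \<le> ennreal (C * exp (- t)) * (1 + neg_powr t (- 1 / 2))"
        "(SUP x. deriv_norm (k + 1) (score \<mu> t) x) \<le> ennreal (C * exp (- t)) * (1 + neg_powr t (\<theta> / 2 - 1))"
        using main(2,3)[OF H] t zero by (cases "t = 0"; simp)+
    }
  qed
qed

end
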